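(* Let $n,m,p$ be non-negative integers with $n>0$, let $\lambda\in\Lambda$ and let $S=(K,L,M)\in\tilde L_{n,m,p}$. Let $\chi\in\Delta_\lambda^+$ (respectively $\chi\in\Delta_\lambda^-$). Then the following statements are equivalent: (1) $S$ is $\lambda$-upperstable (respectively $\lambda$-lowerstable); (2) $S$ is $\chi$-stable; (3) $S$ is $\chi$-semistable.
   Context: $k$ is an algebraically closed field of characteristic $0$. A Lomadze system of type $(n,m,p)$ is a triple $(K,L,M)$ with $K,L\in k^{(n+p)\times n}$, $M\in k^{(n+p)\times(p+m)}$; $\tilde L_{n,m,p}$ is the vector space of these. $G=\mathrm{GL}_n\times\mathrm{GL}_{n+p}$ acts by $(g_0,g_1)\cdot(K,L,M)=(g_1Kg_0^{-1},g_1Lg_0^{-1},g_1M)$. A pair $(\chi_0,\chi_1)\in\mathbb{Z}^2$ is identified with the character $(g_0,g_1)\mapsto\det(g_0)^{\chi_0}\det(g_1)^{\chi_1}$. For a character $\theta$ of $G$, a point $S$ is $\theta$-semistable if for some $N\ge1$ there is a regular function $f$ on $\tilde L_{n,m,p}$ with $f(gx)=\theta(g)^Nf(x)$ for all $g,x$ and $f(S)\neq0$; it is $\theta$-stable if there are such $N,f$ for which moreover all $G$-orbits in $\{f\ne0\}$ are closed in $\{f\neq 0\}$ and $\dim G\cdot S=\dim G/\Delta$, where $\Delta$ is the kernel of the action. Put $[0,\infty]_{\mathbb{Q}}=\{q\in\mathbb{Q}\mid q\ge0\}\cup\{\infty\}$. For $\chi\in[0,\infty]_{\mathbb{Q}}$,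 $S$ is called $\chi$-(semi)stable if it is $(\chi_0,\chi_1)$-(semi)stable for some (equivalently every) $(\chi_0,\chi_1)\in\mathbb{Z}_{\le0}\times\mathbb{Z}_{\ge0}$, not both zero, with $\chi=-\chi_0/\chi_1$. Fractions $a/0$ with $a>0$ are $\infty$. $\Lambda=\{v/u\in[0,\infty]_{\mathbb{Q}}\mid 0\le v\le n+p,\ 0\le u\le n\}$ ($u,v$ integers, not both zero). For $\lambda\in\Lambda$: $\Delta_\lambda^-=\{\chi\in[0,\infty]_{\mathbb{Q}}\mid\chi>\lambda$ and $\chi<\lambda'$ for all $\lambda'\in\Lambda$ with $\lambda'>\lambda\}$, and $\Delta_\lambda^+=\{\chi\in[0,\infty]_{\mathbb{Q}}\mid\chi<\lambda$ and $\chi>\lambda'$ for all $\lambda'\in\Lambda$ with $\lambda'<\lambda\}$. $S=(K,L,M)$ is $\lambda$-lowerstable (respectively $\lambda$-upperstable) if for all subspaces $U\subset k^n$, $V\subset k^{n+p}$: (1) if ($\dim U>0$ or $\dim V>0$) and $K(U)+L(U)\subset V$, then $\lambda<\frac{\dim V}{\dim U}$ (respectively $\lambda\le\frac{\dim V}{\dim U}$); (2) if ($U\subsetneq k^n$ or $V\subsetneq k^{n+p}$), $K(U)+L(U)\subset V$ and $\mathrm{im}\,M\subset V$, then $\lambda\ge\frac{n+p-\dim V}{n-\dim U}$ (respectively $\lambda>\frac{n+p-\dim V}{n-\dim U}$). *)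

theory Defs
  imports
    "HOL-Analysis.Abstract_Topology"
    "HOL-Algebra.Group_Action"
    "HOL-Library.Extended"
    "HOL-Library.Extended_Nat"
    "Jordan_Normal_Form.Determinant"
    "Jordan_Normal_Form.VS_Connect"
begin

section \<open>Zariski topology and dimension\<close>

text \<open>
  An affine space is a set X of points together with a set C of coordinate functions; its
  regular functions are the polynomial expressions in the coordinates. Only their values on X
  matter.
\<close>

inductive_set polyfuns :: "('x \<Rightarrow> 'k :: comm_ring_1) set \<Rightarrow> ('x \<Rightarrow> 'k) set"
  for C :: "('x \<Rightarrow> 'k) set"
where
  const: "(\<lambda>_. c) \<in> polyfuns C"
| coord: "f \<in> C \<Longrightarrow> f \<in> polyfuns C"
| add: "f \<in> polyfuns C \<Longrightarrow> g \<in> polyfuns C \<Longrightarrow> (\<lambda>x. f x + g x) \<in> polyfuns C"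
| mult: "f \<in> polyfuns C \<Longrightarrow> g \<in> polyfuns C \<Longrightarrow> (\<lambda>x. f x * g x) \<in> polyfuns C"

text \<open>
  If X is only a subset of the affine space (as for the general linear group inside the space of
  square matrices), this is the subspace topology.
\<close>

definition zariski :: "'x set \<Rightarrow> ('x \<Rightarrow> 'k :: idom) set \<Rightarrow> 'x topology" where
  "zariski X C = topology (\<lambda>U. \<exists>F \<subseteq> polyfuns C. U = {x \<in> X. \<exists>f\<in>F. f x \<noteq> 0})"

lemma openin_zariski:
  "openin (zariski X C) U \<longleftrightarrow> (\<exists>F \<subseteq> polyfuns C. U = {x \<in> X. \<exists>f\<in>F. f x \<noteq> 0})"
proof -
  let ?O = "\<lambda>U. \<exists>F \<subseteq> polyfuns C. U = {x \<in> X. \<exists>f\<in>F. f x \<noteq> 0}"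
  have "istopology ?O"
    unfolding istopology_def
  proof (intro conjI allI impI)
    fix U V assume "?O U" "?O V"
    then obtain F H where F: "F \<subseteq> polyfuns C" "U = {x \<in> X. \<exists>f\<in>F. f x \<noteq> 0}"
      and H: "H \<subseteq> polyfuns C" "V = {x \<in> X. \<exists>f\<in>H. f x \<noteq> 0}" by blast
    let ?P = "{(\<lambda>x. f x * h x) | f h. f \<in> F \<and> h \<in> H}"
    have "?P \<subseteq> polyfuns C" using F(1) H(1) by (blast intro: polyfuns.mult)
    moreover have "U \<inter> V = {x \<in> X. \<exists>f\<in>?P. f x \<noteq> 0}"
    proof
      show "U \<inter> V \<subseteq> {x \<in> X. \<exists>f\<in>?P. f x \<noteq> 0}"
      proof
        fix x assume "x \<in> U \<inter> V"
        then obtain f h where "x \<in> X" "f \<in> F" "h \<in> H" "f x \<noteq> 0" "h x \<noteq> 0" 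
          using F(2) H(2) by blast
        then have "(\<lambda>x. f x * h x) \<in> ?P" "f x * h x \<noteq> 0" by auto
        then have "\<exists>f\<in>?P. f x \<noteq> 0" by (intro bexI[where x = "\<lambda>x. f x * h x"])
        with \<open>x \<in> X\<close> show "x \<in> {x \<in> X. \<exists>f\<in>?P. f x \<noteq> 0}" by simp
      qed
      show "{x \<in> X. \<exists>f\<in>?P. f x \<noteq> 0} \<subseteq> U \<inter> V" using F(2) H(2) by auto
    qed
    ultimately show "?O (U \<inter> V)" by (intro exI[of _ ?P] conjI)
  next
    fix K assume "\<forall>U\<in>K. ?O U"
    then have "\<exists>F. \<forall>U\<in>K. F U \<subseteq> polyfuns C \<and> U = {x \<in> X. \<exists>f\<in>F U. f x \<noteq> 0}"
      by (rule bchoice)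
    then obtain F where F': "\<forall>U\<in>K. F U \<subseteq> polyfuns C \<and> U = {x \<in> X. \<exists>f\<in>F U. f x \<noteq> 0}"
      by (elim exE)
    note F = conjunct1[OF bspec[OF F']] conjunct2[OF bspec[OF F']]
    have mem: "x \<in> \<Union>K \<longleftrightarrow> x \<in> X \<and> (\<exists>U\<in>K. \<exists>f\<in>F U. f x \<noteq> 0)" for x
    proof -
      have "x \<in> U \<longleftrightarrow> x \<in> X \<and> (\<exists>f\<in>F U. f x \<noteq> 0)" if "U \<in> K" for U
        by (subst F(2)[OF that]) simp
      then show ?thesis by auto
    qed
    have "\<Union>K = {x \<in> X. \<exists>f\<in>(\<Union>U\<in>K. F U). f x \<noteq> 0}"
      by (intro Set.set_eqI) (simp only: mem mem_Collect_eq bex_UN)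
    moreover have "(\<Union>U\<in>K. F U) \<subseteq> polyfuns C" using F(1) by (rule UN_least)
    ultimately show "?O (\<Union>K)" by (intro exI[of _ "\<Union>U\<in>K. F U"] conjI)
  qed
  then show ?thesis by (simp add: zariski_def)
qed

lemma topspace_zariski:
  fixes C :: "('x \<Rightarrow> 'k :: idom) set"
  shows "topspace (zariski X C) = X"
proof -
  have "{\<lambda>_. 1} \<subseteq> polyfuns C" by (simp add: polyfuns.const)
  moreover have "X = {x \<in> X. \<exists>f\<in>{\<lambda>_. 1 :: 'k}. f x \<noteq> 0}" by simp
  ultimately have "openin (zariski X C) X"
    unfolding openin_zariski by (intro exI[of _ "{\<lambda>_. 1}"] conjI)
  then have "X \<subseteq> topspace (zariski X C)" by (rule openin_subset)
  moreover obtain F where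
    "F \<subseteq> polyfuns C \<and> topspace (zariski X C) = {x \<in> X. \<exists>f\<in>F. f x \<noteq> 0}"
    using openin_topspace[of "zariski X C"] unfolding openin_zariski by (elim exE)
  then have "topspace (zariski X C) \<subseteq> X" by auto
  ultimately show ?thesis by (rule antisym[rotated])
qed

definition quotient_topology :: "'a topology \<Rightarrow> ('a \<Rightarrow> 'b) \<Rightarrow> 'b topology" where
  "quotient_topology T q =
     topology (\<lambda>V. V \<subseteq> q ` topspace T \<and> openin T {x \<in> topspace T. q x \<in> V})"

lemma openin_quotient_topology:
  "openin (quotient_topology T q) V \<longleftrightarrow>
     V \<subseteq> q ` topspace T \<and> openin T {x \<in> topspace T. q x \<in> V}"
proof -
  have "istopology (\<lambda>V. V \<subseteq> q ` topspace T \<and> openin T {x \<in> topspace T. q x \<in> V})"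
    unfolding istopology_def
  proof (intro conjI allI impI; (elim conjE)?)
    fix U V assume "openin T {x \<in> topspace T. q x \<in> U}" "openin T {x \<in> topspace T. q x \<in> V}"
    then have "openin T ({x \<in> topspace T. q x \<in> U} \<inter> {x \<in> topspace T. q x \<in> V})" by blast
    also have "{x \<in> topspace T. q x \<in> U} \<inter> {x \<in> topspace T. q x \<in> V} =
      {x \<in> topspace T. q x \<in> U \<inter> V}" by blast
    finally show "openin T {x \<in> topspace T. q x \<in> U \<inter> V}" .
  next
    fix K assume K: "\<forall>V\<in>K. V \<subseteq> q ` topspace T \<and> openin T {x \<in> topspace T. q x \<in> V}"
    have "openin T (\<Union>V\<in>K. {x \<in> topspace T. q x \<in> V})" using K by blast
    also have "(\<Union>V\<in>K. {x \<in> topspace T. q x \<in> V}) = {x \<in> topspace T. q x \<in> \<Union>K}" by blast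
    finally show "openin T {x \<in> topspace T. q x \<in> \<Union>K}" .
  qed blast+
  then show ?thesis by (simp add: quotient_topology_def)
qed

lemma quotient_map_quotient_topology: "quotient_map T (quotient_topology T q) q"
proof -
  have "{x \<in> topspace T. q x \<in> q ` topspace T} = topspace T" by blast
  then have "openin (quotient_topology T q) (q ` topspace T)"
    by (simp add: openin_quotient_topology)
  then have "q ` topspace T \<subseteq> topspace (quotient_topology T q)" by (rule openin_subset)
  moreover have "topspace (quotient_topology T q) \<subseteq> q ` topspace T"
    using openin_topspace[of "quotient_topology T q"] unfolding openin_quotient_topology by simp
  ultimately have "topspace (quotient_topology T q) = q ` topspace T" by (rule antisym[rotated])
  then show ?thesis by (auto simp: quotient_map_def openin_quotient_topology)
qed

definition irreducible_closed :: "'a topology \<Rightarrow> 'a set \<Rightarrow> bool" where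
  "irreducible_closed T Z \<longleftrightarrow> closedin T Z \<and> Z \<noteq> {} \<and>
     (\<forall>A B. closedin T A \<and> closedin T B \<and> Z = A \<union> B \<longrightarrow> Z = A \<or> Z = B)"

definition krull_dim :: "'a topology \<Rightarrow> enat" where
  "krull_dim T = Sup {enat d | d. \<exists>Z :: nat \<Rightarrow> 'a set.
     (\<forall>i\<le>d. irreducible_closed T (Z i)) \<and> (\<forall>i<d. Z i \<subset> Z (Suc i))}"

section \<open>Lomadze systems and the group action\<close>

type_synonym 'k lomadze = "'k mat \<times> 'k mat \<times> 'k mat"

definition lomadze_space :: "nat \<Rightarrow> nat \<Rightarrow> nat \<Rightarrow> 'k :: field lomadze set" where
  "lomadze_space n m p =
     carrier_mat (n + p) n \<times> carrier_mat (n + p) n \<times> carrier_mat (n + p) (p + m)"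

definition lomadze_coords :: "nat \<Rightarrow> nat \<Rightarrow> nat \<Rightarrow> ('k :: field lomadze \<Rightarrow> 'k) set" where
  "lomadze_coords n m p =
     {\<lambda>(K, L, M). K $$ (i, j) | i j. i < n + p \<and> j < n} \<union>
     {\<lambda>(K, L, M). L $$ (i, j) | i j. i < n + p \<and> j < n} \<union>
     {\<lambda>(K, L, M). M $$ (i, j) | i j. i < n + p \<and> j < p + m}"

definition lomadze_top :: "nat \<Rightarrow> nat \<Rightarrow> nat \<Rightarrow> 'k :: field lomadze topology" where
  "lomadze_top n m p = zariski (lomadze_space n m p) (lomadze_coords n m p)"

definition gl :: "nat \<Rightarrow> 'k :: field mat monoid" where
  "gl n = units_of (ring_mat TYPE('k) n ())"

definition lomadze_group :: "nat \<Rightarrow> nat \<Rightarrow> ('k :: field mat \<times> 'k mat) monoid" where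
  "lomadze_group n p = gl n \<times>\<times> gl (n + p)"

definition group_coords :: "nat \<Rightarrow> nat \<Rightarrow> ('k :: field mat \<times> 'k mat \<Rightarrow> 'k) set" where
  "group_coords n p =
     {\<lambda>(g0, g1). g0 $$ (i, j) | i j. i < n \<and> j < n} \<union>
     {\<lambda>(g0, g1). g1 $$ (i, j) | i j. i < n + p \<and> j < n + p}"

definition group_top :: "nat \<Rightarrow> nat \<Rightarrow> ('k :: field mat \<times> 'k mat) topology" where
  "group_top n p = zariski (carrier (lomadze_group n p)) (group_coords n p)"

fun act :: "nat \<Rightarrow> 'k :: field mat \<times> 'k mat \<Rightarrow> 'k lomadze \<Rightarrow> 'k lomadze" where
  "act n (g0, g1) (K, L, M) =
     (g1 * K * inv\<^bsub>gl n\<^esub> g0, g1 * L * inv\<^bsub>gl n\<^esub> g0, g1 * M)"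

definition act_kernel :: "nat \<Rightarrow> nat \<Rightarrow> nat \<Rightarrow> ('k :: field mat \<times> 'k mat) set" where
  "act_kernel n m p =
     {g \<in> carrier (lomadze_group n p). \<forall>x \<in> lomadze_space n m p. act n g x = x}"

text \<open>
  The points of \<open>G/\<Delta>\<close> are the cosets of \<open>\<Delta>\<close>, i.e. the carrier of \<open>G Mod \<Delta>\<close>; the underlying
  space of the quotient variety carries the quotient topology.
\<close>

definition dim_group_mod_kernel :: "'k :: field itself \<Rightarrow> nat \<Rightarrow> nat \<Rightarrow> nat \<Rightarrow> enat" where
  "dim_group_mod_kernel _ n m p =
     krull_dim (quotient_topology (group_top n p :: ('k mat \<times> 'k mat) topology)
       (\<lambda>g. act_kernel n m p #>\<^bsub>lomadze_group n p\<^esub> g))"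

definition lomadze_orbit :: "nat \<Rightarrow> nat \<Rightarrow> 'k :: field lomadze \<Rightarrow> 'k lomadze set" where
  "lomadze_orbit n p x = Group_Action.orbit (lomadze_group n p) (act n) x"

fun character :: "int \<Rightarrow> int \<Rightarrow> 'k :: field mat \<times> 'k mat \<Rightarrow> 'k" where
  "character \<chi>0 \<chi>1 (g0, g1) = Determinant.det g0 powi \<chi>0 * Determinant.det g1 powi \<chi>1"

section \<open>Stability with respect to a character\<close>

definition semi_invariants ::
  "nat \<Rightarrow> nat \<Rightarrow> nat \<Rightarrow> int \<Rightarrow> int \<Rightarrow> nat \<Rightarrow> ('k :: field lomadze \<Rightarrow> 'k) set" where
  "semi_invariants n m p \<chi>0 \<chi>1 N =
     {f \<in> polyfuns (lomadze_coords n m p).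
        \<forall>g \<in> carrier (lomadze_group n p). \<forall>x \<in> lomadze_space n m p.
          f (act n g x) = character \<chi>0 \<chi>1 g ^ N * f x}"

definition char_semistable ::
  "nat \<Rightarrow> nat \<Rightarrow> nat \<Rightarrow> int \<Rightarrow> int \<Rightarrow> 'k :: field lomadze \<Rightarrow> bool" where
  "char_semistable n m p \<chi>0 \<chi>1 S \<longleftrightarrow>
     (\<exists>N\<ge>1. \<exists>f \<in> semi_invariants n m p \<chi>0 \<chi>1 N. f S \<noteq> 0)"

definition char_stable ::
  "nat \<Rightarrow> nat \<Rightarrow> nat \<Rightarrow> int \<Rightarrow> int \<Rightarrow> 'k :: field lomadze \<Rightarrow> bool" where
  "char_stable n m p \<chi>0 \<chi>1 S \<longleftrightarrow>
     (\<exists>N\<ge>1. \<exists>f \<in> semi_invariants n m p \<chi>0 \<chi>1 N. f S \<noteq> 0 \<and>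
        (\<forall>x \<in> lomadze_space n m p. f x \<noteq> 0 \<longrightarrow>
           closedin (subtopology (lomadze_top n m p) {y. f y \<noteq> 0}) (lomadze_orbit n p x)) \<and>
        krull_dim (subtopology (lomadze_top n m p) (lomadze_orbit n p S)) =
          dim_group_mod_kernel TYPE('k) n m p)"

section \<open>Slopes\<close>

text \<open>
  The type \<open>rat extended\<close> also contains \<open>-\<infinity>\<close>, which \<open>slopes\<close> excludes. The fraction \<open>0/0\<close>
  gets the junk value \<open>\<infinity>\<close>; it is excluded wherever \<open>ratio\<close> is used below.
\<close>

definition slopes :: "rat extended set" where
  "slopes = {\<chi>. Fin 0 \<le> \<chi>}"

definition ratio :: "int \<Rightarrow> int \<Rightarrow> rat extended" where
  "ratio a b = (if b = 0 then Pinf else Fin (of_int a / of_int b))"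

definition slope_pair :: "rat extended \<Rightarrow> int \<Rightarrow> int \<Rightarrow> bool" where
  "slope_pair \<chi> \<chi>0 \<chi>1 \<longleftrightarrow>
     \<chi>0 \<le> 0 \<and> \<chi>1 \<ge> 0 \<and> \<not> (\<chi>0 = 0 \<and> \<chi>1 = 0) \<and> \<chi> = ratio (- \<chi>0) \<chi>1"

definition slope_semistable ::
  "nat \<Rightarrow> nat \<Rightarrow> nat \<Rightarrow> rat extended \<Rightarrow> 'k :: field lomadze \<Rightarrow> bool" where
  "slope_semistable n m p \<chi> S \<longleftrightarrow>
     (\<exists>\<chi>0 \<chi>1. slope_pair \<chi> \<chi>0 \<chi>1 \<and> char_semistable n m p \<chi>0 \<chi>1 S)"

definition slope_stable ::
  "nat \<Rightarrow> nat \<Rightarrow> nat \<Rightarrow> rat extended \<Rightarrow> 'k :: field lomadze \<Rightarrow> bool" where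
  "slope_stable n m p \<chi> S \<longleftrightarrow>
     (\<exists>\<chi>0 \<chi>1. slope_pair \<chi> \<chi>0 \<chi>1 \<and> char_stable n m p \<chi>0 \<chi>1 S)"

definition Lambda_set :: "nat \<Rightarrow> nat \<Rightarrow> rat extended set" where
  "Lambda_set n p =
     {ratio v u | v u. 0 \<le> v \<and> v \<le> int (n + p) \<and> 0 \<le> u \<and> u \<le> int n \<and> \<not> (v = 0 \<and> u = 0)}"

definition Delta_minus :: "nat \<Rightarrow> nat \<Rightarrow> rat extended \<Rightarrow> rat extended set" where
  "Delta_minus n p l =
     {\<chi> \<in> slopes. \<chi> > l \<and> (\<forall>l' \<in> Lambda_set n p. l' > l \<longrightarrow> \<chi> < l')}"

definition Delta_plus :: "nat \<Rightarrow> nat \<Rightarrow> rat extended \<Rightarrow> rat extended set" where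
  "Delta_plus n p l =
     {\<chi> \<in> slopes. \<chi> < l \<and> (\<forall>l' \<in> Lambda_set n p. l' < l \<longrightarrow> \<chi> > l')}"

section \<open>Lower and upper stability\<close>

definition vec_subspace :: "nat \<Rightarrow> 'k :: field vec set \<Rightarrow> bool" where
  "vec_subspace d U \<longleftrightarrow> VectorSpace.subspace class_ring U (module_vec TYPE('k) d)"

definition vec_dim :: "nat \<Rightarrow> 'k :: field vec set \<Rightarrow> int" where
  "vec_dim d U = int (vectorspace.dim class_ring (module_vec TYPE('k) d \<lparr>carrier := U\<rparr>))"

definition maps_into :: "'k :: field mat \<Rightarrow> 'k mat \<Rightarrow> 'k vec set \<Rightarrow> 'k vec set \<Rightarrow> bool" where
  "maps_into K L U V \<longleftrightarrow> {K *\<^sub>v u + L *\<^sub>v w | u w. u \<in> U \<and> w \<in> U} \<subseteq> V"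

fun lowerstable :: "nat \<Rightarrow> nat \<Rightarrow> nat \<Rightarrow> rat extended \<Rightarrow> 'k :: field lomadze \<Rightarrow> bool" where
  "lowerstable n m p l (K, L, M) \<longleftrightarrow>
     (\<forall>U V. vec_subspace n U \<and> vec_subspace (n + p) V \<longrightarrow>
        ((vec_dim n U > 0 \<or> vec_dim (n + p) V > 0) \<and> maps_into K L U V \<longrightarrow>
           l < ratio (vec_dim (n + p) V) (vec_dim n U)) \<and>
        ((U \<subset> carrier_vec n \<or> V \<subset> carrier_vec (n + p)) \<and> maps_into K L U V \<and>
         (\<lambda>x. M *\<^sub>v x) ` carrier_vec (p + m) \<subseteq> V \<longrightarrow>
           l \<ge> ratio (int (n + p) - vec_dim (n + p) V) (int n - vec_dim n U)))"

fun upperstable :: "nat \<Rightarrow> nat \<Rightarrow> nat \<Rightarrow> rat extended \<Rightarrow> 'k :: field lomadze \<Rightarrow> bool" where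
  "upperstable n m p l (K, L, M) \<longleftrightarrow>
     (\<forall>U V. vec_subspace n U \<and> vec_subspace (n + p) V \<longrightarrow>
        ((vec_dim n U > 0 \<or> vec_dim (n + p) V > 0) \<and> maps_into K L U V \<longrightarrow>
           l \<le> ratio (vec_dim (n + p) V) (vec_dim n U)) \<and>
        ((U \<subset> carrier_vec n \<or> V \<subset> carrier_vec (n + p)) \<and> maps_into K L U V \<and>
         (\<lambda>x. M *\<^sub>v x) ` carrier_vec (p + m) \<subseteq> V \<longrightarrow>
           l > ratio (int (n + p) - vec_dim (n + p) V) (int n - vec_dim n U)))"

end

theory Submission
  imports Defs "Jordan_Normal_Form.DL_Rank"
begin

text \<open>
  Write \<open>\<chi> = a / b\<close>. As \<open>\<chi>\<close> is not in \<open>\<Lambda>\<close>, the inequalities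
  \<open>a * dim U < b * dim V\<close> and \<open>b * codim V < a * codim U\<close> that express upper or lower stability
  cannot become equalities. Semistable points satisfy them: if one fails, a one-parameter subgroup
  adapted to \<open>U\<close>, \<open>V\<close> degenerates \<open>S\<close> so that every semi-invariant vanishes at \<open>S\<close>.
  Conversely, a semi-invariant of weight \<open>(-A, B)\<close> is the determinant of
  \<open>[X \<otimes> K + Y \<otimes> L | (1 \<otimes> M) Z]\<close> with \<open>X\<close>, \<open>Y\<close> of size \<open>B \<times> A\<close>. For \<open>X\<close>, \<open>Y\<close> a
  Kronecker block of size \<open>(D + 1) \<times> D\<close> or \<open>D \<times> (D + 1)\<close>, the inequalities make
  \<open>X \<otimes> K + Y \<otimes> L\<close> injective and, for suitable \<open>Z\<close>, the determinant nonzero; a product of such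
  determinants for two consecutive \<open>D\<close> has weight \<open>(-a, b)\<close>.

  For stability, the inequalities leave no nonzero homomorphism between stable systems that kills
  \<open>M\<close>, and make every homomorphism compatible with \<open>M\<close> invertible. Hence the group element
  carrying \<open>S\<close> to a point of its orbit is, by Cramer's rule, locally a rational function of that
  point. So orbits are closed among the semistable points and the orbit map is a homeomorphism from
  the group, which gives the dimension.
\<close>

section \<open>Injective matrices and column spaces\<close>

text \<open>Duality halves the work: passing to annihilators turns the inequality for subspaces
  containing the image of \<open>M\<close> into the other inequality, for the transposed pencil on
  the kernel of the transpose of \<open>M\<close>, with \<open>a\<close> and \<open>b\<close>
  interchanged. Hence one notion, \<open>expanding\<close>, yields both the injectivity of X
  \<otimes> K + Y \<otimes> L and the fact that its columns together with those of 1 \<otimes> M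
  span. Kronecker blocks are chosen because a kernel vector is then a chain of vectors, each linked
  to the next through the pencil, and the span of such a chain has so small an image that the
  inequalities apply directly. The price is that a block works only for slopes near its own, and
  that the slopes D / (D + 1) and their inverses never reach 1; but 1 lies in \<Lambda> because n >
  0, so a \<noteq> b. No dimension is ever computed. A single stable point has trivial stabilizer,
  which forces the kernel of the action to be trivial, so the orbit and the quotient by the kernel
  can both be compared with the group itself.\<close>

definition inj_mat :: "'a :: field mat \<Rightarrow> bool" where
  "inj_mat A \<longleftrightarrow>
     (\<forall>v \<in> carrier_vec (dim_col A). A *\<^sub>v v = 0\<^sub>v (dim_row A) \<longrightarrow> v = 0\<^sub>v (dim_col A))"

text \<open>A family of vectors is a function on all of \<open>nat\<close> of which only the first
  \<open>r\<close> values count, so that inductions lengthen the family by raising \<open>r\<close>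
  or by updating one value.\<close>

definition colmat :: "nat \<Rightarrow> nat \<Rightarrow> (nat \<Rightarrow> 'a vec) \<Rightarrow> 'a mat" where
  "colmat d r w = mat d r (\<lambda>(i, j). w j $ i)"

definition colspace :: "'a :: field mat \<Rightarrow> 'a vec set" where
  "colspace A = {A *\<^sub>v v | v. v \<in> carrier_vec (dim_col A)}"

lemma inj_matD:
  "inj_mat A \<Longrightarrow> A \<in> carrier_mat r c \<Longrightarrow> v \<in> carrier_vec c \<Longrightarrow> A *\<^sub>v v = 0\<^sub>v r \<Longrightarrow> v = 0\<^sub>v c"
  by (auto simp: inj_mat_def)

lemma inj_matI:
  assumes "A \<in> carrier_mat r c"
    and "\<And>v. v \<in> carrier_vec c \<Longrightarrow> A *\<^sub>v v = 0\<^sub>v r \<Longrightarrow> v = 0\<^sub>v c"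
  shows "inj_mat A"
  using assms by (auto simp: inj_mat_def)

lemma inj_mat_iff_det:
  assumes "A \<in> carrier_mat n n"
  shows "inj_mat A \<longleftrightarrow> Determinant.det A \<noteq> 0"
  unfolding det_0_iff_vec_prod_zero[OF assms] using assms by (auto simp: inj_mat_def)

lemma colmat_carrier [simp]: "colmat d r w \<in> carrier_mat d r"
  by (simp add: colmat_def)

lemma colmat_dims [simp]: "dim_row (colmat d r w) = d" "dim_col (colmat d r w) = r"
  by (simp_all add: colmat_def)

lemma col_colmat: "j < r \<Longrightarrow> w j \<in> carrier_vec d \<Longrightarrow> col (colmat d r w) j = w j"
  by (auto simp: colmat_def)

lemma colmat_mult_vec_index:
  "i < d \<Longrightarrow> v \<in> carrier_vec r \<Longrightarrow> (colmat d r w *\<^sub>v v) $ i = (\<Sum>j<r. w j $ i * v $ j)"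
  by (simp add: colmat_def scalar_prod_def atLeast0LessThan)

lemma colmat_Suc_mult_vec:
  fixes w :: "nat \<Rightarrow> 'a :: field vec"
  assumes "v \<in> carrier_vec (Suc r)" "w r \<in> carrier_vec d"
  shows "colmat d (Suc r) w *\<^sub>v v = colmat d r w *\<^sub>v vec r (\<lambda>i. v $ i) + v $ r \<cdot>\<^sub>v w r"
proof (rule eq_vecI)
  fix i assume "i < dim_vec (colmat d r w *\<^sub>v vec r (\<lambda>i. v $ i) + v $ r \<cdot>\<^sub>v w r)"
  then have i: "i < d" using assms(2) by simp
  have "(colmat d r w *\<^sub>v vec r (\<lambda>i. v $ i)) $ i = (\<Sum>j<r. w j $ i * v $ j)"
    using colmat_mult_vec_index[OF i, of "vec r (\<lambda>i. v $ i)" r w] by simp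
  then show "(colmat d (Suc r) w *\<^sub>v v) $ i =
      (colmat d r w *\<^sub>v vec r (\<lambda>i. v $ i) + v $ r \<cdot>\<^sub>v w r) $ i"
    using i assms by (simp del: index_mult_mat_vec add: colmat_mult_vec_index mult.commute)
qed (use assms in simp_all)

lemma mult_colmat:
  assumes "A \<in> carrier_mat e d" "\<And>j. j < r \<Longrightarrow> w j \<in> carrier_vec d"
  shows "A * colmat d r w = colmat e r (\<lambda>j. A *\<^sub>v w j)"
proof (rule eq_matI)
  fix i j assume "i < dim_row (colmat e r (\<lambda>j. A *\<^sub>v w j))" "j < dim_col (colmat e r (\<lambda>j. A *\<^sub>v w j))"
  then have "i < e" "j < r" by auto
  with assms show "(A * colmat d r w) $$ (i, j) = colmat e r (\<lambda>j. A *\<^sub>v w j) $$ (i, j)"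
    by (simp add: col_colmat) (simp add: colmat_def)
qed (use assms in auto)

lemma colmat_cols: "A \<in> carrier_mat d r \<Longrightarrow> colmat d r (\<lambda>j. col A j) = A"
  by (rule eq_matI) (auto simp: colmat_def)

lemma colmat_cong: "(\<And>j. j < r \<Longrightarrow> w j = w' j) \<Longrightarrow> colmat d r w = colmat d r w'"
  by (rule eq_matI) (auto simp: colmat_def)

lemma colspaceI: "A \<in> carrier_mat d r \<Longrightarrow> v \<in> carrier_vec r \<Longrightarrow> A *\<^sub>v v \<in> colspace A"
  by (auto simp: colspace_def)

lemma colspaceE:
  assumes "x \<in> colspace A" "A \<in> carrier_mat d r"
  obtains v where "v \<in> carrier_vec r" "x = A *\<^sub>v v"
  using assms by (auto simp: colspace_def)

lemma colspace_carrier: "A \<in> carrier_mat d r \<Longrightarrow> colspace A \<subseteq> carrier_vec d"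
  by (auto simp: colspace_def)

lemma colspace_add:
  assumes "A \<in> carrier_mat d r" "x \<in> colspace A" "y \<in> colspace A"
  shows "x + y \<in> colspace A"
proof -
  obtain v w where "v \<in> carrier_vec r" "x = A *\<^sub>v v" "w \<in> carrier_vec r" "y = A *\<^sub>v w"
    using assms by (metis colspaceE)
  then have "x + y = A *\<^sub>v (v + w)" "v + w \<in> carrier_vec r"
    using assms(1) by (auto simp: mult_add_distrib_mat_vec)
  then show ?thesis using colspaceI[OF assms(1)] by simp
qed

lemma colspace_smult:
  assumes "A \<in> carrier_mat d r" "x \<in> colspace A"
  shows "c \<cdot>\<^sub>v x \<in> colspace A"
proof -
  obtain v where "v \<in> carrier_vec r" "x = A *\<^sub>v v"
    using assms by (metis colspaceE)
  then have "c \<cdot>\<^sub>v x = A *\<^sub>v (c \<cdot>\<^sub>v v)" "c \<cdot>\<^sub>v v \<in> carrier_vec r"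
    using assms(1) by (auto simp: mult_mat_vec)
  then show ?thesis using colspaceI[OF assms(1)] by simp
qed

lemma colspace_uminus:
  assumes "A \<in> carrier_mat d r" "x \<in> colspace A"
  shows "- x \<in> colspace A"
proof -
  have "- x = (- 1) \<cdot>\<^sub>v x" by auto
  with colspace_smult[OF assms] show ?thesis by metis
qed

lemma colspace_zero:
  assumes "A \<in> carrier_mat d r"
  shows "0\<^sub>v d \<in> colspace A"
proof -
  have "A *\<^sub>v 0\<^sub>v r = 0\<^sub>v d" using assms by auto
  then show ?thesis using colspaceI[OF assms, of "0\<^sub>v r"] by simp
qed

lemma col_in_colspace:
  assumes "A \<in> carrier_mat d r" "j < r"
  shows "col A j \<in> colspace A"
proof -
  have "A *\<^sub>v unit_vec r j = col A j"
    using assms by (intro eq_vecI) auto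
  then show ?thesis using colspaceI[OF assms(1), of "unit_vec r j"] by simp
qed

lemma colmat_in_colspace:
  "j < r \<Longrightarrow> w j \<in> carrier_vec d \<Longrightarrow> w j \<in> colspace (colmat d r w)"
  using col_in_colspace[OF colmat_carrier, of j r d w] by (simp add: col_colmat)

lemma colmat_span_subset:
  fixes V :: "'a :: field vec set"
  assumes "V \<subseteq> carrier_vec d" "0\<^sub>v d \<in> V" "\<And>x y. x \<in> V \<Longrightarrow> y \<in> V \<Longrightarrow> x + y \<in> V"
    and "\<And>c x. x \<in> V \<Longrightarrow> c \<cdot>\<^sub>v x \<in> V" and "\<And>j. j < r \<Longrightarrow> w j \<in> V"
    and "v \<in> carrier_vec r"
  shows "colmat d r w *\<^sub>v v \<in> V"
  using assms(5,6)
proof (induction r arbitrary: v)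
  case 0
  have "colmat d 0 w *\<^sub>v v = 0\<^sub>v d" using 0 by (intro eq_vecI) (auto simp: colmat_def scalar_prod_def)
  with assms(2) show ?case by simp
next
  case (Suc r)
  have "w r \<in> carrier_vec d" using Suc.prems assms(1) by auto
  then show ?case
    using Suc by (subst colmat_Suc_mult_vec[of v r w d]) (auto intro!: assms(3,4))
qed

lemma mult_colspace_subset:
  assumes A: "A \<in> carrier_mat e d" and Y: "Y \<in> carrier_mat e s"
    and w: "\<And>j. j < r \<Longrightarrow> w j \<in> carrier_vec d" "\<And>j. j < r \<Longrightarrow> A *\<^sub>v w j \<in> colspace Y"
    and x: "x \<in> colspace (colmat d r w)"
  shows "A *\<^sub>v x \<in> colspace Y"
proof -
  obtain v where v: "v \<in> carrier_vec r" "x = colmat d r w *\<^sub>v v"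
    using x by (rule colspaceE[OF _ colmat_carrier])
  have "A *\<^sub>v x = (A * colmat d r w) *\<^sub>v v"
    using v A by (simp add: assoc_mult_mat_vec[OF A colmat_carrier])
  also have "\<dots> = colmat e r (\<lambda>j. A *\<^sub>v w j) *\<^sub>v v"
    using mult_colmat[OF A] w by metis
  also have "\<dots> \<in> colspace Y"
    by (rule colmat_span_subset)
      (use Y w v in \<open>auto intro: colspace_add colspace_smult colspace_zero colspace_carrier\<close>,
       use colspace_carrier[OF Y] in auto)
  finally show ?thesis .
qed

lemma inj_colmat_Suc:
  assumes inj: "inj_mat (colmat d r w)" and w: "w r \<in> carrier_vec d"
    and notin: "w r \<notin> colspace (colmat d r w)"
  shows "inj_mat (colmat d (Suc r) w)"
proof (rule inj_matI[OF colmat_carrier])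
  fix v :: "'a vec" assume v: "v \<in> carrier_vec (Suc r)" and 0: "colmat d (Suc r) w *\<^sub>v v = 0\<^sub>v d"
  let ?v = "vec r (\<lambda>i. v $ i)" and ?X = "colmat d r w"
  have X: "?X *\<^sub>v ?v \<in> carrier_vec d" by (rule carrier_vecI) simp
  have eq: "?X *\<^sub>v ?v + v $ r \<cdot>\<^sub>v w r = 0\<^sub>v d"
    using colmat_Suc_mult_vec[of v r w d, OF v w] 0 by simp
  have vr: "v $ r = 0"
  proof (rule ccontr)
    assume nz: "v $ r \<noteq> 0"
    have "w r = (- inverse (v $ r)) \<cdot>\<^sub>v (?X *\<^sub>v ?v)"
    proof (rule eq_vecI)
      fix i assume "i < dim_vec ((- inverse (v $ r)) \<cdot>\<^sub>v (?X *\<^sub>v ?v))"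
      then have i: "i < d" by simp
      have "(?X *\<^sub>v ?v) $ i + v $ r * w r $ i = 0"
        using arg_cong[OF eq, of "\<lambda>x. x $ i"] i w by simp
      then have "(?X *\<^sub>v ?v) $ i = - (v $ r * w r $ i)" by (simp add: eq_neg_iff_add_eq_0)
      moreover have "((- inverse (v $ r)) \<cdot>\<^sub>v (?X *\<^sub>v ?v)) $ i = - inverse (v $ r) * (?X *\<^sub>v ?v) $ i"
        using i by simp
      ultimately show "w r $ i = ((- inverse (v $ r)) \<cdot>\<^sub>v (?X *\<^sub>v ?v)) $ i"
        using nz by simp
    qed (use w in auto)
    also have "\<dots> \<in> colspace ?X"
      by (rule colspace_smult[OF colmat_carrier], rule colspaceI[OF colmat_carrier]) simp
    finally show False using notin by simp
  qed
  have zero_smult: "0 \<cdot>\<^sub>v w r = 0\<^sub>v d" using w by (intro eq_vecI) auto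
  have "?X *\<^sub>v ?v = 0\<^sub>v d" 
    using eq X zero_smult unfolding vr by simp
  then have "?v = 0\<^sub>v r" using inj_matD[OF inj colmat_carrier, of ?v] by simp
  then have "\<And>i. i < r \<Longrightarrow> v $ i = 0" by (metis index_vec index_zero_vec(1))
  then show "v = 0\<^sub>v (Suc r)" using v vr by (intro eq_vecI) (auto simp: less_Suc_eq)
qed

lemma inj_colmat_0: "inj_mat (colmat d 0 w :: 'a :: field mat)"
  by (rule inj_matI[OF colmat_carrier]) auto

text \<open>Zero rows pad \<open>A\<close> to a square matrix \<open>B\<close> of size
  \<open>c\<close>. Row \<open>r\<close> of \<open>B\<close> vanishes, so its determinant does, and
  a kernel vector of \<open>B\<close> is one of \<open>A\<close>.\<close>

lemma inj_mat_le:
  assumes A: "A \<in> carrier_mat r c" and inj: "inj_mat A"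
  shows "c \<le> r"
proof (rule ccontr)
  assume "\<not> c \<le> r"
  then have rc: "r < c" by simp
  define B where "B = mat c c (\<lambda>(i, j). if i < r then A $$ (i, j) else 0)"
  have B: "B \<in> carrier_mat c c" by (simp add: B_def)
  have "B\<^sup>T *\<^sub>v unit_vec c r = 0\<^sub>v c"
    using rc by (intro eq_vecI) (auto simp: B_def)
  then have "Determinant.det B\<^sup>T = 0"
    using det_0_iff_vec_prod_zero[of "B\<^sup>T" c] B rc
    by (metis transpose_carrier_mat unit_vec_carrier unit_vec_nonzero)
  then have "Determinant.det B = 0" using det_transpose[OF B] by simp
  then obtain v where v: "v \<in> carrier_vec c" "v \<noteq> 0\<^sub>v c" "B *\<^sub>v v = 0\<^sub>v c"
    using det_0_iff_vec_prod_zero[OF B] by auto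
  have "A *\<^sub>v v = 0\<^sub>v r"
  proof (rule eq_vecI)
    fix i assume "i < dim_vec (0\<^sub>v r :: 'a vec)"
    then have i: "i < r" by simp
    then have "row B i = row A i" using A rc by (intro eq_vecI) (auto simp: B_def)
    moreover have "(B *\<^sub>v v) $ i = 0" using v(3) i rc by simp
    ultimately show "(A *\<^sub>v v) $ i = 0\<^sub>v r $ i" using i rc A B by simp
  qed (use A in auto)
  with inj_matD[OF inj A v(1)] v(2) show False by simp
qed

lemma left_kernel_exists:
  assumes A: "(A :: 'a :: field mat) \<in> carrier_mat r c" and rc: "c < r"
  obtains w where "w \<in> carrier_vec r" "w \<noteq> 0\<^sub>v r" "A\<^sup>T *\<^sub>v w = 0\<^sub>v c"
proof -
  have "\<not> inj_mat A\<^sup>T" using inj_mat_le[of "A\<^sup>T" c r] A rc by auto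
  then show ?thesis using that A by (auto simp: inj_mat_def)
qed

text \<open>Basis completion by vectors from the image of \<open>W\<close>. By \<open>sep\<close> no
  nonzero functional kills both the \<open>u j\<close> and that image. As long as there are fewer
  than \<open>s\<close> columns, some \<open>w\<close> \<noteq> 0 is orthogonal to all of them; a
  column of \<open>W\<close> not orthogonal to \<open>w\<close> exists by \<open>sep\<close>, lies
  outside their span, and is appended.\<close>

lemma extend_inj_colmat:
  assumes inj: "inj_mat (colmat s q u)" and u: "\<And>j. j < q \<Longrightarrow> u j \<in> carrier_vec s"
    and W: "(W :: 'a :: field mat) \<in> carrier_mat s t"
    and sep: "\<And>w. w \<in> carrier_vec s \<Longrightarrow> (\<And>j. j < q \<Longrightarrow> u j \<bullet> w = 0) \<Longrightarrow> W\<^sup>T *\<^sub>v w = 0\<^sub>v t \<Longrightarrow>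
      w = 0\<^sub>v s"
  shows "\<exists>z. (\<forall>j. z j \<in> carrier_vec t) \<and>
    inj_mat (colmat s s (\<lambda>j. if j < q then u j else W *\<^sub>v z j))"
proof -
  have qs: "q \<le> s" using inj_mat_le[OF colmat_carrier inj] .
  have "q \<le> k \<Longrightarrow> k \<le> s \<Longrightarrow> \<exists>z. (\<forall>j. z j \<in> carrier_vec t) \<and>
    inj_mat (colmat s k (\<lambda>j. if j < q then u j else W *\<^sub>v z j))" for k
  proof (induction k rule: dec_induct)
    case base
    have "colmat s q (\<lambda>j. if j < q then u j else W *\<^sub>v 0\<^sub>v t) = colmat s q u"
      by (rule colmat_cong) simp
    then show ?case using inj by (intro exI[of _ "\<lambda>_. 0\<^sub>v t"]) auto
  next
    case (step k)
    then obtain z where z: "\<And>j. z j \<in> carrier_vec t"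
      and injk: "inj_mat (colmat s k (\<lambda>j. if j < q then u j else W *\<^sub>v z j))" (is "inj_mat ?X")
      by auto
    obtain w where w: "w \<in> carrier_vec s" "w \<noteq> 0\<^sub>v s" "?X\<^sup>T *\<^sub>v w = 0\<^sub>v k"
      using left_kernel_exists[of ?X s k] step by auto
    have cX: "col ?X j \<bullet> w = 0" if "j < k" for j
      using arg_cong[OF w(3), of "\<lambda>v. v $ j"] that by simp
    have cu: "u j \<bullet> w = 0" if "j < q" for j
      using cX[of j] that step u[OF that] by (simp add: col_colmat)
    have "W\<^sup>T *\<^sub>v w \<noteq> 0\<^sub>v t" using sep[OF w(1) cu] w(2) by auto
    then obtain j where j: "j < t" "(W\<^sup>T *\<^sub>v w) $ j \<noteq> 0"
      using W by (metis carrier_matD(2) dim_mult_mat_vec eq_vecI index_transpose_mat(2)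
          index_zero_vec(1) index_zero_vec(2))
    define z' where "z' = z(k := unit_vec t j)"
    let ?u = "\<lambda>j. if j < q then u j else W *\<^sub>v z' j"
    have z': "z' i \<in> carrier_vec t" for i using z by (simp add: z'_def)
    have eq: "colmat s k ?u = ?X" by (rule colmat_cong) (simp add: z'_def)
    have uk: "?u k = col W j" using step j W by (auto simp: z'_def intro: eq_vecI)
    have ck: "col W j \<in> carrier_vec s" using W by auto
    have nz: "col W j \<bullet> w \<noteq> 0" using j W by simp
    have "?u k \<notin> colspace (colmat s k ?u)"
    proof
      assume "?u k \<in> colspace (colmat s k ?u)"
      then obtain v where v: "v \<in> carrier_vec k" "col W j = ?X *\<^sub>v v"
        unfolding eq uk by (rule colspaceE[OF _ colmat_carrier])
      have "col W j \<bullet> w = w \<bullet> (?X *\<^sub>v v)"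
        using v(2) ck w(1) by (simp add: comm_scalar_prod)
      also have "\<dots> = (?X\<^sup>T *\<^sub>v w) \<bullet> v"
        by (rule transpose_vec_mult_scalar[OF colmat_carrier v(1) w(1), symmetric])
      also have "\<dots> = 0" using w(3) v(1) by simp
      finally show False using nz by simp
    qed
    moreover have "?u k \<in> carrier_vec s" using uk ck by simp
    ultimately have "inj_mat (colmat s (Suc k) ?u)"
      using inj_colmat_Suc[of s k ?u] injk eq by simp
    then show ?case using z' by blast
  qed
  from this[OF qs order.refl] show ?thesis by blast
qed

lemma extend_inj_mat:
  assumes B: "(B :: 'a :: field mat) \<in> carrier_mat d r" and inj: "inj_mat B"
  obtains P where "P \<in> carrier_mat d d" "Determinant.det P \<noteq> 0" "\<forall>j<r. col P j = col B j"
proof -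
  have "inj_mat (colmat d r (\<lambda>j. col B j))" using inj colmat_cols[OF B] by simp
  then obtain z where z: "\<And>j. z j \<in> carrier_vec d"
    "inj_mat (colmat d d (\<lambda>j. if j < r then col B j else 1\<^sub>m d *\<^sub>v z j))" (is "inj_mat ?P")
    using extend_inj_colmat[of d r "\<lambda>j. col B j" "1\<^sub>m d" d] B by auto
  have "r \<le> d" using inj_mat_le[OF B inj] .
  then have "col ?P j = col B j" if "j < r" for j
    using that B by (subst col_colmat) auto
  with that[of ?P] show ?thesis using z(2) by (simp add: inj_mat_iff_det[OF colmat_carrier])
qed

section \<open>Dimensions of subspaces\<close>

lemma vec_subspace_iff:
  fixes U :: "'k :: field vec set"
  shows "vec_subspace d U \<longleftrightarrow> U \<subseteq> carrier_vec d \<and> 0\<^sub>v d \<in> U \<and>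
    (\<forall>x\<in>U. \<forall>y\<in>U. x + y \<in> U) \<and> (\<forall>c. \<forall>x\<in>U. c \<cdot>\<^sub>v x \<in> U)"
  using vec_vs[where ?'a = 'k and n = d] vec_module[where ?'a = 'k and n = d]
  unfolding vec_subspace_def VectorSpace.subspace_def LinearCombinations.submodule_def
  by (auto simp: module_vec_simps class_ring_simps)

lemma vec_dim_colspace:
  fixes B :: "'k :: field mat"
  assumes B: "B \<in> carrier_mat d r" and inj: "inj_mat B"
  shows "vec_dim d (colspace B) = int r"
proof -
  interpret vec_space "TYPE('k)" d .
  \<comment> \<open>The library speaks of independence of the set of columns, so repetitions must be
    excluded separately.\<close>
  have dist: "distinct (cols B)"
    unfolding distinct_conv_nth
  proof (intro allI impI notI)
    fix i j assume ij: "i < length (cols B)" "j < length (cols B)" "i \<noteq> j" "cols B ! i = cols B ! j"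
    then have ir: "i < r" "j < r" and eq: "col B i = col B j" using B by auto
    have "B *\<^sub>v (unit_vec r i - unit_vec r j) = B *\<^sub>v unit_vec r i - B *\<^sub>v unit_vec r j"
      using B by (simp add: mult_minus_distrib_mat_vec)
    also have "\<dots> = col B i - col B j"
      using B ir by (auto intro!: eq_vecI)
    also have "\<dots> = 0\<^sub>v d" using eq B by auto
    finally have "unit_vec r i - unit_vec r j = (0\<^sub>v r :: 'k vec)"
      using inj_matD[OF inj B] by simp
    from arg_cong[OF this, of "\<lambda>v. v $ i"] show False using ir ij(3) by simp
  qed
  have "lin_indpt (set (cols B))"
  proof
    assume "lin_dep (set (cols B))"
    then obtain v where "v \<in> carrier_vec r" "v \<noteq> 0\<^sub>v r" "B *\<^sub>v v = 0\<^sub>v d"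
      by (rule lin_depE[OF B _ dist])
    then show False using inj_matD[OF inj B] by blast
  qed
  then have "rank B = r" by (rule lin_indpt_full_rank[OF B dist])
  moreover have "span (set (cols B)) = colspace B"
    using col_space_eq[OF B] B by (auto simp: col_space_def colspace_def)
  ultimately show ?thesis by (simp add: vec_dim_def rank_def)
qed

lemma vec_subspace_colspace:
  "A \<in> carrier_mat d r \<Longrightarrow> vec_subspace d (colspace A)"
  unfolding vec_subspace_iff
  by (intro conjI ballI allI colspace_carrier colspace_zero colspace_add colspace_smult)

text \<open>The columns are an independent family in \<open>U\<close> of maximal length; lengths are
  bounded by \<open>d\<close>.\<close>

lemma vec_subspace_is_colspace:
  fixes U :: "'k :: field vec set"
  assumes "vec_subspace d U"
  obtains r B where "B \<in> carrier_mat d r" "inj_mat B" "colspace B = U"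
proof -
  have U: "U \<subseteq> carrier_vec d" "0\<^sub>v d \<in> U" "\<And>x y. x \<in> U \<Longrightarrow> y \<in> U \<Longrightarrow> x + y \<in> U"
    "\<And>c x. x \<in> U \<Longrightarrow> c \<cdot>\<^sub>v x \<in> U"
    using assms by (auto simp: vec_subspace_iff)
  define P where "P r \<longleftrightarrow> (\<exists>w. (\<forall>j. w j \<in> U) \<and> inj_mat (colmat d r w))" for r
  have P0: "P 0" unfolding P_def
    by (intro exI[of _ "\<lambda>_. 0\<^sub>v d"] conjI inj_colmat_0) (use U(2) in simp)
  have bound: "P r \<Longrightarrow> r \<le> d" for r
    unfolding P_def using inj_mat_le[OF colmat_carrier] by blast
  define r where "r = (GREATEST r. P r)"
  have "P r" unfolding r_def by (rule GreatestI_nat[of P 0 d]) (use P0 bound in auto)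
  then obtain w where w: "\<And>j. w j \<in> U" "inj_mat (colmat d r w)" unfolding P_def by auto
  have "colspace (colmat d r w) \<subseteq> U"
  proof
    fix x assume "x \<in> colspace (colmat d r w)"
    then obtain v where "v \<in> carrier_vec r" "x = colmat d r w *\<^sub>v v"
      by (rule colspaceE[OF _ colmat_carrier])
    then show "x \<in> U" using colmat_span_subset[of U d r w v] U w(1) by blast
  qed
  moreover have "x \<in> colspace (colmat d r w)" if "x \<in> U" for x
  proof (rule ccontr)
    assume notin: "x \<notin> colspace (colmat d r w)"
    have eq: "colmat d r (w(r := x)) = colmat d r w" by (rule colmat_cong) simp
    have "inj_mat (colmat d (Suc r) (w(r := x)))"
      by (rule inj_colmat_Suc) (use w eq notin that U(1) in auto)
    then have "P (Suc r)" unfolding P_def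
      by (intro exI[of _ "w(r := x)"]) (use w that in auto)
    then have "Suc r \<le> r" unfolding r_def by (rule Greatest_le_nat) (rule bound)
    then show False by simp
  qed
  ultimately show ?thesis using that[OF colmat_carrier w(2)] by blast
qed

lemma mult_vec_split:
  assumes A: "(A :: 'k :: field mat) \<in> carrier_mat c d" and r: "r \<le> d" and v: "v \<in> carrier_vec d"
  shows "A *\<^sub>v v = colmat c r (\<lambda>j. col A j) *\<^sub>v vec r (\<lambda>j. v $ j) +
    colmat c (d - r) (\<lambda>j. col A (r + j)) *\<^sub>v vec (d - r) (\<lambda>j. v $ (r + j))"
proof (rule eq_vecI)
  fix i assume "i < dim_vec (colmat c r (\<lambda>j. col A j) *\<^sub>v vec r (\<lambda>j. v $ j) +
    colmat c (d - r) (\<lambda>j. col A (r + j)) *\<^sub>v vec (d - r) (\<lambda>j. v $ (r + j)))"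
  then have i: "i < c" by simp
  have "(A *\<^sub>v v) $ i = (\<Sum>j<d. A $$ (i, j) * v $ j)"
    using i A v by (simp add: scalar_prod_def atLeast0LessThan)
  also have "{..<d} = {..<r} \<union> {r..<d}" using r by auto
  also have "(\<Sum>j\<in>\<dots>. A $$ (i, j) * v $ j) =
      (\<Sum>j<r. A $$ (i, j) * v $ j) + (\<Sum>j=r..<d. A $$ (i, j) * v $ j)"
    by (rule sum.union_disjoint) auto
  also have "(\<Sum>j=r..<d. A $$ (i, j) * v $ j) = (\<Sum>j<d - r. A $$ (i, r + j) * v $ (r + j))"
    using sum.shift_bounds_nat_ivl[of "\<lambda>j. A $$ (i, j) * v $ j" 0 r "d - r"] r
    by (simp add: atLeast0LessThan add.commute)
  finally show "(A *\<^sub>v v) $ i = (colmat c r (\<lambda>j. col A j) *\<^sub>v vec r (\<lambda>j. v $ j) +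
    colmat c (d - r) (\<lambda>j. col A (r + j)) *\<^sub>v vec (d - r) (\<lambda>j. v $ (r + j))) $ i"
    using i A r by (simp del: index_mult_mat_vec add: colmat_mult_vec_index)
qed (use A in simp_all)

text \<open>The first \<open>r\<close> columns of \<open>P\<close> are a basis of the subspace and
  the others complete it. Coordinates in this basis make the subspace visible to diagonal
  one-parameter subgroups.\<close>

lemma vec_subspace_adapted_basis:
  fixes U :: "'k :: field vec set"
  assumes U: "vec_subspace d U"
  obtains P r where "P \<in> carrier_mat d d" "Determinant.det P \<noteq> 0" "r \<le> d" "vec_dim d U = int r"
    "\<forall>v\<in>carrier_vec d. P *\<^sub>v v \<in> U \<longleftrightarrow> (\<forall>i. r \<le> i \<and> i < d \<longrightarrow> v $ i = 0)"
proof -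
  obtain r B where B: "B \<in> carrier_mat d r" and inj: "inj_mat B" and BU: "colspace B = U"
    using vec_subspace_is_colspace[OF U] .
  obtain P where P: "P \<in> carrier_mat d d" "Determinant.det P \<noteq> 0" "\<forall>j<r. col P j = col B j"
    using extend_inj_mat[OF B inj] .
  have r: "r \<le> d" using inj_mat_le[OF B inj] .
  have injP: "inj_mat P" using P by (simp add: inj_mat_iff_det)
  have PB: "P *\<^sub>v v = B *\<^sub>v vec r (\<lambda>j. v $ j)"
    if v: "v \<in> carrier_vec d" and z: "\<And>i. r \<le> i \<Longrightarrow> i < d \<Longrightarrow> v $ i = 0" for v
  proof -
    have "vec (d - r) (\<lambda>j. v $ (r + j)) = 0\<^sub>v (d - r)" using z by (intro eq_vecI) auto
    then have 0: "colmat d (d - r) (\<lambda>j. col P (r + j)) *\<^sub>v vec (d - r) (\<lambda>j. v $ (r + j)) = 0\<^sub>v d"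
      by (simp add: mult_mat_vec_def) (auto intro!: eq_vecI simp: scalar_prod_def)
    have "colmat d r (\<lambda>j. col P j) = B"
      using P(3) colmat_cong[of r "col P" "col B" d] colmat_cols[OF B] by simp
    then have "colmat d r (\<lambda>j. col P j) *\<^sub>v vec r (\<lambda>j. v $ j) = B *\<^sub>v vec r (\<lambda>j. v $ j)" by simp
    moreover have "B *\<^sub>v vec r (\<lambda>j. v $ j) \<in> carrier_vec d" using B by simp
    ultimately show ?thesis using mult_vec_split[OF P(1) r v] 0 by simp
  qed
  have "P *\<^sub>v v \<in> U \<longleftrightarrow> (\<forall>i. r \<le> i \<and> i < d \<longrightarrow> v $ i = 0)" if v: "v \<in> carrier_vec d" for v
  proof
    assume "P *\<^sub>v v \<in> U"
    then obtain x where x: "x \<in> carrier_vec r" "P *\<^sub>v v = B *\<^sub>v x"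
      using BU colspaceE[OF _ B] by metis
    define y where "y = vec d (\<lambda>i. if i < r then x $ i else 0)"
    have y: "y \<in> carrier_vec d" by (simp add: y_def)
    have "vec r (\<lambda>j. y $ j) = x" using x r by (intro eq_vecI) (auto simp: y_def)
    then have "P *\<^sub>v y = P *\<^sub>v v" using PB[OF y] x(2) by (simp add: y_def)
    then have "P *\<^sub>v (v - y) = 0\<^sub>v d" using P v y by (simp add: mult_minus_distrib_mat_vec)
    then have "v - y = 0\<^sub>v d" using inj_matD[OF injP P(1)] v y by simp
    then have "v $ i - y $ i = 0" if "i < d" for i
      using that v y by (metis index_minus_vec(1) carrier_vecD index_zero_vec(1))
    then show "\<forall>i. r \<le> i \<and> i < d \<longrightarrow> v $ i = 0" by (auto simp: y_def)
  next
    assume "\<forall>i. r \<le> i \<and> i < d \<longrightarrow> v $ i = 0"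
    then have "P *\<^sub>v v = B *\<^sub>v vec r (\<lambda>j. v $ j)" using PB v by blast
    then show "P *\<^sub>v v \<in> U" using BU colspaceI[OF B, of "vec r (\<lambda>j. v $ j)"] by simp
  qed
  then show ?thesis using that[OF P(1,2) r] vec_dim_colspace[OF B inj] BU by blast
qed

lemma vec_dim_bounds:
  assumes "vec_subspace d (U :: 'k :: field vec set)"
  shows "0 \<le> vec_dim d U" "vec_dim d U \<le> int d"
  using assms by (metis vec_subspace_adapted_basis of_nat_0_le_iff of_nat_le_iff)+

lemma vec_dim_eq_full:
  assumes U: "vec_subspace d (U :: 'k :: field vec set)"
  shows "vec_dim d U = int d \<longleftrightarrow> U = carrier_vec d"
proof -
  obtain P r where P: "P \<in> carrier_mat d d" "Determinant.det P \<noteq> 0" "r \<le> d" "vec_dim d U = int r"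
    "\<forall>v\<in>carrier_vec d. P *\<^sub>v v \<in> U \<longleftrightarrow> (\<forall>i. r \<le> i \<and> i < d \<longrightarrow> v $ i = 0)"
    using vec_subspace_adapted_basis[OF U] .
  have "U = carrier_vec d" if "r = d"
  proof -
    obtain Q where "Q \<in> carrier_mat d d" "P * Q = 1\<^sub>m d"
      using det_non_zero_imp_unit[OF P(1,2), of "()"] by (auto simp: Units_def ring_mat_simps)
    then have "x = P *\<^sub>v (Q *\<^sub>v x)" "Q *\<^sub>v x \<in> carrier_vec d" if "x \<in> carrier_vec d" for x
      using that P(1) by (auto simp: assoc_mult_mat_vec[symmetric])
    then have "carrier_vec d \<subseteq> U" using P(5) \<open>r = d\<close> by (metis leD subsetI)
    then show ?thesis using U by (auto simp: vec_subspace_iff)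
  qed
  moreover have "r = d" if "U = carrier_vec d"
  proof (rule ccontr)
    assume "r \<noteq> d"
    then have "r < d" using P(3) by simp
    moreover have "P *\<^sub>v unit_vec d r \<in> U" using that P(1) by simp
    ultimately show False using P(5) by auto
  qed
  ultimately show ?thesis using P(4) by auto
qed

lemma vec_dim_eq_0:
  assumes U: "vec_subspace d (U :: 'k :: field vec set)"
  shows "vec_dim d U = 0 \<longleftrightarrow> U = {0\<^sub>v d}"
proof -
  obtain r B where B: "B \<in> carrier_mat d r" and inj: "inj_mat B" and BU: "colspace B = U"
    using vec_subspace_is_colspace[OF U] .
  have "U = {0\<^sub>v d}" if "r = 0"
  proof -
    have "B *\<^sub>v v = 0\<^sub>v d" if "v \<in> carrier_vec 0" for v
      using that B \<open>r = 0\<close> by (intro eq_vecI) (auto simp: scalar_prod_def)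
    then show ?thesis using BU B \<open>r = 0\<close> colspace_zero[OF B] by (auto simp: colspace_def)
  qed
  moreover have "r = 0" if "U = {0\<^sub>v d}"
  proof (rule ccontr)
    assume "r \<noteq> 0"
    then have "B *\<^sub>v unit_vec r 0 = 0\<^sub>v d" using that BU colspaceI[OF B, of "unit_vec r 0"] by auto
    then show False using inj_matD[OF inj B, of "unit_vec r 0"] \<open>r \<noteq> 0\<close> by auto
  qed
  ultimately show ?thesis using vec_dim_colspace[OF B inj] BU by auto
qed

lemma inj_mat_right_factor:
  assumes A: "A \<in> carrier_mat d r" and Z: "Z \<in> carrier_mat r s" and inj: "inj_mat (A * Z)"
  shows "inj_mat Z"
proof (rule inj_matI[OF Z])
  fix v assume v: "v \<in> carrier_vec s" "Z *\<^sub>v v = 0\<^sub>v r"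
  have "A * Z *\<^sub>v v = A *\<^sub>v (Z *\<^sub>v v)" by (rule assoc_mult_mat_vec[OF A Z v(1)])
  also have "\<dots> = 0\<^sub>v d" using v(2) A by auto
  finally show "v = 0\<^sub>v s" using inj_matD[OF inj, of d s v] A Z v(1) by simp
qed

text \<open>A basis matrix \<open>B\<close> of the column space factors through \<open>A\<close>;
  the right factor inherits injectivity from \<open>B\<close>, so it has at most as many columns as
  rows.\<close>

lemma vec_dim_colspace_le:
  assumes A: "(A :: 'k :: field mat) \<in> carrier_mat d r"
  shows "vec_dim d (colspace A) \<le> int r"
proof -
  obtain s B where B: "B \<in> carrier_mat d s" and inj: "inj_mat B" and eq: "colspace B = colspace A"
    using vec_subspace_is_colspace[OF vec_subspace_colspace[OF A]] .
  have "\<exists>z. z \<in> carrier_vec r \<and> col B j = A *\<^sub>v z" if "j < s" for j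
    using col_in_colspace[OF B that] eq colspaceE[OF _ A] by metis
  then obtain z where z: "\<And>j. j < s \<Longrightarrow> z j \<in> carrier_vec r" "\<And>j. j < s \<Longrightarrow> col B j = A *\<^sub>v z j"
    by metis
  have "A * colmat r s z = colmat d s (\<lambda>j. A *\<^sub>v z j)" by (rule mult_colmat[OF A z(1)])
  also have "\<dots> = colmat d s (col B)" by (rule colmat_cong) (rule z(2)[symmetric])
  also have "\<dots> = B" by (rule colmat_cols[OF B])
  finally have "A * colmat r s z = B" .
  then have "inj_mat (colmat r s z)"
    by (intro inj_mat_right_factor[OF A colmat_carrier]) (simp only: inj)
  then have "s \<le> r" by (rule inj_mat_le[OF colmat_carrier])
  then show ?thesis by (simp only: eq[symmetric] vec_dim_colspace[OF B inj] of_nat_le_iff)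
qed

section \<open>Kernels, images and rank-nullity\<close>

definition kernel_of :: "'k :: field mat \<Rightarrow> 'k vec set" where
  "kernel_of A = {v \<in> carrier_vec (dim_col A). A *\<^sub>v v = 0\<^sub>v (dim_row A)}"

lemma kernel_of_iff:
  "A \<in> carrier_mat c d \<Longrightarrow> v \<in> kernel_of A \<longleftrightarrow> v \<in> carrier_vec d \<and> A *\<^sub>v v = 0\<^sub>v c"
  by (auto simp: kernel_of_def)

lemma vec_subspace_kernel_of:
  "A \<in> carrier_mat c d \<Longrightarrow> vec_subspace d (kernel_of A)"
  by (auto simp: vec_subspace_iff kernel_of_iff mult_add_distrib_mat_vec mult_mat_vec)

text \<open>In a basis adapted to the kernel the first \<open>r\<close> columns of
  \<open>C * P\<close> vanish, and the remaining ones are independent and span the image.\<close>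

lemma rank_nullity_mat:
  assumes C: "(C :: 'k :: field mat) \<in> carrier_mat c d"
  shows "vec_dim d (kernel_of C) + vec_dim c (colspace C) = int d"
proof -
  obtain P r where P: "P \<in> carrier_mat d d" "Determinant.det P \<noteq> 0" "r \<le> d"
    "vec_dim d (kernel_of C) = int r"
    "\<forall>v\<in>carrier_vec d. P *\<^sub>v v \<in> kernel_of C \<longleftrightarrow> (\<forall>i. r \<le> i \<and> i < d \<longrightarrow> v $ i = 0)"
    by (rule vec_subspace_adapted_basis[OF vec_subspace_kernel_of[OF C]])
  let ?B = "colmat c (d - r) (\<lambda>j. col (C * P) (r + j))"
  have CP: "C * P \<in> carrier_mat c d" using C P by simp
  have "col (C * P) j = 0\<^sub>v c" if "j < r" for j
  proof -
    have "P *\<^sub>v unit_vec d j \<in> kernel_of C" using that P(3) by (subst bspec[OF P(5)]) auto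
    moreover have "C * P *\<^sub>v unit_vec d j = col (C * P) j"
      using CP that P(3) by (auto intro!: eq_vecI)
    ultimately show ?thesis using C P(1) by (simp add: kernel_of_iff assoc_mult_mat_vec[OF C P(1)])
  qed
  then have 0: "colmat c r (\<lambda>j. col (C * P) j) = 0\<^sub>m c r"
    using C P(3) by (intro eq_matI) (auto simp: colmat_def simp del: col_mult2)
  have split: "C *\<^sub>v (P *\<^sub>v v) = ?B *\<^sub>v vec (d - r) (\<lambda>j. v $ (r + j))" if v: "v \<in> carrier_vec d" for v
  proof -
    have "0\<^sub>m c r *\<^sub>v vec r (\<lambda>j. v $ j) = 0\<^sub>v c"
      by (intro eq_vecI) (auto simp: scalar_prod_def)
    moreover have "?B *\<^sub>v vec (d - r) (\<lambda>j. v $ (r + j)) \<in> carrier_vec c" by (rule carrier_vecI) simp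
    ultimately show ?thesis
      using mult_vec_split[OF CP P(3) v] 0 by (simp add: assoc_mult_mat_vec[OF C P(1) v])
  qed
  have inj: "inj_mat ?B"
  proof (rule inj_matI[OF colmat_carrier])
    fix x :: "'k vec" assume x: "x \<in> carrier_vec (d - r)" "?B *\<^sub>v x = 0\<^sub>v c"
    define v where "v = vec d (\<lambda>i. if i < r then 0 else x $ (i - r))"
    have v: "v \<in> carrier_vec d" by (simp add: v_def)
    have "vec (d - r) (\<lambda>j. v $ (r + j)) = x" using x(1) by (intro eq_vecI) (auto simp: v_def)
    then have "P *\<^sub>v v \<in> kernel_of C"
      using split[OF v] x(2) C P(1) v by (simp add: kernel_of_iff)
    then have "v $ (r + i) = 0" if "i < d - r" for i using bspec[OF P(5) v] that by auto
    then show "x = 0\<^sub>v (d - r)" using x(1) by (intro eq_vecI) (auto simp: v_def)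
  qed
  have "colspace ?B = colspace C"
  proof
    show "colspace ?B \<subseteq> colspace C"
    proof
      fix y assume "y \<in> colspace ?B"
      then obtain x where x: "x \<in> carrier_vec (d - r)" "y = ?B *\<^sub>v x"
        by (rule colspaceE[OF _ colmat_carrier])
      define v where "v = vec d (\<lambda>i. if i < r then 0 else x $ (i - r))"
      have v: "v \<in> carrier_vec d" by (simp add: v_def)
      have "vec (d - r) (\<lambda>j. v $ (r + j)) = x" using x(1) by (intro eq_vecI) (auto simp: v_def)
      then have "y = C *\<^sub>v (P *\<^sub>v v)" using split[OF v] x by simp
      then show "y \<in> colspace C" using colspaceI[OF C, of "P *\<^sub>v v"] P(1) v by simp
    qed
    show "colspace C \<subseteq> colspace ?B"
    proof
      fix y assume "y \<in> colspace C"
      then obtain x where x: "x \<in> carrier_vec d" "y = C *\<^sub>v x"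
        by (rule colspaceE[OF _ C])
      obtain Q where Q: "Q \<in> carrier_mat d d" "P * Q = 1\<^sub>m d"
        using det_non_zero_imp_unit[OF P(1,2), of "()"] by (auto simp: Units_def ring_mat_simps)
      have "x = P *\<^sub>v (Q *\<^sub>v x)"
        using x(1) P(1) Q by (simp add: assoc_mult_mat_vec[symmetric])
      moreover have Qx: "Q *\<^sub>v x \<in> carrier_vec d" using Q(1) x(1) by simp
      ultimately have "y = ?B *\<^sub>v vec (d - r) (\<lambda>j. (Q *\<^sub>v x) $ (r + j))"
        using split[OF Qx] x(2) by simp
      then show "y \<in> colspace ?B"
        using colspaceI[OF colmat_carrier] by (metis vec_carrier)
    qed
  qed
  then show ?thesis using P(3,4) vec_dim_colspace[OF colmat_carrier inj] by simp
qed

text \<open>If the image were proper, a nonzero functional vanishing on a basis of it would lie in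
  the kernel of the transpose.\<close>

lemma surj_mat_colspace:
  assumes C: "(C :: 'k :: field mat) \<in> carrier_mat c d" and inj: "inj_mat C\<^sup>T"
  shows "vec_dim c (colspace C) = int c"
proof -
  obtain s B where B: "B \<in> carrier_mat c s" and injB: "inj_mat B" and eq: "colspace B = colspace C"
    using vec_subspace_is_colspace[OF vec_subspace_colspace[OF C]] .
  have "\<not> s < c"
  proof
    assume "s < c"
    then obtain w where w: "w \<in> carrier_vec c" "w \<noteq> 0\<^sub>v c" "B\<^sup>T *\<^sub>v w = 0\<^sub>v s"
      using left_kernel_exists[OF B] by blast
    have "C\<^sup>T *\<^sub>v w = 0\<^sub>v d"
    proof (rule eq_vecI)
      fix j assume "j < dim_vec (0\<^sub>v d :: 'k vec)"
      then have j: "j < d" by simp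
      then obtain x where x: "x \<in> carrier_vec s" "col C j = B *\<^sub>v x"
        using col_in_colspace[OF C, of j] eq colspaceE[OF _ B] by metis
      have "(C\<^sup>T *\<^sub>v w) $ j = col C j \<bullet> w" using j C by simp
      also have "\<dots> = w \<bullet> (B *\<^sub>v x)" using x w(1) B comm_scalar_prod[of w c "B *\<^sub>v x"] by simp
      also have "\<dots> = (B\<^sup>T *\<^sub>v w) \<bullet> x"
        by (rule transpose_vec_mult_scalar[OF B x(1) w(1), symmetric])
      finally show "(C\<^sup>T *\<^sub>v w) $ j = 0\<^sub>v d $ j" using w(3) x(1) j by simp
    qed (use C in simp)
    then show False using inj_matD[OF inj, of d c w] w C by simp
  qed
  then show ?thesis using inj_mat_le[OF B injB] vec_dim_colspace[OF B injB] eq by simp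
qed

section \<open>Pencils that expand subspaces\<close>

text \<open>The \<open>w j\<close> are a basis of a subspace of the kernel of \<open>C\<close>, and the \<open>y j\<close> span a space that
  contains its images under \<open>A\<close> and \<open>B\<close>; linear dependence of the \<open>y j\<close> is harmless.\<close>

definition expanding :: "nat \<Rightarrow> nat \<Rightarrow> 'k :: field mat \<Rightarrow> 'k mat \<Rightarrow> 'k mat \<Rightarrow> bool" where
  "expanding a b A B C \<longleftrightarrow>
     (\<forall>r s w y. 0 < r \<longrightarrow> inj_mat (colmat (dim_col A) r w) \<longrightarrow>
        (\<forall>j<r. w j \<in> carrier_vec (dim_col A) \<and> C *\<^sub>v w j = 0\<^sub>v (dim_row C)) \<longrightarrow>
        (\<forall>j<s. y j \<in> carrier_vec (dim_row A)) \<longrightarrow>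
        (\<forall>j<r. A *\<^sub>v w j \<in> colspace (colmat (dim_row A) s y) \<and>
               B *\<^sub>v w j \<in> colspace (colmat (dim_row A) s y)) \<longrightarrow>
        a * r < b * s)"

lemma expandingD:
  assumes "expanding a b A B C" "A \<in> carrier_mat e d" "C \<in> carrier_mat c d"
    and "0 < r" "inj_mat (colmat d r w)"
    and "\<And>j. j < r \<Longrightarrow> w j \<in> carrier_vec d" "\<And>j. j < r \<Longrightarrow> C *\<^sub>v w j = 0\<^sub>v c"
    and "\<And>j. j < s \<Longrightarrow> y j \<in> carrier_vec e"
    and "\<And>j. j < r \<Longrightarrow> A *\<^sub>v w j \<in> colspace (colmat e s y)"
    and "\<And>j. j < r \<Longrightarrow> B *\<^sub>v w j \<in> colspace (colmat e s y)"
  shows "a * r < b * s"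
  using assms(1)[unfolded expanding_def, rule_format, of r w s y] assms(2-) by auto

text \<open>The prefix stops at the first vector that depends on its predecessors. That this vector
  lies in the span is what lets the relations of a chain close up on the span of the prefix.\<close>

lemma independent_prefix:
  fixes w :: "nat \<Rightarrow> 'k :: field vec"
  assumes "1 \<le> D" and w: "\<And>j. j < D \<Longrightarrow> w j \<in> carrier_vec d" and "w 0 \<noteq> 0\<^sub>v d"
  shows "\<exists>r. 1 \<le> r \<and> r \<le> D \<and> inj_mat (colmat d r w) \<and> (r = D \<or> w r \<in> colspace (colmat d r w))"
  using assms(1) w
proof (induction D rule: dec_induct)
  case base
  have "x = 0\<^sub>v d" if x: "x \<in> colspace (colmat d 0 w)" for x
  proof -
    obtain v where "v \<in> carrier_vec 0" "x = colmat d 0 w *\<^sub>v v"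
      using x by (rule colspaceE[OF _ colmat_carrier])
    then show ?thesis by (intro eq_vecI) (auto simp: colmat_def scalar_prod_def)
  qed
  then have "inj_mat (colmat d (Suc 0) w)"
    using inj_colmat_Suc[OF inj_colmat_0] base assms(3) by auto
  then show ?case by (intro exI[of _ 1]) simp
next
  case (step D)
  then obtain r where r: "1 \<le> r" "r \<le> D" "inj_mat (colmat d r w)"
    "r = D \<or> w r \<in> colspace (colmat d r w)" by auto
  show ?case
  proof (cases "w r \<in> colspace (colmat d r w)")
    case True
    then show ?thesis using r by (intro exI[of _ r]) auto
  next
    case False
    then have "r = D" using r by simp
    then have "inj_mat (colmat d (Suc D) w)"
      using inj_colmat_Suc[of d r w] r False step.prems by auto
    then show ?thesis using r by (intro exI[of _ "Suc D"]) auto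
  qed
qed

lemma add_eq_0_uminus_vec:
  fixes x y :: "'k :: field vec"
  assumes "x \<in> carrier_vec e" "y \<in> carrier_vec e" "x + y = 0\<^sub>v e"
  shows "x = - y" "y = - x"
proof -
  have eq: "x $ i + y $ i = 0" if "i < e" for i
    using arg_cong[OF assms(3), of "\<lambda>v. v $ i"] that assms(1,2) by simp
  show "x = - y" by (rule eq_vecI) (use eq assms in \<open>auto simp: eq_neg_iff_add_eq_0\<close>)
  show "y = - x" by (rule eq_vecI) (use eq assms in \<open>auto simp: eq_neg_iff_add_eq_0 add.commute\<close>)
qed

text \<open>The vectors \<open>u j\<close> are the coefficients of a polynomial kernel vector of the pencil; the
  maximal independent prefix of the nonzero part spans a subspace with too small an image.\<close>

lemma tall_sequence_zero:
  fixes A B C :: "'k :: field mat"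
  assumes exp: "expanding a b A B C"
    and A: "A \<in> carrier_mat e d" and B: "B \<in> carrier_mat e d" and C: "C \<in> carrier_mat c d"
    and u: "\<And>j. j < D \<Longrightarrow> u j \<in> carrier_vec d" and Cu: "\<And>j. j < D \<Longrightarrow> C *\<^sub>v u j = 0\<^sub>v c"
    and first: "0 < D \<Longrightarrow> A *\<^sub>v u 0 = 0\<^sub>v e"
    and mid: "\<And>j. Suc j < D \<Longrightarrow> A *\<^sub>v u (Suc j) + B *\<^sub>v u j = 0\<^sub>v e"
    and last: "0 < D \<Longrightarrow> B *\<^sub>v u (D - 1) = 0\<^sub>v e"
    and slope: "b * D \<le> a * D + b"
    and j: "j < D"
  shows "u j = 0\<^sub>v d"
proof (rule ccontr)
  assume "u j \<noteq> 0\<^sub>v d"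
  \<comment> \<open>Leading zeros are dropped. The shortened chain still starts with
    \<open>A *\<^sub>v w 0\<close> = 0, either by \<open>first\<close> or by the relation linking
    \<open>u i0\<close> to its zero predecessor.\<close>
  define i0 where "i0 = (LEAST i. u i \<noteq> 0\<^sub>v d)"
  have i0: "u i0 \<noteq> 0\<^sub>v d" unfolding i0_def by (rule LeastI[of _ j]) fact
  have before: "u i = 0\<^sub>v d" if "i < i0" for i using not_less_Least that unfolding i0_def by blast
  have i0D: "i0 < D" using \<open>u j \<noteq> 0\<^sub>v d\<close> j Least_le[of "\<lambda>i. u i \<noteq> 0\<^sub>v d" j] unfolding i0_def by simp
  define w where "w i = u (i0 + i)" for i
  have w0: "w 0 \<noteq> 0\<^sub>v d" using i0 by (simp add: w_def)
  have w: "w i \<in> carrier_vec d" if "i < D - i0" for i using that u unfolding w_def by simp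
  have D1: "1 \<le> D - i0" using i0D by simp
  obtain r where r: "1 \<le> r" "r \<le> D - i0" "inj_mat (colmat d r w)"
    "r = D - i0 \<or> w r \<in> colspace (colmat d r w)"
    using independent_prefix[of "D - i0" w d, OF D1 w w0] by blast
  \<comment> \<open>These \<open>r - 1\<close> vectors span all images:
    \<open>A *\<^sub>v w 0\<close> vanishes, every other A-image is minus the preceding B-image, and
    the last B-image is 0 at the end of the chain or else minus the image of \<open>w r\<close>,
    which lies in the span of the prefix.\<close>
  let ?Y = "colmat e (r - 1) (\<lambda>i. B *\<^sub>v w i)"
  have Y: "B *\<^sub>v w i \<in> carrier_vec e" if "i < r" for i using w[of i] that r B by simp
  have Bw: "B *\<^sub>v w i \<in> colspace ?Y" if "i < r - 1" for i
    using colmat_in_colspace[of i "r - 1" "\<lambda>i. B *\<^sub>v w i" e] Y that by simp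
  have step: "A *\<^sub>v w (Suc i) = - (B *\<^sub>v w i)" "B *\<^sub>v w i = - (A *\<^sub>v w (Suc i))" if "Suc i < D - i0" for i
    using add_eq_0_uminus_vec[of "A *\<^sub>v w (Suc i)" e "B *\<^sub>v w i"] mid[of "i0 + i"] that A B
      w[of i] w[OF that] by (auto simp: w_def)
  have A0: "A *\<^sub>v w 0 = 0\<^sub>v e"
  proof (cases i0)
    case 0
    then show ?thesis using first i0D by (simp add: w_def)
  next
    case (Suc i)
    have "B *\<^sub>v 0\<^sub>v d = 0\<^sub>v e" using B by auto
    then show ?thesis using mid[of i] Suc before[of i] i0D A u[of i0] by (simp add: w_def)
  qed
  have Aw: "A *\<^sub>v w i \<in> colspace ?Y" if "i < r" for i
  proof (cases i)
    case 0
    then show ?thesis using A0 colspace_zero[OF colmat_carrier] by simp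
  next
    case (Suc k)
    then have "A *\<^sub>v w i = - (B *\<^sub>v w k)" using step(1)[of k] that r by simp
    then show ?thesis using colspace_uminus[OF colmat_carrier Bw[of k]] Suc that by simp
  qed
  have Bw': "B *\<^sub>v w i \<in> colspace ?Y" if i: "i < r" for i
  proof (cases "i < r - 1")
    case False
    then have ir: "i = r - 1" using i by simp
    show ?thesis
    proof (cases "r = D - i0")
      case True
      then have "B *\<^sub>v w i = 0\<^sub>v e" using last ir i0D r by (simp add: w_def)
      then show ?thesis using colspace_zero[OF colmat_carrier] by simp
    next
      case False
      then have wr: "w r \<in> colspace (colmat d r w)" using r by simp
      have "A *\<^sub>v w r \<in> colspace ?Y"
        by (rule mult_colspace_subset[OF A colmat_carrier w Aw wr]) (use r in auto)
      moreover have "B *\<^sub>v w i = - (A *\<^sub>v w r)" using step(2)[of i] False ir r by simp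
      ultimately show ?thesis using colspace_uminus[OF colmat_carrier] by simp
    qed
  qed (rule Bw)
  have "a * r < b * (r - 1)"
    by (rule expandingD[OF exp A C _ r(3) w _ _ Aw Bw'])
      (use r Cu Y in \<open>auto simp: w_def\<close>)
  \<comment> \<open>The inequality reads b < (b - a) r; it forces b > a, and then r \<le> D gives b
    < (b - a) D, against \<open>slope\<close>.\<close>
  then have "int a * int r < int b * (int r - 1)"
    using r(1) by (metis (no_types) of_nat_less_iff of_nat_mult of_nat_diff of_nat_1)
  then have pos: "(int b - int a) * int r > int b" by (simp add: algebra_simps)
  then have "(int b - int a) * int r > 0" by (meson of_nat_0_le_iff order_le_less_trans)
  then have "int b - int a > 0" using zero_less_mult_pos2 r(1) by fastforce
  moreover have "int r \<le> int D" using r(2) by simp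
  ultimately have "(int b - int a) * int r \<le> (int b - int a) * int D"
    by (intro mult_left_mono) auto
  moreover have "(int b - int a) * int D \<le> int b"
    using slope by (simp add: algebra_simps flip: of_nat_mult of_nat_add)
  ultimately show False using pos by linarith
qed

text \<open>Here the chain has D + 1 vectors, D relations and no end conditions. If the independent
  prefix stops early or the chain starts with zeros, its r vectors have images in a span of r
  vectors; otherwise r = D + 1 and the images lie in a span of D + 2 vectors. Both contradict the
  expansion.\<close>

lemma wide_sequence_zero:
  fixes A B C :: "'k :: field mat"
  assumes exp: "expanding a b A B C"
    and A: "A \<in> carrier_mat e d" and B: "B \<in> carrier_mat e d" and C: "C \<in> carrier_mat c d"
    and u: "\<And>j. j \<le> D \<Longrightarrow> u j \<in> carrier_vec d" and Cu: "\<And>j. j \<le> D \<Longrightarrow> C *\<^sub>v u j = 0\<^sub>v c"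
    and mid: "\<And>j. j < D \<Longrightarrow> A *\<^sub>v u j + B *\<^sub>v u (Suc j) = 0\<^sub>v e"
    and slope: "b * (D + 2) \<le> a * (D + 1)" and b: "0 < b"
    and j: "j \<le> D"
  shows "u j = 0\<^sub>v d"
proof (rule ccontr)
  assume "u j \<noteq> 0\<^sub>v d"
  define i0 where "i0 = (LEAST i. u i \<noteq> 0\<^sub>v d)"
  have i0: "u i0 \<noteq> 0\<^sub>v d" unfolding i0_def by (rule LeastI[of _ j]) fact
  have before: "u i = 0\<^sub>v d" if "i < i0" for i using not_less_Least that unfolding i0_def by blast
  have i0D: "i0 \<le> D" using \<open>u j \<noteq> 0\<^sub>v d\<close> j Least_le[of "\<lambda>i. u i \<noteq> 0\<^sub>v d" j] unfolding i0_def by simp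
  define w where "w i = u (i0 + i)" for i
  have w0: "w 0 \<noteq> 0\<^sub>v d" using i0 by (simp add: w_def)
  have w: "w i \<in> carrier_vec d" if "i < D + 1 - i0" for i using that u unfolding w_def by simp
  have D1: "1 \<le> D + 1 - i0" using i0D by simp
  obtain r where r: "1 \<le> r" "r \<le> D + 1 - i0" "inj_mat (colmat d r w)"
    "r = D + 1 - i0 \<or> w r \<in> colspace (colmat d r w)"
    using independent_prefix[of "D + 1 - i0" w d, OF D1 w w0] by blast
  have step: "A *\<^sub>v w i = - (B *\<^sub>v w (Suc i))" "B *\<^sub>v w (Suc i) = - (A *\<^sub>v w i)" if "Suc i < D + 1 - i0" for i
    using add_eq_0_uminus_vec[of "A *\<^sub>v w i" e "B *\<^sub>v w (Suc i)"] mid[of "i0 + i"] that A B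
      w[of i] w[OF that] by (auto simp: w_def)
  have Aw: "A *\<^sub>v w i \<in> carrier_vec e" and Bw: "B *\<^sub>v w i \<in> carrier_vec e" if "i < r" for i
    using w[of i] that r A B by simp_all
  have Cw: "C *\<^sub>v w i = 0\<^sub>v c" if "i < r" for i using Cu that r by (simp add: w_def)
  have wr: "w i \<in> carrier_vec d" if "i < r" for i using w that r by simp
  have ab: "b < a"
  proof (rule ccontr)
    assume "\<not> b < a"
    then have "a * (D + 1) \<le> b * (D + 1)" by (intro mult_right_mono) auto
    with slope b show False by simp
  qed
  \<comment> \<open>An image spanned by only \<open>r\<close> vectors is already impossible because
    b < a; this settles every case but the last.\<close>
  have contr: False if "a * r < b * r" using that ab r(1) by simp
  show False
  proof (cases "r = D + 1 - i0")
    case False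
    then have wr': "w r \<in> colspace (colmat d r w)" using r by simp
    let ?Y = "colmat e r (\<lambda>i. B *\<^sub>v w i)"
    have BY: "B *\<^sub>v w i \<in> colspace ?Y" if "i < r" for i
      using colmat_in_colspace[of i r "\<lambda>i. B *\<^sub>v w i" e] Bw that by simp
    have BY': "B *\<^sub>v w r \<in> colspace ?Y"
      by (rule mult_colspace_subset[OF B colmat_carrier wr BY wr'])
    have AY: "A *\<^sub>v w i \<in> colspace ?Y" if "i < r" for i
    proof -
      have "B *\<^sub>v w (Suc i) \<in> colspace ?Y" using BY[of "Suc i"] BY' that by (cases "Suc i = r") auto
      moreover have "A *\<^sub>v w i = - (B *\<^sub>v w (Suc i))" using step(1)[of i] that r False by simp
      ultimately show ?thesis using colspace_uminus[OF colmat_carrier] by simp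
    qed
    have "a * r < b * r"
      by (rule expandingD[OF exp A C _ r(3) wr Cw Bw AY BY]) (use r in auto)
    then show False by (rule contr)
  next
    case True
    note rD = True
    let ?Y = "colmat e r (\<lambda>i. A *\<^sub>v w i)"
    show False
    proof (cases i0)
      case (Suc i)
      have AY: "A *\<^sub>v w i \<in> colspace ?Y" if "i < r" for i
        using colmat_in_colspace[of i r "\<lambda>i. A *\<^sub>v w i" e] Aw that by simp
      have "A *\<^sub>v 0\<^sub>v d = 0\<^sub>v e" using A by auto
      then have B0: "B *\<^sub>v w 0 = 0\<^sub>v e"
        using mid[of i] Suc before[of i] i0D B u[of i0] by (simp add: w_def)
      have BY: "B *\<^sub>v w i \<in> colspace ?Y" if "i < r" for i
      proof (cases i)
        case 0
        then show ?thesis using B0 colspace_zero[OF colmat_carrier] by simp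
      next
        case (Suc k)
        then show ?thesis
          using step(2)[of k] that rD colspace_uminus[OF colmat_carrier AY[of k]] by simp
      qed
      have "a * r < b * r"
        by (rule expandingD[OF exp A C _ r(3) wr Cw Aw AY BY]) (use r in auto)
      then show False by (rule contr)
    next
      case 0
      \<comment> \<open>Nothing puts \<open>B *\<^sub>v w 0\<close> into the span of the other
        images, so it is added as one more vector. As i0 = 0 and r = D + 1, this gives the D + 2
        occurring in \<open>slope\<close>.\<close>
      let ?y = "\<lambda>i. if i < r then A *\<^sub>v w i else B *\<^sub>v w 0"
      let ?Y = "colmat e (Suc r) ?y"
      have y: "?y i \<in> carrier_vec e" if "i < Suc r" for i using that Aw Bw[of 0] r(1) by auto
      have AY: "A *\<^sub>v w i \<in> colspace ?Y" if "i < r" for i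
        using colmat_in_colspace[of i "Suc r" ?y e] y[of i] that by simp
      have B0: "B *\<^sub>v w 0 \<in> colspace ?Y"
        using colmat_in_colspace[of r "Suc r" ?y e] y[of r] by simp
      have BY: "B *\<^sub>v w i \<in> colspace ?Y" if "i < r" for i
      proof (cases i)
        case 0
        then show ?thesis using B0 by simp
      next
        case (Suc k)
        then show ?thesis
          using step(2)[of k] that rD colspace_uminus[OF colmat_carrier AY[of k]] by simp
      qed
      have "a * r < b * Suc r"
        by (rule expandingD[OF exp A C _ r(3) wr Cw y AY BY]) (use r in auto)
      then show False using slope rD 0 by simp
    qed
  qed
qed

section \<open>Kronecker products\<close>

definition kron :: "'a :: field mat \<Rightarrow> 'a mat \<Rightarrow> 'a mat" where
  "kron X K = mat (dim_row X * dim_row K) (dim_col X * dim_col K)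
     (\<lambda>(i, j). X $$ (i div dim_row K, j div dim_col K) * K $$ (i mod dim_row K, j mod dim_col K))"

lemma kron_carrier [simp]:
  "X \<in> carrier_mat B A \<Longrightarrow> K \<in> carrier_mat e d \<Longrightarrow> kron X K \<in> carrier_mat (B * e) (A * d)"
  by (auto simp: kron_def)

lemma div_mod_less:
  fixes i :: nat
  assumes "i < B * e"
  shows "i div e < B" "i mod e < e"
  using assms by (simp add: less_mult_imp_div_less) (metis assms mod_less_divisor mult_0_right not_gr_zero not_less_zero)

lemma kron_index:
  "X \<in> carrier_mat B A \<Longrightarrow> K \<in> carrier_mat e d \<Longrightarrow> i < B * e \<Longrightarrow> j < A * d \<Longrightarrow>
    kron X K $$ (i, j) = X $$ (i div e, j div d) * K $$ (i mod e, j mod d)"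
  by (auto simp: kron_def)

lemma kron_transpose:
  assumes "X \<in> carrier_mat B A" "K \<in> carrier_mat e d"
  shows "(kron X K)\<^sup>T = kron X\<^sup>T K\<^sup>T"
  using assms by (intro eq_matI) (auto simp: kron_def div_mod_less)

lemma sum_div_mod:
  fixes f :: "nat \<Rightarrow> nat \<Rightarrow> 'a :: comm_monoid_add"
  shows "(\<Sum>t<A * d. f (t div d) (t mod d)) = (\<Sum>p<A. \<Sum>q<d. f p q)"
proof -
  have "(\<Sum>t = p * d..<p * d + d. f (t div d) (t mod d)) = (\<Sum>q<d. f p q)" for p
  proof -
    have "(\<Sum>t = 0 + p * d..<d + p * d. f (t div d) (t mod d)) =
        (\<Sum>q = 0..<d. f ((q + p * d) div d) ((q + p * d) mod d))"
      by (rule sum.shift_bounds_nat_ivl)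
    also have "\<dots> = (\<Sum>q = 0..<d. f p q)" by (rule sum.cong) auto
    finally show ?thesis by (simp add: add.commute atLeast0LessThan)
  qed
  then show ?thesis by (simp flip: sum.nat_group)
qed

lemma kron_mult:
  assumes X: "X \<in> carrier_mat B A" and K: "K \<in> carrier_mat e d"
    and Y: "Y \<in> carrier_mat A C" and L: "L \<in> carrier_mat d f"
  shows "kron X K * kron Y L = kron (X * Y) (K * L)"
proof (rule eq_matI)
  fix i j assume "i < dim_row (kron (X * Y) (K * L))" "j < dim_col (kron (X * Y) (K * L))"
  then have i: "i < B * e" and j: "j < C * f" using assms by (auto simp: kron_def)
  note dm = div_mod_less[OF i] div_mod_less[OF j]
  have "(kron X K * kron Y L) $$ (i, j) =
      (\<Sum>t<A * d. kron X K $$ (i, t) * kron Y L $$ (t, j))"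
    using kron_carrier[OF X K] kron_carrier[OF Y L] i j
    by (simp add: scalar_prod_def atLeast0LessThan)
  also have "\<dots> = (\<Sum>t<A * d. (X $$ (i div e, t div d) * K $$ (i mod e, t mod d)) *
      (Y $$ (t div d, j div f) * L $$ (t mod d, j mod f)))"
    by (rule sum.cong) (use i j in \<open>auto simp: kron_index[OF X K] kron_index[OF Y L]\<close>)
  also have "\<dots> = (\<Sum>p<A. \<Sum>q<d. (X $$ (i div e, p) * K $$ (i mod e, q)) *
      (Y $$ (p, j div f) * L $$ (q, j mod f)))"
    by (rule sum_div_mod[where f = "\<lambda>p q. (X $$ (i div e, p) * K $$ (i mod e, q)) *
      (Y $$ (p, j div f) * L $$ (q, j mod f))"])
  also have "\<dots> = (\<Sum>p<A. X $$ (i div e, p) * Y $$ (p, j div f)) *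
      (\<Sum>q<d. K $$ (i mod e, q) * L $$ (q, j mod f))"
    unfolding sum_product by (intro sum.cong refl) (simp add: mult_ac)
  also have "\<dots> = (X * Y) $$ (i div e, j div f) * (K * L) $$ (i mod e, j mod f)"
    using assms dm by (simp add: scalar_prod_def atLeast0LessThan)
  also have "\<dots> = kron (X * Y) (K * L) $$ (i, j)"
    using kron_index[of "X * Y" B C "K * L" e f i j] assms i j by simp
  finally show "(kron X K * kron Y L) $$ (i, j) = kron (X * Y) (K * L) $$ (i, j)" .
qed (use assms in \<open>auto simp: kron_def\<close>)

text \<open>The matrix is block diagonal with \<open>B\<close> copies of \<open>g\<close>; the
  induction splits off the first block.\<close>

lemma det_kron_one:
  assumes g: "(g :: 'a :: field mat) \<in> carrier_mat e e"
  shows "Determinant.det (kron (1\<^sub>m B) g) = Determinant.det g ^ B"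
proof (induction B)
  case 0
  have "kron (1\<^sub>m 0) g \<in> carrier_mat 0 0" using kron_carrier[OF one_carrier_mat[of 0] g] by simp
  then show ?case by (simp add: det_def)
next
  case (Suc B)
  have "kron (1\<^sub>m (Suc B)) g =
      four_block_mat g (0\<^sub>m e (B * e)) (0\<^sub>m (B * e) e) (kron (1\<^sub>m B) g)" (is "_ = ?R")
  proof (rule eq_matI)
    have c: "kron (1\<^sub>m B) g \<in> carrier_mat (B * e) (B * e)" using g by simp
    have R: "?R \<in> carrier_mat (Suc B * e) (Suc B * e)" using four_block_carrier_mat[OF g c] by simp
    show "dim_row (kron (1\<^sub>m (Suc B)) g) = dim_row ?R" "dim_col (kron (1\<^sub>m (Suc B)) g) = dim_col ?R"
      using R g by (auto simp: kron_def)
    fix i j assume "i < dim_row ?R" "j < dim_col ?R"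
    then have i: "i < Suc B * e" and j: "j < Suc B * e" using R by auto
    note dm = div_mod_less[OF i] div_mod_less[OF j]
    have e: "0 < e" using i by (cases e) auto
    have k: "kron (1\<^sub>m (Suc B)) g $$ (i, j) =
        (if i div e = j div e then g $$ (i mod e, j mod e) else 0)"
      using kron_index[OF one_carrier_mat g i j] dm by simp
    have shift: "x div e = Suc ((x - e) div e)" "x mod e = (x - e) mod e" if "\<not> x < e" for x
      using that e by (auto simp: le_div_geq le_mod_geq)
    have zero: "x div e = 0" "x mod e = x" if "x < e" for x using that by auto
    have ij: "i - e < B * e \<or> i < e" "j - e < B * e \<or> j < e" using i j by auto
    have "?R $$ (i, j) = (if i < e then if j < e then g $$ (i, j) else 0
        else if j < e then 0 else kron (1\<^sub>m B) g $$ (i - e, j - e))"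
      using carrier_matD[OF g] carrier_matD[OF c] i j ij by (subst index_mat_four_block(1)) auto
    also have "\<dots> = (if i div e = j div e then g $$ (i mod e, j mod e) else 0)"
    proof (cases "i < e \<or> j < e")
      case True
      then show ?thesis using shift(1)[of i] shift(1)[of j] zero[of i] zero[of j] by auto
    next
      case False
      then have ij': "i - e < B * e" "j - e < B * e" using ij by auto
      show ?thesis
        using False kron_index[OF one_carrier_mat g ij'] div_mod_less[OF ij'(1)]
          div_mod_less[OF ij'(2)] shift[of i] shift[of j] by simp
    qed
    finally show "kron (1\<^sub>m (Suc B)) g $$ (i, j) = ?R $$ (i, j)" using k by simp
  qed
  moreover have "Determinant.det ?R = Determinant.det g * Determinant.det (kron (1\<^sub>m B) g)"
    by (rule det_four_block_mat_lower_left_zero[OF g]) (use g in auto)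
  ultimately show ?case using Suc by simp
qed

text \<open>Blocks of a vector in the tensor product of two coordinate spaces. For the pencils below
  they are the coefficients of a polynomial vector.\<close>

definition slice :: "nat \<Rightarrow> 'a vec \<Rightarrow> nat \<Rightarrow> 'a vec" where
  "slice d v j = vec d (\<lambda>l. v $ (j * d + l))"

lemma slice_carrier [simp]: "slice d v j \<in> carrier_vec d"
  by (simp add: slice_def)

lemma slices_zero:
  assumes "v \<in> carrier_vec (A * d)" "\<And>j. j < A \<Longrightarrow> slice d v j = 0\<^sub>v d"
  shows "v = 0\<^sub>v (A * d)"
proof (rule eq_vecI)
  fix i assume "i < dim_vec (0\<^sub>v (A * d) :: 'a vec)"
  then have i: "i < A * d" by simp
  have "v $ i = slice d v (i div d) $ (i mod d)" using div_mod_less[OF i] by (simp add: slice_def)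
  also have "\<dots> = 0" using assms(2)[of "i div d"] div_mod_less[OF i] by simp
  finally show "v $ i = 0\<^sub>v (A * d) $ i" using i by simp
qed (use assms in simp)

lemma less_mult_add: "i < B \<Longrightarrow> l < e \<Longrightarrow> i * e + l < B * (e :: nat)"
  by (metis add.commute add_less_cancel_left less_le_trans mult_Suc mult_le_mono1 Suc_leI)

lemma slice_kron_mult_vec:
  assumes X: "X \<in> carrier_mat B A" and K: "(K :: 'a :: field mat) \<in> carrier_mat e d"
    and v: "v \<in> carrier_vec (A * d)" and i: "i < B"
  shows "slice e (kron X K *\<^sub>v v) i = K *\<^sub>v vec d (\<lambda>l. \<Sum>j<A. X $$ (i, j) * v $ (j * d + l))"
proof (rule eq_vecI)
  fix l assume "l < dim_vec (K *\<^sub>v vec d (\<lambda>l. \<Sum>j<A. X $$ (i, j) * v $ (j * d + l)))"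
  then have l: "l < e" using K by simp
  have il: "i * e + l < B * e" using i l by (rule less_mult_add)
  have "slice e (kron X K *\<^sub>v v) i $ l = (\<Sum>t<A * d. kron X K $$ (i * e + l, t) * v $ t)"
    using l il v kron_carrier[OF X K] by (simp add: slice_def scalar_prod_def atLeast0LessThan)
  also have "\<dots> = (\<Sum>t<A * d. (\<lambda>j q. X $$ (i, j) * K $$ (l, q) * v $ (j * d + q)) (t div d) (t mod d))"
    by (rule sum.cong) (use l il in \<open>auto simp: kron_index[OF X K]\<close>)
  also have "\<dots> = (\<Sum>j<A. \<Sum>q<d. X $$ (i, j) * K $$ (l, q) * v $ (j * d + q))"
    by (rule sum_div_mod)
  also have "\<dots> = (\<Sum>q<d. \<Sum>j<A. X $$ (i, j) * K $$ (l, q) * v $ (j * d + q))"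
    by (rule sum.swap)
  also have "\<dots> = (\<Sum>q<d. K $$ (l, q) * (\<Sum>j<A. X $$ (i, j) * v $ (j * d + q)))"
    by (simp add: sum_distrib_left mult_ac)
  also have "\<dots> = (K *\<^sub>v vec d (\<lambda>l. \<Sum>j<A. X $$ (i, j) * v $ (j * d + l))) $ l"
    using l K by (simp add: scalar_prod_def atLeast0LessThan)
  finally show "slice e (kron X K *\<^sub>v v) i $ l =
      (K *\<^sub>v vec d (\<lambda>l. \<Sum>j<A. X $$ (i, j) * v $ (j * d + l))) $ l" .
qed (use K in \<open>simp add: slice_def\<close>)

section \<open>Determinants of juxtaposed matrices\<close>

definition hcat :: "'a :: field mat \<Rightarrow> 'a mat \<Rightarrow> 'a mat" where
  "hcat T V = mat (dim_row T) (dim_col T + dim_col V)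
     (\<lambda>(i, j). if j < dim_col T then T $$ (i, j) else V $$ (i, j - dim_col T))"

lemma hcat_carrier [simp]:
  "T \<in> carrier_mat s q \<Longrightarrow> V \<in> carrier_mat s c \<Longrightarrow> hcat T V \<in> carrier_mat s (q + c)"
  by (auto simp: hcat_def)

lemma mult_hcat:
  assumes "G \<in> carrier_mat t s" "T \<in> carrier_mat s q" "V \<in> carrier_mat s c"
  shows "G * hcat T V = hcat (G * T) (G * V)"
proof (rule eq_matI)
  fix i j assume "i < dim_row (hcat (G * T) (G * V))" "j < dim_col (hcat (G * T) (G * V))"
  then have ij: "i < t" "j < q + c" using assms by (auto simp: hcat_def)
  have "col (hcat T V) j = (if j < q then col T j else col V (j - q))"
    using ij assms by (intro eq_vecI) (auto simp: hcat_def)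
  then show "(G * hcat T V) $$ (i, j) = hcat (G * T) (G * V) $$ (i, j)"
    using ij assms by (auto simp: hcat_def)
qed (use assms in \<open>auto simp: hcat_def\<close>)

lemma hcat_mult_diag:
  assumes "T \<in> carrier_mat s q" "V \<in> carrier_mat s c" "D \<in> carrier_mat q q"
  shows "hcat T V * four_block_mat D (0\<^sub>m q c) (0\<^sub>m c q) (1\<^sub>m c) = hcat (T * D) V"
proof -
  \<comment> \<open>With lower blocks that have no rows, juxtaposition becomes a four-block matrix,
    so the block product formula applies.\<close>
  have h: "hcat T' V = four_block_mat T' V (0\<^sub>m 0 q) (0\<^sub>m 0 c)" if "T' \<in> carrier_mat s q" for T'
    using that assms(2) by (intro eq_matI) (auto simp: hcat_def)
  have z: "(0\<^sub>m 0 k :: 'a mat) * X = 0\<^sub>m 0 l" if "X \<in> carrier_mat k l" for k l and X :: "'a mat"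
    using that by (intro eq_matI) auto
  show ?thesis
    unfolding h[OF assms(1)] h[OF mult_carrier_mat[OF assms(1,3)]]
    by (subst mult_four_block_mat[OF assms(1,2) zero_carrier_mat zero_carrier_mat assms(3)
          zero_carrier_mat zero_carrier_mat one_carrier_mat])
      (use assms in \<open>simp add: z\<close>)
qed

text \<open>This produces the weights: \<open>G\<close> will come from g1 and \<open>D\<close> from
  the inverse of g0. Only \<open>T\<close> gets a right factor, since the group acts on
  \<open>M\<close> from the left alone.\<close>

lemma det_hcat_transform:
  assumes G: "G \<in> carrier_mat (q + c) (q + c)" and T: "T \<in> carrier_mat (q + c) q"
    and V: "V \<in> carrier_mat (q + c) c" and D: "(D :: 'a :: field mat) \<in> carrier_mat q q"
  shows "Determinant.det (hcat (G * T * D) (G * V)) =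
    Determinant.det G * Determinant.det (hcat T V) * Determinant.det D"
proof -
  let ?D = "four_block_mat D (0\<^sub>m q c) (0\<^sub>m c q) (1\<^sub>m c)"
  have dD: "Determinant.det ?D = Determinant.det D"
    by (subst det_four_block_mat_lower_left_zero[OF D zero_carrier_mat refl one_carrier_mat]) simp
  have "hcat (G * T * D) (G * V) = hcat (G * T) (G * V) * ?D"
    by (rule hcat_mult_diag[symmetric]) (use assms in auto)
  also have "hcat (G * T) (G * V) = G * hcat T V" by (rule mult_hcat[symmetric]) (use assms in auto)
  finally have "hcat (G * T * D) (G * V) = G * hcat T V * ?D" .
  moreover have "hcat T V \<in> carrier_mat (q + c) (q + c)" using T V by simp
  moreover have "?D \<in> carrier_mat (q + c) (q + c)" using D by simp
  ultimately show ?thesis using G dD by (simp add: det_mult[of _ "q + c"])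
qed

text \<open>By \<open>sep\<close> the columns of \<open>T\<close> and \<open>W\<close> together
  span, so the independent columns of \<open>T\<close> can be completed to a basis by
  \<open>c\<close> = s - q combinations of columns of \<open>W\<close>, recorded in
  \<open>Z\<close>.\<close>

lemma exists_hcat_det_nonzero:
  assumes T: "(T :: 'a :: field mat) \<in> carrier_mat s q" and W: "W \<in> carrier_mat s t"
    and inj: "inj_mat T"
    and sep: "\<And>w. w \<in> carrier_vec s \<Longrightarrow> T\<^sup>T *\<^sub>v w = 0\<^sub>v q \<Longrightarrow> W\<^sup>T *\<^sub>v w = 0\<^sub>v t \<Longrightarrow> w = 0\<^sub>v s"
  obtains c Z where "q + c = s" "Z \<in> carrier_mat t c" "Determinant.det (hcat T (W * Z)) \<noteq> 0"
proof -
  have qs: "q \<le> s" using inj_mat_le[OF T inj] .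
  have "inj_mat (colmat s q (col T))" using inj colmat_cols[OF T] by simp
  moreover have "w = 0\<^sub>v s" if "w \<in> carrier_vec s" "\<And>j. j < q \<Longrightarrow> col T j \<bullet> w = 0" "W\<^sup>T *\<^sub>v w = 0\<^sub>v t" for w
    by (rule sep[OF that(1) _ that(3)]) (use T that(2) in \<open>auto intro!: eq_vecI\<close>)
  ultimately have "\<exists>z. (\<forall>j. z j \<in> carrier_vec t) \<and>
      inj_mat (colmat s s (\<lambda>j. if j < q then col T j else W *\<^sub>v z j))"
    by (intro extend_inj_colmat[OF _ _ W]) (use T in auto)
  then obtain z where z: "\<And>j. z j \<in> carrier_vec t"
    "inj_mat (colmat s s (\<lambda>j. if j < q then col T j else W *\<^sub>v z j))" (is "inj_mat ?P") by auto
  define Z where "Z = colmat t (s - q) (\<lambda>j. z (q + j))"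
  have WZ: "W * Z = colmat s (s - q) (\<lambda>j. W *\<^sub>v z (q + j))"
    unfolding Z_def by (rule mult_colmat[OF W]) (rule z)
  have "?P = hcat T (W * Z)"
    unfolding WZ using T W z qs
    by (intro eq_matI) (auto simp: hcat_def colmat_def)
  then have "Determinant.det (hcat T (W * Z)) \<noteq> 0"
    using z(2) unfolding inj_mat_iff_det[OF colmat_carrier] by simp
  then show ?thesis using that[of "s - q" Z] qs by (simp add: Z_def)
qed

section \<open>Polynomial functions and the group action\<close>

lemma polyfuns_sum:
  "(\<And>i. i \<in> I \<Longrightarrow> f i \<in> polyfuns C) \<Longrightarrow> (\<lambda>x. \<Sum>i\<in>I. f i x) \<in> polyfuns C"
  by (induction I rule: infinite_finite_induct) (auto intro: polyfuns.intros)

lemma polyfuns_prod: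
  "(\<And>i. i \<in> I \<Longrightarrow> f i \<in> polyfuns C) \<Longrightarrow> (\<lambda>x. \<Prod>i\<in>I. f i x) \<in> polyfuns C"
  by (induction I rule: infinite_finite_induct) (auto intro: polyfuns.intros)

lemma polyfuns_uminus: "f \<in> polyfuns C \<Longrightarrow> (\<lambda>x. - f x) \<in> polyfuns C"
  using polyfuns.mult[OF polyfuns.const[of "- 1"]] by force

lemma polyfuns_diff: "f \<in> polyfuns C \<Longrightarrow> g \<in> polyfuns C \<Longrightarrow> (\<lambda>x. f x - g x) \<in> polyfuns C"
  using polyfuns.add[OF _ polyfuns_uminus] by fastforce

definition poly_mat :: "('x \<Rightarrow> 'k :: field) set \<Rightarrow> nat \<Rightarrow> nat \<Rightarrow> ('x \<Rightarrow> 'k mat) \<Rightarrow> bool" where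
  "poly_mat C r c F \<longleftrightarrow>
     (\<forall>x. F x \<in> carrier_mat r c) \<and> (\<forall>i<r. \<forall>j<c. (\<lambda>x. F x $$ (i, j)) \<in> polyfuns C)"

lemma poly_matI:
  "(\<And>x. F x \<in> carrier_mat r c) \<Longrightarrow>
    (\<And>i j. i < r \<Longrightarrow> j < c \<Longrightarrow> (\<lambda>x. F x $$ (i, j)) \<in> polyfuns C) \<Longrightarrow> poly_mat C r c F"
  by (simp add: poly_mat_def)

lemma poly_mat_carrier: "poly_mat C r c F \<Longrightarrow> F x \<in> carrier_mat r c"
  by (simp add: poly_mat_def)

lemma poly_mat_entry: "poly_mat C r c F \<Longrightarrow> i < r \<Longrightarrow> j < c \<Longrightarrow> (\<lambda>x. F x $$ (i, j)) \<in> polyfuns C"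
  by (simp add: poly_mat_def)

lemma poly_mat_const: "A \<in> carrier_mat r c \<Longrightarrow> poly_mat C r c (\<lambda>_. A)"
  by (simp add: poly_mat_def polyfuns.const)

lemma poly_mat_add:
  assumes F: "poly_mat C r c F" and G: "poly_mat C r c G"
  shows "poly_mat C r c (\<lambda>x. F x + G x)"
proof (rule poly_matI)
  fix i j assume ij: "i < r" "j < c"
  then have "(F x + G x) $$ (i, j) = F x $$ (i, j) + G x $$ (i, j)" for x
    using poly_mat_carrier[OF G, of x] by auto
  then show "(\<lambda>x. (F x + G x) $$ (i, j)) \<in> polyfuns C"
    using ij by (simp add: polyfuns.add poly_mat_entry[OF F] poly_mat_entry[OF G])
qed (use poly_mat_carrier[OF F] poly_mat_carrier[OF G] in simp)

lemma poly_mat_mult: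
  assumes F: "poly_mat C r s F" and G: "poly_mat C s c G"
  shows "poly_mat C r c (\<lambda>x. F x * G x)"
proof (rule poly_matI)
  fix i j assume ij: "i < r" "j < c"
  then have "(F x * G x) $$ (i, j) = (\<Sum>k<s. F x $$ (i, k) * G x $$ (k, j))" for x
    using poly_mat_carrier[OF F, of x] poly_mat_carrier[OF G, of x]
    by (simp add: scalar_prod_def atLeast0LessThan)
  then show "(\<lambda>x. (F x * G x) $$ (i, j)) \<in> polyfuns C"
    using ij by (simp only:) (intro polyfuns_sum polyfuns.mult poly_mat_entry[OF F] poly_mat_entry[OF G]; simp)
qed (rule mult_carrier_mat[OF poly_mat_carrier[OF F] poly_mat_carrier[OF G]])

lemma poly_mat_kron:
  assumes X: "X \<in> carrier_mat B A" and F: "poly_mat C e d F"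
  shows "poly_mat C (B * e) (A * d) (\<lambda>x. kron X (F x))"
proof (rule poly_matI)
  fix i j assume ij: "i < B * e" "j < A * d"
  have "kron X (F x) $$ (i, j) = X $$ (i div e, j div d) * F x $$ (i mod e, j mod d)" for x
    by (rule kron_index[OF X poly_mat_carrier[OF F] ij])
  then show "(\<lambda>x. kron X (F x) $$ (i, j)) \<in> polyfuns C"
    using div_mod_less[OF ij(1)] div_mod_less[OF ij(2)]
    by (simp add: polyfuns.mult polyfuns.const poly_mat_entry[OF F])
qed (use X poly_mat_carrier[OF F] in simp)

lemma poly_mat_hcat:
  assumes F: "poly_mat C s q F" and G: "poly_mat C s c G"
  shows "poly_mat C s (q + c) (\<lambda>x. hcat (F x) (G x))"
proof (rule poly_matI)
  fix i j assume ij: "i < s" "j < q + c"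
  then have "hcat (F x) (G x) $$ (i, j) = (if j < q then F x $$ (i, j) else G x $$ (i, j - q))" for x
    using poly_mat_carrier[OF F, of x] poly_mat_carrier[OF G, of x] by (auto simp: hcat_def)
  then show "(\<lambda>x. hcat (F x) (G x) $$ (i, j)) \<in> polyfuns C"
    using ij poly_mat_entry[OF F] poly_mat_entry[OF G] by (cases "j < q") auto
qed (use poly_mat_carrier[OF F] poly_mat_carrier[OF G] in simp)

lemma polyfuns_det:
  assumes F: "poly_mat C r r F"
  shows "(\<lambda>x. Determinant.det (F x)) \<in> polyfuns C"
proof -
  have "(\<lambda>x. Determinant.det (F x)) =
      (\<lambda>x. \<Sum>p\<in>{p. p permutes {0..<r}}. signof p * (\<Prod>i=0..<r. F x $$ (i, p i)))"
    using det_def'[OF poly_mat_carrier[OF F]] by simp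
  moreover have "p i < r" if "p permutes {0..<r}" "i < r" for p i
    using permutes_in_image[OF that(1), of i] that(2) by simp
  ultimately show ?thesis
    by (simp only:) (intro polyfuns_sum polyfuns_prod polyfuns.mult polyfuns.const poly_mat_entry[OF F]; simp)
qed

text \<open>Polynomial functions are defined on triples of matrices of arbitrary sizes, while
  \<open>poly_mat\<close> demands a fixed size everywhere. Cropping enforces it, keeps the entries
  equal to the coordinate functions, and changes nothing on the points of interest.\<close>

definition crop :: "nat \<Rightarrow> nat \<Rightarrow> 'a mat \<Rightarrow> 'a mat" where
  "crop r c K = mat r c (\<lambda>ij. K $$ ij)"

lemma crop_carrier [simp]: "crop r c K \<in> carrier_mat r c"
  by (simp add: crop_def)

lemma crop_id [simp]: "K \<in> carrier_mat r c \<Longrightarrow> crop r c K = K"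
  by (intro eq_matI) (auto simp: crop_def)

lemma poly_mat_lomadze:
  "poly_mat (lomadze_coords n m p) (n + p) n (\<lambda>x. crop (n + p) n (fst x))"
  "poly_mat (lomadze_coords n m p) (n + p) n (\<lambda>x. crop (n + p) n (fst (snd x)))"
  "poly_mat (lomadze_coords n m p) (n + p) (p + m) (\<lambda>x. crop (n + p) (p + m) (snd (snd x)))"
  unfolding poly_mat_def crop_def lomadze_coords_def
  by (auto intro!: polyfuns.coord simp: case_prod_unfold)

section \<open>The general linear groups and their action\<close>

lemma carrier_gl: "g \<in> carrier (gl n) \<longleftrightarrow> g \<in> carrier_mat n n \<and> Determinant.det g \<noteq> 0"
proof -
  have "g \<in> Units (ring_mat TYPE('a) n ()) \<longleftrightarrow> g \<in> carrier_mat n n \<and> Determinant.det g \<noteq> 0"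
    using unit_imp_det_non_zero[of g n "()"] det_non_zero_imp_unit[of g n "()"]
    by (auto simp: Units_def ring_mat_simps)
  then show ?thesis by (simp add: gl_def units_of_carrier)
qed

lemma inv_gl:
  assumes "g \<in> carrier (gl n)"
  shows "inv\<^bsub>gl n\<^esub> g \<in> carrier_mat n n" "g * inv\<^bsub>gl n\<^esub> g = 1\<^sub>m n" "inv\<^bsub>gl n\<^esub> g * g = 1\<^sub>m n"
proof -
  interpret ring "ring_mat TYPE('a) n ()" by (rule ring_mat)
  have g: "g \<in> Units (ring_mat TYPE('a) n ())" using assms by (simp add: gl_def units_of_carrier)
  have eq: "inv\<^bsub>gl n\<^esub> g = inv\<^bsub>ring_mat TYPE('a) n ()\<^esub> g"
    unfolding gl_def by (rule units_of_inv[OF g])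
  show "inv\<^bsub>gl n\<^esub> g \<in> carrier_mat n n" "g * inv\<^bsub>gl n\<^esub> g = 1\<^sub>m n" "inv\<^bsub>gl n\<^esub> g * g = 1\<^sub>m n"
    unfolding eq using Units_inv_closed[OF g] Units_r_inv[OF g] Units_l_inv[OF g]
    by (simp_all add: ring_mat_simps)
qed

lemma gl_monoid [simp]:
  "x \<otimes>\<^bsub>gl n\<^esub> y = x * y" "\<one>\<^bsub>gl n\<^esub> = 1\<^sub>m n"
  by (simp_all add: gl_def units_of_mult units_of_one ring_mat_simps)

lemma group_gl: "Group.group (gl n :: 'k :: field mat monoid)"
proof -
  interpret ring "ring_mat TYPE('k) n ()" by (rule ring_mat)
  show ?thesis unfolding gl_def by (rule units_group)
qed

lemma det_inv_gl:
  assumes "g \<in> carrier (gl n)"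
  shows "Determinant.det (inv\<^bsub>gl n\<^esub> g) = inverse (Determinant.det g)"
proof -
  have "Determinant.det g * Determinant.det (inv\<^bsub>gl n\<^esub> g) = 1"
    using det_mult[of g n "inv\<^bsub>gl n\<^esub> g"] inv_gl[OF assms] assms by (simp add: carrier_gl)
  then show ?thesis by (metis inverse_unique)
qed

lemma carrier_lomadze_group:
  "(g0, g1) \<in> carrier (lomadze_group n p) \<longleftrightarrow> g0 \<in> carrier (gl n) \<and> g1 \<in> carrier (gl (n + p))"
  by (simp add: lomadze_group_def)

lemma lomadze_space_iff:
  "(K, L, M) \<in> lomadze_space n m p \<longleftrightarrow>
    K \<in> carrier_mat (n + p) n \<and> L \<in> carrier_mat (n + p) n \<and> M \<in> carrier_mat (n + p) (p + m)"
  by (simp add: lomadze_space_def)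

lemma act_closed:
  "g \<in> carrier (lomadze_group n p) \<Longrightarrow> x \<in> lomadze_space n m p \<Longrightarrow> act n g x \<in> lomadze_space n m p"
proof -
  assume g: "g \<in> carrier (lomadze_group n p)" and x: "x \<in> lomadze_space n m p"
  obtain g0 g1 where gd: "g = (g0, g1)" by (cases g)
  obtain K L M where xd: "x = (K, L, M)" by (cases x)
  have g1: "g1 \<in> carrier_mat (n + p) (n + p)" and h: "inv\<^bsub>gl n\<^esub> g0 \<in> carrier_mat n n"
    using g by (auto simp: gd carrier_lomadze_group carrier_gl intro!: inv_gl(1))
  show ?thesis
    using x g1 mult_carrier_mat[OF mult_carrier_mat[OF g1] h]
    by (auto simp: gd xd lomadze_space_iff intro: mult_carrier_mat[OF g1])
qed

section \<open>Semi-invariants and their weights\<close>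

lemma semi_invariant_mult:
  assumes f: "f \<in> semi_invariants n m p c0 c1 1" and h: "h \<in> semi_invariants n m p d0 d1 1"
  shows "(\<lambda>x. f x * h x) \<in> semi_invariants n m p (c0 + d0) (c1 + d1) 1"
proof -
  have "character (c0 + d0) (c1 + d1) g = character c0 c1 g * character d0 d1 g"
    if "g \<in> carrier (lomadze_group n p)" for g :: "'a mat \<times> 'a mat"
    using that by (cases g) (auto simp: carrier_lomadze_group carrier_gl power_int_add)
  then show ?thesis
    using f h unfolding semi_invariants_def by (auto intro: polyfuns.mult simp: mult_ac)
qed

lemma semi_invariant_power:
  assumes f: "f \<in> semi_invariants n m p c0 c1 1"
  shows "(\<lambda>x. f x ^ k) \<in> semi_invariants n m p (int k * c0) (int k * c1) 1"
proof (induction k)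
  case 0
  have "character 0 0 g = 1" for g :: "'a mat \<times> 'a mat" by (cases g) simp
  then show ?case by (simp add: semi_invariants_def polyfuns.const)
next
  case (Suc k)
  have "int (Suc k) * c0 = c0 + int k * c0" "int (Suc k) * c1 = c1 + int k * c1"
    by (simp_all add: algebra_simps)
  then show ?case using semi_invariant_mult[OF f Suc] by simp
qed

text \<open>The group multiplies the matrix by 1 \<otimes> g1 on the left, and its first
  \<open>A * n\<close> columns by 1 \<otimes> \<open>h\<close> on the right, with \<open>h\<close>
  inverse to g0. The determinants of these factors are the \<open>B\<close>-th power of det g1 and
  the inverse of the \<open>A\<close>-th power of det g0.\<close>

lemma kron_semi_invariant:
  fixes K L M :: "'k :: field mat"
  assumes S: "(K, L, M) \<in> lomadze_space n m p"
    and X: "X \<in> carrier_mat B A" and Y: "Y \<in> carrier_mat B A"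
    and inj: "inj_mat (kron X K + kron Y L)"
    and sep: "\<And>w. w \<in> carrier_vec (B * (n + p)) \<Longrightarrow> (kron X K + kron Y L)\<^sup>T *\<^sub>v w = 0\<^sub>v (A * n) \<Longrightarrow>
      (kron (1\<^sub>m B) M)\<^sup>T *\<^sub>v w = 0\<^sub>v (B * (p + m)) \<Longrightarrow> w = 0\<^sub>v (B * (n + p))"
  shows "\<exists>f \<in> semi_invariants n m p (- int A) (int B) 1. f (K, L, M) \<noteq> 0"
proof -
  have K: "K \<in> carrier_mat (n + p) n" and L: "L \<in> carrier_mat (n + p) n"
    and M: "M \<in> carrier_mat (n + p) (p + m)" using S by (auto simp: lomadze_space_iff)
  have T: "kron X K + kron Y L \<in> carrier_mat (B * (n + p)) (A * n)" using X Y K L by simp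
  have W: "kron (1\<^sub>m B) M \<in> carrier_mat (B * (n + p)) (B * (p + m))" using M by simp
  obtain c Z where c: "A * n + c = B * (n + p)" and Z: "Z \<in> carrier_mat (B * (p + m)) c"
    and nz: "Determinant.det (hcat (kron X K + kron Y L) (kron (1\<^sub>m B) M * Z)) \<noteq> 0"
    using exists_hcat_det_nonzero[OF T W inj sep] .
  \<comment> \<open>\<open>Z\<close> was chosen for the given system and stays fixed; only the three
    matrices vary with the point.\<close>
  define F where "F x = hcat (kron X (crop (n + p) n (fst x)) + kron Y (crop (n + p) n (fst (snd x))))
    (kron (1\<^sub>m B) (crop (n + p) (p + m) (snd (snd x))) * Z)" for x :: "'k lomadze"
  have poly: "poly_mat (lomadze_coords n m p) (A * n + c) (A * n + c) F"
    unfolding F_def c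
    unfolding c[symmetric]
    by (intro poly_mat_hcat poly_mat_add poly_mat_mult[OF _ poly_mat_const[OF Z]]; unfold c;
        intro poly_mat_kron X Y one_carrier_mat poly_mat_lomadze)
  have eqv: "Determinant.det (F (act n g x)) = character (- int A) (int B) g ^ 1 * Determinant.det (F x)"
    if g: "g \<in> carrier (lomadze_group n p)" and x: "x \<in> lomadze_space n m p" for g x
  proof -
    obtain g0 g1 where g_def: "g = (g0, g1)" by (cases g)
    obtain K L M where x_def: "x = (K, L, M)" by (cases x)
    have g0: "g0 \<in> carrier (gl n)" and g1: "g1 \<in> carrier_mat (n + p) (n + p)"
      using g by (auto simp: g_def carrier_lomadze_group carrier_gl)
    define h where "h = inv\<^bsub>gl n\<^esub> g0"
    have h: "h \<in> carrier_mat n n" unfolding h_def by (rule inv_gl(1)[OF g0])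
    have K: "K \<in> carrier_mat (n + p) n" and L: "L \<in> carrier_mat (n + p) n"
      and M: "M \<in> carrier_mat (n + p) (p + m)" using x by (auto simp: x_def lomadze_space_iff)
    let ?G = "kron (1\<^sub>m B) g1" and ?D = "kron (1\<^sub>m A) h"
    let ?T = "kron X K + kron Y L" and ?V = "kron (1\<^sub>m B) M * Z"
    have G: "?G \<in> carrier_mat (B * (n + p)) (B * (n + p))" using g1 by simp
    have D: "?D \<in> carrier_mat (A * n) (A * n)" using h by simp
    have T: "?T \<in> carrier_mat (B * (n + p)) (A * n)" using X Y K L by simp
    have V: "?V \<in> carrier_mat (B * (n + p)) c"
      using M Z by (intro mult_carrier_mat[OF _ Z] kron_carrier) auto
    \<comment> \<open>The mixed-product rule, with identities inserted on the left and on the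
      right.\<close>
    have k: "kron U (g1 * Q * h) = ?G * kron U Q * ?D"
      if "U \<in> carrier_mat B A" "Q \<in> carrier_mat (n + p) n" for U Q
      using that g1 h by (simp add: kron_mult[of _ B B _ "n + p" "n + p" _ A _ n] kron_mult[of _ B A _ "n + p" n _ A _ n])
    have "F (act n g x) = hcat (kron X (g1 * K * h) + kron Y (g1 * L * h)) (kron (1\<^sub>m B) (g1 * M) * Z)"
      using g1 h K L M by (simp add: F_def g_def x_def h_def)
    also have "kron X (g1 * K * h) + kron Y (g1 * L * h) = ?G * ?T * ?D"
      unfolding k[OF X K] k[OF Y L]
      using G D X Y K L by (simp add: mult_add_distrib_mat[of _ "B * (n + p)" "B * (n + p)" _ "A * n"]
          add_mult_distrib_mat[of _ "B * (n + p)" "A * n" _ _ "A * n"])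
    also have "kron (1\<^sub>m B) (g1 * M) * Z = ?G * ?V"
    proof -
      have "kron (1\<^sub>m B) (g1 * M) = ?G * kron (1\<^sub>m B) M"
        using g1 M by (simp add: kron_mult[of _ B B _ "n + p" "n + p" _ B _ "p + m"])
      then show ?thesis using assoc_mult_mat[OF G _ Z, of "kron (1\<^sub>m B) M"] M by simp
    qed
    finally have "Determinant.det (F (act n g x)) =
        Determinant.det ?G * Determinant.det (hcat ?T ?V) * Determinant.det ?D"
      using det_hcat_transform[of ?G "A * n" c ?T ?V ?D] G T V D c by simp
    moreover have "hcat ?T ?V = F x" using K L M by (simp add: F_def x_def)
    ultimately show ?thesis
      using det_kron_one[OF g1, of B] det_kron_one[OF h, of A] det_inv_gl[OF g0]
      by (simp add: g_def h_def power_int_minus power_inverse mult_ac)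
  qed
  have "(\<lambda>x. Determinant.det (F x)) \<in> semi_invariants n m p (- int A) (int B) 1"
    unfolding semi_invariants_def using polyfuns_det[OF poly] eqv by blast
  moreover have "Determinant.det (F (K, L, M)) \<noteq> 0" using nz K L M by (simp add: F_def)
  ultimately show ?thesis by (intro bexI[of _ "\<lambda>x. Determinant.det (F x)"])
qed

section \<open>Determinantal semi-invariants\<close>

text \<open>The matrix \<open>kron (tall_shift 0 D) A + kron (tall_shift 1 D) B\<close> multiplies polynomial vectors of
  degree less than \<open>D\<close> by \<open>A + s B\<close>.\<close>

definition tall_shift :: "nat \<Rightarrow> nat \<Rightarrow> 'k :: field mat" where
  "tall_shift k D = mat (Suc D) D (\<lambda>(i, j). if i = j + k then 1 else 0)"

lemma tall_shift_carrier [simp]: "tall_shift k D \<in> carrier_mat (Suc D) D"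
  by (simp add: tall_shift_def)

lemma kron_pencil_slice:
  assumes X: "X \<in> carrier_mat B A" and Y: "Y \<in> carrier_mat B A"
    and K: "K \<in> carrier_mat e d" and L: "L \<in> carrier_mat e d"
    and v: "v \<in> carrier_vec (A * d)" and 0: "(kron X K + kron Y L) *\<^sub>v v = 0\<^sub>v (B * e)"
    and i: "i < B"
  shows "K *\<^sub>v vec d (\<lambda>l. \<Sum>j<A. X $$ (i, j) * v $ (j * d + l)) +
    L *\<^sub>v vec d (\<lambda>l. \<Sum>j<A. Y $$ (i, j) * v $ (j * d + l)) = (0\<^sub>v e :: 'k :: field vec)"
proof -
  have KX: "kron X K \<in> carrier_mat (B * e) (A * d)" and LY: "kron Y L \<in> carrier_mat (B * e) (A * d)"
    using assms by simp_all
  have "slice e (kron X K *\<^sub>v v) i + slice e (kron Y L *\<^sub>v v) i =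
      slice e ((kron X K + kron Y L) *\<^sub>v v) i"
    unfolding add_mult_distrib_mat_vec[OF KX LY v]
    using KX LY v less_mult_add[OF i] by (intro eq_vecI) (auto simp: slice_def)
  also have "\<dots> = 0\<^sub>v e" unfolding 0 using less_mult_add[OF i] by (intro eq_vecI) (auto simp: slice_def)
  finally show ?thesis
    unfolding slice_kron_mult_vec[OF X K v i] slice_kron_mult_vec[OF Y L v i] .
qed

lemma kron_one_slice:
  assumes C: "(C :: 'k :: field mat) \<in> carrier_mat c d" and v: "v \<in> carrier_vec (A * d)"
    and 0: "kron (1\<^sub>m A) C *\<^sub>v v = 0\<^sub>v (A * c)" and i: "i < A"
  shows "C *\<^sub>v slice d v i = 0\<^sub>v c"
proof -
  have "vec d (\<lambda>l. \<Sum>j<A. 1\<^sub>m A $$ (i, j) * v $ (j * d + l)) = slice d v i"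
    using i by (intro eq_vecI) (auto simp: slice_def if_distrib[of "\<lambda>x. x * _"] cong: if_cong)
  then have "C *\<^sub>v slice d v i = slice c (kron (1\<^sub>m A) C *\<^sub>v v) i"
    using slice_kron_mult_vec[OF one_carrier_mat C v i] by simp
  also have "\<dots> = 0\<^sub>v c" unfolding 0 using less_mult_add[OF i] by (intro eq_vecI) (auto simp: slice_def)
  finally show ?thesis .
qed

lemma tall_kron_kernel:
  fixes A B C :: "'k :: field mat"
  assumes exp: "expanding a b A B C"
    and A: "A \<in> carrier_mat e d" and B: "B \<in> carrier_mat e d" and C: "C \<in> carrier_mat c d"
    and slope: "b * D \<le> a * D + b"
    and v: "v \<in> carrier_vec (D * d)"
    and ker: "(kron (tall_shift 0 D) A + kron (tall_shift 1 D) B) *\<^sub>v v = 0\<^sub>v (Suc D * e)"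
    and Cv: "kron (1\<^sub>m D) C *\<^sub>v v = 0\<^sub>v (D * c)"
  shows "v = 0\<^sub>v (D * d)"
proof -
  have sum0: "vec d (\<lambda>l. \<Sum>j<D. tall_shift 0 D $$ (i, j) * v $ (j * d + l)) =
      (if i < D then slice d v i else 0\<^sub>v d)" if "i \<le> D" for i
    using that by (intro eq_vecI)
      (auto simp: slice_def tall_shift_def if_distrib[of "\<lambda>x. x * _"] cong: if_cong)
  have sum1: "vec d (\<lambda>l. \<Sum>j<D. tall_shift 1 D $$ (i, j) * v $ (j * d + l)) =
      (if 0 < i then slice d v (i - 1) else 0\<^sub>v d)" if "i \<le> D" for i
    using that by (cases i; intro eq_vecI)
      (auto simp: slice_def tall_shift_def if_distrib[of "\<lambda>x. x * _"] cong: if_cong)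
  \<comment> \<open>Row 0 contains only the A-term and row \<open>D\<close> only the B-term; these
    are the two end conditions of the chain.\<close>
  have eq: "A *\<^sub>v (if i < D then slice d v i else 0\<^sub>v d) +
      B *\<^sub>v (if 0 < i then slice d v (i - 1) else 0\<^sub>v d) = 0\<^sub>v e" if "i \<le> D" for i
    using kron_pencil_slice[OF tall_shift_carrier tall_shift_carrier A B v ker, of i]
      sum0[OF that] sum1[OF that] that by simp
  have z: "A *\<^sub>v 0\<^sub>v d = 0\<^sub>v e" "B *\<^sub>v 0\<^sub>v d = 0\<^sub>v e" using A B by auto
  have car: "A *\<^sub>v slice d v i \<in> carrier_vec e" "B *\<^sub>v slice d v i \<in> carrier_vec e" for i
    using A B by auto
  have "slice d v j = 0\<^sub>v d" if "j < D" for j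
  proof (rule tall_sequence_zero[OF exp A B C, where u = "slice d v" and D = D])
    show "A *\<^sub>v slice d v 0 = 0\<^sub>v e" if "0 < D" using eq[of 0] that z car by simp
    show "A *\<^sub>v slice d v (Suc j) + B *\<^sub>v slice d v j = 0\<^sub>v e" if "Suc j < D" for j
      using eq[of "Suc j"] that by simp
    show "B *\<^sub>v slice d v (D - 1) = 0\<^sub>v e" if "0 < D" using eq[of D] that z car by simp
  qed (use kron_one_slice[OF C v Cv] slope that in auto)
  then show ?thesis by (rule slices_zero[OF v])
qed

text \<open>The transposed shifts have no boundary rows: row \<open>i\<close> couples slices
  \<open>i\<close> and \<open>Suc i\<close>, so D + 1 slices satisfy D relations with free
  ends.\<close>

lemma wide_kron_kernel:
  fixes A B C :: "'k :: field mat"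
  assumes exp: "expanding a b A B C"
    and A: "A \<in> carrier_mat e d" and B: "B \<in> carrier_mat e d" and C: "C \<in> carrier_mat c d"
    and slope: "b * (D + 2) \<le> a * (D + 1)" and b: "0 < b"
    and v: "v \<in> carrier_vec (Suc D * d)"
    and ker: "(kron (tall_shift 0 D)\<^sup>T A + kron (tall_shift 1 D)\<^sup>T B) *\<^sub>v v = 0\<^sub>v (D * e)"
    and Cv: "kron (1\<^sub>m (Suc D)) C *\<^sub>v v = 0\<^sub>v (Suc D * c)"
  shows "v = 0\<^sub>v (Suc D * d)"
proof -
  have sum: "vec d (\<lambda>l. \<Sum>j<Suc D. (tall_shift k D)\<^sup>T $$ (i, j) * v $ (j * d + l)) = slice d v (i + k)"
    if "i < D" "k \<le> 1" for i k
    using that by (intro eq_vecI)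
      (auto simp: slice_def tall_shift_def if_distrib[of "\<lambda>x. x * _"] simp del: sum.lessThan_Suc cong: if_cong)
  have tc: "(tall_shift k D)\<^sup>T \<in> carrier_mat D (Suc D)" for k by simp
  have eq: "A *\<^sub>v slice d v i + B *\<^sub>v slice d v (Suc i) = 0\<^sub>v e" if "i < D" for i
    using kron_pencil_slice[OF tc tc A B v ker that] sum[OF that, of 0] sum[OF that, of 1] by simp
  have "slice d v j = 0\<^sub>v d" if "j < Suc D" for j
  proof (rule wide_sequence_zero[OF exp A B C, where u = "slice d v" and D = D])
    show "C *\<^sub>v slice d v j = 0\<^sub>v c" if "j \<le> D" for j
      using kron_one_slice[OF C v Cv] that by simp
  qed (use eq slope b that in auto)
  then show ?thesis by (rule slices_zero[OF v])
qed

lemma kron_pencil_transpose: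
  assumes "X \<in> carrier_mat B A" "Y \<in> carrier_mat B A" "K \<in> carrier_mat e d" "L \<in> carrier_mat e d"
  shows "(kron X K + kron Y L)\<^sup>T = kron X\<^sup>T K\<^sup>T + kron Y\<^sup>T L\<^sup>T"
  using assms by (simp add: kron_transpose[symmetric] transpose_add[OF kron_carrier kron_carrier])

text \<open>A matrix without rows imposes no condition; it serves as \<open>C\<close> for a pencil
  on the whole space.\<close>

lemma kron_unconstrained:
  "v \<in> carrier_vec (D * d) \<Longrightarrow> kron (1\<^sub>m D) (0\<^sub>m 0 d) *\<^sub>v v = (0\<^sub>v (D * 0) :: 'k :: field vec)"
  by (intro eq_vecI) (auto simp: kron_def)

text \<open>Injectivity is the tall kernel statement for \<open>K\<close>, \<open>L\<close> without
  constraint; the spanning condition is the wide one for the transposes, constrained by the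
  transpose of \<open>M\<close>, with \<open>a\<close> and \<open>b\<close> swapped. For D > 0 the
  slope hypotheses place a / b between (D - 1) / D and (D + 1) / (D + 2), the slopes of the
  neighbouring blocks.\<close>

lemma tall_semi_invariant:
  fixes K L M :: "'k :: field mat"
  assumes S: "(K, L, M) \<in> lomadze_space n m p"
    and exp: "expanding a b K L (0\<^sub>m 0 n)" and exp': "expanding b a K\<^sup>T L\<^sup>T M\<^sup>T"
    and "b * D \<le> a * D + b" "a * (D + 2) \<le> b * (D + 1)" "0 < a"
  shows "\<exists>f \<in> semi_invariants n m p (- int D) (int (Suc D)) 1. f (K, L, M) \<noteq> 0"
proof -
  have K: "K \<in> carrier_mat (n + p) n" and L: "L \<in> carrier_mat (n + p) n"
    and M: "M \<in> carrier_mat (n + p) (p + m)" using S by (auto simp: lomadze_space_iff)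
  let ?X = "tall_shift 0 D :: 'k mat" and ?Y = "tall_shift 1 D :: 'k mat"
  have T: "kron ?X K + kron ?Y L \<in> carrier_mat (Suc D * (n + p)) (D * n)"
    by (intro add_carrier_mat kron_carrier tall_shift_carrier L)
  have "inj_mat (kron ?X K + kron ?Y L)"
    by (rule inj_matI[OF T], rule tall_kron_kernel[OF exp K L zero_carrier_mat])
      (use assms kron_unconstrained in auto)
  moreover have "w = 0\<^sub>v (Suc D * (n + p))"
    if "w \<in> carrier_vec (Suc D * (n + p))" "(kron ?X K + kron ?Y L)\<^sup>T *\<^sub>v w = 0\<^sub>v (D * n)"
      "(kron (1\<^sub>m (Suc D)) M)\<^sup>T *\<^sub>v w = 0\<^sub>v (Suc D * (p + m))" for w
    by (rule wide_kron_kernel[OF exp', where e = n and c = "p + m" and D = D])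
      (use that assms K L M in \<open>simp_all only: kron_pencil_transpose[OF tall_shift_carrier tall_shift_carrier K L]
        kron_transpose[OF one_carrier_mat M] transpose_one transpose_carrier_mat\<close>)
  ultimately show ?thesis
    by (rule kron_semi_invariant[OF S tall_shift_carrier tall_shift_carrier])
qed

text \<open>The tall and the wide kernel statements exchange roles. For D > 1 the slope hypotheses
  place a / b between (D + 2) / (D + 1) and D / (D - 1), again the slopes of the neighbours.\<close>

lemma wide_semi_invariant:
  fixes K L M :: "'k :: field mat"
  assumes S: "(K, L, M) \<in> lomadze_space n m p"
    and exp: "expanding a b K L (0\<^sub>m 0 n)" and exp': "expanding b a K\<^sup>T L\<^sup>T M\<^sup>T"
    and "b * (D + 2) \<le> a * (D + 1)" "a * D \<le> b * D + a" "0 < b"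
  shows "\<exists>f \<in> semi_invariants n m p (- int (Suc D)) (int D) 1. f (K, L, M) \<noteq> 0"
proof -
  have K: "K \<in> carrier_mat (n + p) n" and L: "L \<in> carrier_mat (n + p) n"
    and M: "M \<in> carrier_mat (n + p) (p + m)" using S by (auto simp: lomadze_space_iff)
  let ?X = "(tall_shift 0 D)\<^sup>T :: 'k mat" and ?Y = "(tall_shift 1 D)\<^sup>T :: 'k mat"
  have X: "?X \<in> carrier_mat D (Suc D)" and Y: "?Y \<in> carrier_mat D (Suc D)" by simp_all
  have T: "kron ?X K + kron ?Y L \<in> carrier_mat (D * (n + p)) (Suc D * n)"
    by (intro add_carrier_mat kron_carrier Y L)
  have "inj_mat (kron ?X K + kron ?Y L)"
    by (rule inj_matI[OF T], rule wide_kron_kernel[OF exp K L zero_carrier_mat _ _ _ _ kron_unconstrained])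
      (use assms in auto)
  moreover have "w = 0\<^sub>v (D * (n + p))"
    if "w \<in> carrier_vec (D * (n + p))" "(kron ?X K + kron ?Y L)\<^sup>T *\<^sub>v w = 0\<^sub>v (Suc D * n)"
      "(kron (1\<^sub>m D) M)\<^sup>T *\<^sub>v w = 0\<^sub>v (D * (p + m))" for w
    by (rule tall_kron_kernel[OF exp', where e = n and c = "p + m" and D = D])
      (use that assms K L M in \<open>simp_all only: kron_pencil_transpose[OF X Y K L] transpose_transpose
        kron_transpose[OF one_carrier_mat M] transpose_one transpose_carrier_mat\<close>)
  ultimately show ?thesis
    by (rule kron_semi_invariant[OF S X Y])
qed

lemma semi_invariant_product:
  assumes "\<exists>f \<in> semi_invariants n m p c0 c1 1. f S \<noteq> 0" "\<exists>f \<in> semi_invariants n m p d0 d1 1. f S \<noteq> 0"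
    and "c = int k * c0 + int l * d0" "d = int k * c1 + int l * d1"
  shows "char_semistable n m p c d (S :: 'k :: field lomadze)"
proof -
  obtain f h where f: "f \<in> semi_invariants n m p c0 c1 1" "f S \<noteq> 0"
    and h: "h \<in> semi_invariants n m p d0 d1 1" "h S \<noteq> 0" using assms by blast
  have "(\<lambda>x. f x ^ k * h x ^ l) \<in> semi_invariants n m p c d 1"
    unfolding assms(3,4) by (intro semi_invariant_mult semi_invariant_power f h)
  then show ?thesis
    using f h unfolding char_semistable_def
    by (intro exI[of _ 1] conjI bexI[of _ "\<lambda>x. f x ^ k * h x ^ l"]) auto
qed

text \<open>The weight \<open>(-a, b)\<close> is a nonnegative combination of the weights of the two consecutive
  blocks whose slopes \<open>D / (D + 1)\<close> (or their inverses) enclose \<open>a / b\<close>.\<close>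

lemma consecutive_blocks:
  fixes a b :: nat
  assumes "a < b"
  obtains D k l where "k * D + l * Suc D = a" "k * Suc D + l * (D + 2) = b"
    "b * D \<le> a * Suc D" "a * (D + 2) \<le> b * (D + 1)"
proof -
  \<comment> \<open>Each block contributes 1 to b - a, so k + l = e blocks are needed. Then a = e D
    + l, and division with remainder determines \<open>D\<close> and \<open>l\<close>.\<close>
  define e where "e = b - a"
  define D where "D = a div e"
  define l where "l = a mod e"
  have e: "0 < e" "b = a + e" using assms by (auto simp: e_def)
  have le: "l < e" using e by (simp add: l_def)
  have a: "a = D * e + l" by (simp add: D_def l_def)
  obtain k where k: "e = k + l" using le by (metis add.commute less_imp_add_positive)
  show ?thesis
  proof (rule that[of k D l])
    show "k * D + l * Suc D = a" "k * Suc D + l * (D + 2) = b"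
      using a e k by (simp_all add: algebra_simps)
    show "b * D \<le> a * Suc D" using a e by (simp add: algebra_simps)
    show "a * (D + 2) \<le> b * (D + 1)" using a e le by (simp add: algebra_simps)
  qed
qed

text \<open>For a < b tall blocks are multiplied, for b < a wide ones, with the same decomposition
  applied to the swapped pair. No finite block has slope 1, hence the hypothesis a \<noteq>
  b.\<close>

lemma char_semistable_of_expanding:
  fixes K L M :: "'k :: field mat"
  assumes S: "(K, L, M) \<in> lomadze_space n m p"
    and exp: "expanding a b K L (0\<^sub>m 0 n)" and exp': "expanding b a K\<^sup>T L\<^sup>T M\<^sup>T"
    and pos: "0 < a" "0 < b" and "a \<noteq> b"
  shows "char_semistable n m p (- int a) (int b) (K, L, M)"
proof (cases "a < b")
  case True
  then obtain D k l where D: "k * D + l * Suc D = a" "k * Suc D + l * (D + 2) = b"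
    "b * D \<le> a * Suc D" "a * (D + 2) \<le> b * (D + 1)" by (rule consecutive_blocks)
  show ?thesis
  proof (rule semi_invariant_product[where k = k and l = l])
    show "\<exists>f \<in> semi_invariants n m p (- int D) (int (Suc D)) 1. f (K, L, M) \<noteq> 0"
      by (rule tall_semi_invariant[OF S exp exp']) (use D True pos in auto)
    show "\<exists>f \<in> semi_invariants n m p (- int (Suc D)) (int (Suc (Suc D))) 1. f (K, L, M) \<noteq> 0"
      by (rule tall_semi_invariant[OF S exp exp']) (use D True pos in auto)
  qed (simp_all add: algebra_simps flip: D(1,2))
next
  case False
  then have "b < a" using \<open>a \<noteq> b\<close> by simp
  then obtain D k l where D: "k * D + l * Suc D = b" "k * Suc D + l * (D + 2) = a"
    "a * D \<le> b * Suc D" "b * (D + 2) \<le> a * (D + 1)" by (rule consecutive_blocks)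
  show ?thesis
  proof (rule semi_invariant_product[where k = k and l = l])
    show "\<exists>f \<in> semi_invariants n m p (- int (Suc D)) (int D) 1. f (K, L, M) \<noteq> 0"
      by (rule wide_semi_invariant[OF S exp exp']) (use D \<open>b < a\<close> pos in auto)
    show "\<exists>f \<in> semi_invariants n m p (- int (Suc (Suc D))) (int (Suc D)) 1. f (K, L, M) \<noteq> 0"
      by (rule wide_semi_invariant[OF S exp exp']) (use D \<open>b < a\<close> pos in auto)
  qed (simp_all add: algebra_simps flip: D(1,2))
qed

section \<open>The numerical criterion\<close>

text \<open>The common form of upper and lower stability at a generic slope: denominators are
  cleared, so no fraction with denominator 0 arises, and both inequalities are strict.\<close>

fun numerically_stable :: "nat \<Rightarrow> nat \<Rightarrow> nat \<Rightarrow> nat \<Rightarrow> nat \<Rightarrow> 'k :: field lomadze \<Rightarrow> bool" where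
  "numerically_stable n m p a b (K, L, M) \<longleftrightarrow>
     (\<forall>U V. vec_subspace n U \<and> vec_subspace (n + p) V \<and> maps_into K L U V \<longrightarrow>
        ((vec_dim n U > 0 \<or> vec_dim (n + p) V > 0) \<longrightarrow>
           int a * vec_dim n U < int b * vec_dim (n + p) V) \<and>
        ((U \<subset> carrier_vec n \<or> V \<subset> carrier_vec (n + p)) \<and>
         (\<lambda>x. M *\<^sub>v x) ` carrier_vec (p + m) \<subseteq> V \<longrightarrow>
           int b * (int (n + p) - vec_dim (n + p) V) < int a * (int n - vec_dim n U)))"

definition generic_slope :: "nat \<Rightarrow> nat \<Rightarrow> nat \<Rightarrow> nat \<Rightarrow> bool" where
  "generic_slope n p a b \<longleftrightarrow>
     0 < a \<and> 0 < b \<and> (\<forall>u\<le>n. \<forall>v\<le>n + p. (0 < u \<or> 0 < v) \<longrightarrow> a * u \<noteq> b * v)"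

lemma maps_intoI:
  assumes "vec_subspace d V" "\<And>u. u \<in> U \<Longrightarrow> K *\<^sub>v u \<in> V" "\<And>u. u \<in> U \<Longrightarrow> L *\<^sub>v u \<in> V"
  shows "maps_into K L U V"
  using assms by (auto simp: maps_into_def vec_subspace_iff)

lemma maps_intoD:
  assumes "maps_into K L U V" "K \<in> carrier_mat e d" "L \<in> carrier_mat e d" "vec_subspace d U" "u \<in> U"
  shows "K *\<^sub>v u \<in> V" "L *\<^sub>v u \<in> V"
proof -
  have 0: "0\<^sub>v d \<in> U" and u: "u \<in> carrier_vec d" using assms(4,5) by (auto simp: vec_subspace_iff)
  have z: "K *\<^sub>v 0\<^sub>v d = 0\<^sub>v e" "L *\<^sub>v 0\<^sub>v d = 0\<^sub>v e" using assms(2,3) by auto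
  have car: "K *\<^sub>v u \<in> carrier_vec e" "L *\<^sub>v u \<in> carrier_vec e" using assms(2,3) u by auto
  have in_V: "K *\<^sub>v x + L *\<^sub>v y \<in> V" if "x \<in> U" "y \<in> U" for x y
    using assms(1) that unfolding maps_into_def by blast
  from in_V[OF assms(5) 0] show "K *\<^sub>v u \<in> V" using z car by simp
  from in_V[OF 0 assms(5)] show "L *\<^sub>v u \<in> V" using z car by simp
qed

lemma numerically_stableD:
  assumes "numerically_stable n m p a b (K, L, M)"
    and "vec_subspace n U" "vec_subspace (n + p) V" "maps_into K L U V"
  shows "0 < vec_dim n U \<or> 0 < vec_dim (n + p) V \<Longrightarrow>
      int a * vec_dim n U < int b * vec_dim (n + p) V"
    and "U \<subset> carrier_vec n \<or> V \<subset> carrier_vec (n + p) \<Longrightarrow>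
      (\<lambda>x. M *\<^sub>v x) ` carrier_vec (p + m) \<subseteq> V \<Longrightarrow>
      int b * (int (n + p) - vec_dim (n + p) V) < int a * (int n - vec_dim n U)"
  using assms(1)[unfolded numerically_stable.simps, THEN spec[of _ U], THEN spec[of _ V]] assms(2-)
  by blast+

text \<open>The inequality is applied to the spans of the \<open>w j\<close> and of the
  \<open>y j\<close>. For the latter only dimension at most \<open>s\<close> is known, which is the
  bound required.\<close>

lemma expanding_of_numerically_stable:
  assumes S: "(K, L, M) \<in> lomadze_space n m p" and num: "numerically_stable n m p a b (K, L, M)"
  shows "expanding a b K L (0\<^sub>m 0 n)"
  unfolding expanding_def
proof (intro allI impI)
  have K: "K \<in> carrier_mat (n + p) n" and L: "L \<in> carrier_mat (n + p) n"
    using S by (auto simp: lomadze_space_iff)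
  fix r s and w y :: "nat \<Rightarrow> 'a vec"
  assume r: "0 < r" and inj: "inj_mat (colmat (dim_col K) r w)"
    and w: "\<forall>j<r. w j \<in> carrier_vec (dim_col K) \<and> 0\<^sub>m 0 n *\<^sub>v w j = 0\<^sub>v (dim_row (0\<^sub>m 0 n :: 'a mat))"
    and Y: "\<forall>j<r. K *\<^sub>v w j \<in> colspace (colmat (dim_row K) s y) \<and> L *\<^sub>v w j \<in> colspace (colmat (dim_row K) s y)"
  let ?U = "colspace (colmat n r w)" and ?V = "colspace (colmat (n + p) s y)"
  have dU: "vec_dim n ?U = int r" using vec_dim_colspace[OF colmat_carrier] inj K by auto
  have dV: "vec_dim (n + p) ?V \<le> int s" by (rule vec_dim_colspace_le[OF colmat_carrier])
  have V: "vec_subspace (n + p) ?V" and U: "vec_subspace n ?U"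
    by (rule vec_subspace_colspace[OF colmat_carrier])+
  have "maps_into K L ?U ?V"
    by (rule maps_intoI[OF V]; rule mult_colspace_subset[OF _ colmat_carrier]) (use K L w Y in auto)
  then have "int a * vec_dim n ?U < int b * vec_dim (n + p) ?V"
    using numerically_stableD(1)[OF num U V] dU r by simp
  also have "\<dots> \<le> int b * int s" using dV by (intro mult_left_mono) auto
  finally show "a * r < b * s" using dU by (simp flip: of_nat_mult)
qed

text \<open>Take for \<open>?U\<close> and \<open>?V\<close> the annihilators of the
  \<open>y j\<close> and of the \<open>w j\<close>. That the transposed pencil maps the
  \<open>w j\<close> into the span of the \<open>y j\<close> means that the pencil maps
  \<open>?U\<close> into \<open>?V\<close>; that the \<open>w j\<close> are killed by the transpose
  of \<open>M\<close> means that \<open>?V\<close> contains the image of \<open>M\<close>. The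
  codimensions are r for \<open>?V\<close> and at most s for \<open>?U\<close>.\<close>

lemma expanding_transpose_of_numerically_stable:
  assumes S: "(K, L, M) \<in> lomadze_space n m p" and num: "numerically_stable n m p a b (K, L, M)"
  shows "expanding b a K\<^sup>T L\<^sup>T M\<^sup>T"
  unfolding expanding_def
proof (intro allI impI)
  have K: "K \<in> carrier_mat (n + p) n" and L: "L \<in> carrier_mat (n + p) n"
    and M: "M \<in> carrier_mat (n + p) (p + m)" using S by (auto simp: lomadze_space_iff)
  fix r s and w y :: "nat \<Rightarrow> 'a vec"
  assume r: "0 < r" and inj: "inj_mat (colmat (dim_col K\<^sup>T) r w)"
    and w': "\<forall>j<r. w j \<in> carrier_vec (dim_col K\<^sup>T) \<and> M\<^sup>T *\<^sub>v w j = 0\<^sub>v (dim_row M\<^sup>T)"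
    and Y': "\<forall>j<r. K\<^sup>T *\<^sub>v w j \<in> colspace (colmat (dim_row K\<^sup>T) s y) \<and>
      L\<^sup>T *\<^sub>v w j \<in> colspace (colmat (dim_row K\<^sup>T) s y)"
  define W where "W = colmat (n + p) r w"
  define Y where "Y = colmat n s y"
  have W: "W \<in> carrier_mat (n + p) r" and Yc: "Y \<in> carrier_mat n s" by (simp_all add: W_def Y_def)
  have w: "w j \<in> carrier_vec (n + p)" "M\<^sup>T *\<^sub>v w j = 0\<^sub>v (p + m)" if "j < r" for j
    using w' that K M by auto
  have Y: "K\<^sup>T *\<^sub>v w j \<in> colspace Y" "L\<^sup>T *\<^sub>v w j \<in> colspace Y" if "j < r" for j
    using Y' that K by (auto simp: Y_def)
  let ?U = "kernel_of Y\<^sup>T" and ?V = "kernel_of W\<^sup>T"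
  have U: "vec_subspace n ?U" using vec_subspace_kernel_of[of "Y\<^sup>T" s n] Yc by simp
  have V: "vec_subspace (n + p) ?V" using vec_subspace_kernel_of[of "W\<^sup>T" r "n + p"] W by simp
  have dV: "vec_dim (n + p) ?V = int (n + p) - int r"
    using rank_nullity_mat[of "W\<^sup>T" r "n + p"] surj_mat_colspace[of "W\<^sup>T" r "n + p"] W inj K
    by (simp add: W_def)
  have dU: "vec_dim n ?U \<ge> int n - int s"
    using rank_nullity_mat[of "Y\<^sup>T" s n] vec_dim_bounds(2)[OF vec_subspace_colspace[of "Y\<^sup>T" s n]] Yc
    by simp
  have inV: "A *\<^sub>v x \<in> ?V"
    if A: "A \<in> carrier_mat (n + p) q" and x: "x \<in> carrier_vec q"
      and zero: "\<And>j. j < r \<Longrightarrow> (A\<^sup>T *\<^sub>v w j) \<bullet> x = 0" for A q x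
  proof -
    have "W\<^sup>T *\<^sub>v (A *\<^sub>v x) = 0\<^sub>v r"
    proof (rule eq_vecI)
      fix j assume "j < dim_vec (0\<^sub>v r :: 'a vec)"
      then have j: "j < r" by simp
      have "(W\<^sup>T *\<^sub>v (A *\<^sub>v x)) $ j = w j \<bullet> (A *\<^sub>v x)"
        using j w(1)[OF j] by (simp add: W_def col_colmat)
      also have "\<dots> = (A\<^sup>T *\<^sub>v w j) \<bullet> x"
        by (rule transpose_vec_mult_scalar[OF A x w(1)[OF j], symmetric])
      finally show "(W\<^sup>T *\<^sub>v (A *\<^sub>v x)) $ j = 0\<^sub>v r $ j" using zero j by simp
    qed (use W in simp)
    then show ?thesis using W A x by (simp add: kernel_of_iff[of _ r "n + p"])
  qed
  have orth: "z \<bullet> x = 0" if z: "z \<in> colspace Y" and x: "x \<in> ?U" for z x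
  proof -
    have xc: "x \<in> carrier_vec n" "Y\<^sup>T *\<^sub>v x = 0\<^sub>v s" using x Yc by (auto simp: kernel_of_iff[of _ s n])
    obtain c where c: "c \<in> carrier_vec s" "z = Y *\<^sub>v c" using z by (rule colspaceE[OF _ Yc])
    have "z \<bullet> x = x \<bullet> (Y *\<^sub>v c)" unfolding c(2) using Yc c xc comm_scalar_prod[of x n "Y *\<^sub>v c"] by simp
    also have "\<dots> = (Y\<^sup>T *\<^sub>v x) \<bullet> c" by (rule transpose_vec_mult_scalar[OF Yc c(1) xc(1), symmetric])
    also have "\<dots> = 0" using xc(2) c(1) by simp
    finally show ?thesis .
  qed
  have Uc: "x \<in> carrier_vec n" if "x \<in> ?U" for x using that Yc by (auto simp: kernel_of_iff[of _ s n])
  have "maps_into K L ?U ?V"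
    by (rule maps_intoI[OF V]; rule inV) (use K L Uc orth Y in auto)
  moreover have "(\<lambda>x. M *\<^sub>v x) ` carrier_vec (p + m) \<subseteq> ?V"
    using inV[OF M] w(2) by auto
  moreover have "?V \<subset> carrier_vec (n + p)"
    using dV vec_dim_eq_full[OF V] r V by (auto simp: vec_subspace_iff)
  ultimately have "int b * (int (n + p) - vec_dim (n + p) ?V) < int a * (int n - vec_dim n ?U)"
    using numerically_stableD(2)[OF num U V] by blast
  also have "\<dots> \<le> int a * int s" using dU by (intro mult_left_mono) auto
  finally show "b * r < a * s" using dV by (simp flip: of_nat_mult)
qed

section \<open>Degeneration along one-parameter subgroups\<close>

lemma polyfuns_along_curve:
  assumes "f \<in> polyfuns C" "\<And>c. c \<in> C \<Longrightarrow> \<exists>P. \<forall>t. c (\<gamma> t) = poly P t"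
  shows "\<exists>P. \<forall>t. f (\<gamma> t) = poly P t"
  using assms(1)
proof (induction rule: polyfuns.induct)
  case (const c)
  show ?case by (rule exI[of _ "[:c:]"]) simp
next
  case (add f g)
  then show ?case by (metis poly_add)
next
  case (mult f g)
  then show ?case by (metis poly_mult)
qed (use assms(2) in blast)

text \<open>The curve \<open>\<gamma>\<close> extends the orbit map of a one-parameter subgroup to \<open>t = 0\<close>, so
  \<open>f x = t ^ (e * N) * f (\<gamma> t)\<close> is an identity of polynomials in \<open>t\<close>; evaluate it at \<open>0\<close>.\<close>

lemma semi_invariant_degenerate:
  fixes x :: "'k :: field_char_0 lomadze"
  assumes f: "f \<in> semi_invariants n m p c0 c1 N" and N: "1 \<le> N" and x: "x \<in> lomadze_space n m p"
    and curve: "\<And>c. c \<in> lomadze_coords n m p \<Longrightarrow> \<exists>P. \<forall>t. c (\<gamma> t) = poly P t"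
    and orbit: "\<And>t. t \<noteq> 0 \<Longrightarrow> \<exists>g \<in> carrier (lomadze_group n p).
      \<gamma> t = act n g x \<and> character c0 c1 g = inverse t ^ e"
    and e: "0 < e"
  shows "f x = 0"
proof -
  obtain P where P: "\<And>t. f (\<gamma> t) = poly P t"
    using polyfuns_along_curve[of f "lomadze_coords n m p" \<gamma>] f curve by (auto simp: semi_invariants_def)
  define R where "R = monom 1 (e * N) * P - [:f x:]"
  have "poly R t = 0" if t: "t \<noteq> 0" for t
  proof -
    obtain g where "g \<in> carrier (lomadze_group n p)" "\<gamma> t = act n g x" "character c0 c1 g = inverse t ^ e"
      using orbit[OF t] by blast
    then have "poly P t = (inverse t ^ e) ^ N * f x"
      using f x P[of t] by (simp add: semi_invariants_def)
    then show ?thesis using t by (simp add: R_def poly_monom power_mult power_inverse)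
  qed
  then have "UNIV - {0} \<subseteq> {t. poly R t = 0}" by auto
  then have "infinite {t. poly R t = 0}"
    using infinite_UNIV_char_0[where ?'a = 'k] infinite_super by (metis finite.emptyI infinite_remove)
  then have "R = 0" using poly_roots_finite by blast
  then have "poly R 0 = 0" by simp
  then show ?thesis using e N by (simp add: R_def poly_monom power_0_left split: if_splits)
qed

text \<open>The two scalars are separate because each inequality has its own subgroup: (t, 1) for
  the one on dimensions and (1, 1 / t) for the one on codimensions.\<close>

definition split_diag :: "nat \<Rightarrow> nat \<Rightarrow> 'k :: field \<Rightarrow> 'k \<Rightarrow> 'k mat" where
  "split_diag d u \<alpha> \<beta> = mat d d (\<lambda>(i, j). if i = j then if i < u then \<alpha> else \<beta> else 0)"

lemma split_diag_carrier [simp]: "split_diag d u \<alpha> \<beta> \<in> carrier_mat d d"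
  by (simp add: split_diag_def)

lemma split_diag_dims:
  "dim_row (split_diag d u \<alpha> \<beta>) = d" "dim_col (split_diag d u \<alpha> \<beta>) = d"
  by (simp_all add: split_diag_def)

lemma det_split_diag:
  assumes "u \<le> d"
  shows "Determinant.det (split_diag d u \<alpha> \<beta>) = \<alpha> ^ u * \<beta> ^ (d - u)"
proof -
  have "Determinant.det (split_diag d u \<alpha> \<beta>) = prod_list (diag_mat (split_diag d u \<alpha> \<beta>))"
    by (rule det_upper_triangular[OF _ split_diag_carrier]) (auto simp: split_diag_def)
  also have "\<dots> = (\<Prod>i<d. if i < u then \<alpha> else \<beta>)"
    by (simp add: split_diag_def diag_mat_def prod.list_conv_set_nth atLeast0LessThan)
  also have "{..<d} = {..<u} \<union> {u..<d}" using assms by auto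
  also have "(\<Prod>i\<in>\<dots>. if i < u then \<alpha> else \<beta>) =
      (\<Prod>i<u. if i < u then \<alpha> else \<beta>) * (\<Prod>i=u..<d. if i < u then \<alpha> else \<beta>)"
    by (rule prod.union_disjoint) auto
  finally show ?thesis by simp
qed

lemma split_diag_mult:
  assumes A: "A \<in> carrier_mat d c" and "i < d" "j < c"
  shows "(split_diag d u \<alpha> \<beta> * A) $$ (i, j) = (if i < u then \<alpha> else \<beta>) * A $$ (i, j)"
proof -
  have "(split_diag d u \<alpha> \<beta> * A) $$ (i, j) = (\<Sum>k<d. split_diag d u \<alpha> \<beta> $$ (i, k) * A $$ (k, j))"
    using assms by (simp add: scalar_prod_def atLeast0LessThan split_diag_def)
  also have "\<dots> = (\<Sum>k<d. if k = i then (if i < u then \<alpha> else \<beta>) * A $$ (i, j) else 0)"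
    using assms by (intro sum.cong) (auto simp: split_diag_def)
  finally show ?thesis using assms by simp
qed

lemma mult_split_diag:
  assumes A: "A \<in> carrier_mat c d" and "i < c" "j < d"
  shows "(A * split_diag d u \<alpha> \<beta>) $$ (i, j) = A $$ (i, j) * (if j < u then \<alpha> else \<beta>)"
proof -
  have "(A * split_diag d u \<alpha> \<beta>) $$ (i, j) = (\<Sum>k<d. A $$ (i, k) * split_diag d u \<alpha> \<beta> $$ (k, j))"
    using assms by (simp add: scalar_prod_def atLeast0LessThan split_diag_def)
  also have "\<dots> = (\<Sum>k<d. if k = j then A $$ (i, j) * (if j < u then \<alpha> else \<beta>) else 0)"
    using assms by (intro sum.cong) (auto simp: split_diag_def)
  finally show ?thesis using assms by simp
qed

lemma split_diag_gl:
  assumes "\<alpha> \<noteq> 0" "\<beta> \<noteq> 0" "u \<le> d"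
  shows "split_diag d u \<alpha> \<beta> \<in> carrier (gl d)"
  using assms by (simp add: carrier_gl det_split_diag)

lemma inv_split_diag:
  assumes "\<alpha> \<noteq> 0" "\<beta> \<noteq> 0" "u \<le> d"
  shows "inv\<^bsub>gl d\<^esub> (split_diag d u \<alpha> \<beta>) = split_diag d u (inverse \<alpha>) (inverse \<beta>)"
proof -
  interpret group "gl d" by (rule group_gl)
  have "split_diag d u (inverse \<alpha>) (inverse \<beta>) * split_diag d u \<alpha> \<beta> = 1\<^sub>m d"
    using assms by (intro eq_matI)
      (simp_all add: split_diag_mult[OF split_diag_carrier], auto simp: split_diag_def)
  then show ?thesis using assms by (intro inv_equality) (auto intro!: split_diag_gl)
qed

lemma act_split_diag:
  assumes "\<alpha> \<noteq> 0" "\<beta> \<noteq> 0" "u \<le> n" and K: "K \<in> carrier_mat d n"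
    and "i < d" "j < n"
  shows "(split_diag d v \<alpha> \<beta> * K * inv\<^bsub>gl n\<^esub> (split_diag n u \<alpha> \<beta>)) $$ (i, j) =
    (if i < v then \<alpha> else \<beta>) * K $$ (i, j) * inverse (if j < u then \<alpha> else \<beta>)"
  using assms
  by (simp add: inv_split_diag mult_split_diag[OF mult_carrier_mat[OF split_diag_carrier K]]
      split_diag_mult[OF K])

lemma mult_unit_vec_index:
  "(A :: 'k :: field mat) \<in> carrier_mat r c \<Longrightarrow> i < r \<Longrightarrow> j < c \<Longrightarrow> (A *\<^sub>v unit_vec c j) $ i = A $$ (i, j)"
  by simp

text \<open>Acting by the inverses of two adapted basis matrices turns \<open>U\<close> and
  \<open>V\<close> into spans of leading coordinate vectors, so containments of subspaces become
  vanishing blocks of entries.\<close>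

lemma adapted_representative:
  fixes K L M :: "'k :: field mat"
  assumes S: "(K, L, M) \<in> lomadze_space n m p"
    and U: "vec_subspace n U" and V: "vec_subspace (n + p) V" and into: "maps_into K L U V"
  obtains g K' L' M' u v where "g \<in> carrier (lomadze_group n p)" "act n g (K, L, M) = (K', L', M')"
    "u \<le> n" "v \<le> n + p" "vec_dim n U = int u" "vec_dim (n + p) V = int v"
    "\<forall>i j. v \<le> i \<and> i < n + p \<and> j < u \<longrightarrow> K' $$ (i, j) = 0 \<and> L' $$ (i, j) = 0"
    "(\<lambda>x. M *\<^sub>v x) ` carrier_vec (p + m) \<subseteq> V \<longrightarrow>
      (\<forall>i j. v \<le> i \<and> i < n + p \<and> j < p + m \<longrightarrow> M' $$ (i, j) = 0)"
proof -
  have K: "K \<in> carrier_mat (n + p) n" and L: "L \<in> carrier_mat (n + p) n"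
    and M: "M \<in> carrier_mat (n + p) (p + m)" using S by (auto simp: lomadze_space_iff)
  obtain P u where P: "P \<in> carrier_mat n n" "Determinant.det P \<noteq> 0" "u \<le> n" "vec_dim n U = int u"
    "\<forall>x\<in>carrier_vec n. P *\<^sub>v x \<in> U \<longleftrightarrow> (\<forall>i. u \<le> i \<and> i < n \<longrightarrow> x $ i = 0)"
    by (rule vec_subspace_adapted_basis[OF U])
  obtain Q v where Q: "Q \<in> carrier_mat (n + p) (n + p)" "Determinant.det Q \<noteq> 0" "v \<le> n + p"
    "vec_dim (n + p) V = int v"
    "\<forall>x\<in>carrier_vec (n + p). Q *\<^sub>v x \<in> V \<longleftrightarrow> (\<forall>i. v \<le> i \<and> i < n + p \<longrightarrow> x $ i = 0)"
    by (rule vec_subspace_adapted_basis[OF V])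
  interpret G0: group "gl n :: 'k mat monoid" by (rule group_gl)
  interpret G1: group "gl (n + p) :: 'k mat monoid" by (rule group_gl)
  have Pg: "P \<in> carrier (gl n)" and Qg: "Q \<in> carrier (gl (n + p))" using P Q by (simp_all add: carrier_gl)
  define R where "R = inv\<^bsub>gl (n + p)\<^esub> Q"
  have R: "R \<in> carrier_mat (n + p) (n + p)" "Q * R = 1\<^sub>m (n + p)"
    unfolding R_def by (rule inv_gl[OF Qg])+
  have zero: "(R * A) $$ (i, j) = 0"
    if A: "A \<in> carrier_mat (n + p) c" and j: "j < c" and inV: "A *\<^sub>v unit_vec c j \<in> V"
      and i: "v \<le> i" "i < n + p" for A c i j
  proof -
    have "Q *\<^sub>v (R * A *\<^sub>v unit_vec c j) = Q * (R * A) *\<^sub>v unit_vec c j"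
      by (rule assoc_mult_mat_vec[symmetric, OF Q(1) mult_carrier_mat[OF R(1) A]]) simp
    also have "Q * (R * A) = Q * R * A" by (rule assoc_mult_mat[symmetric, OF Q(1) R(1) A])
    also have "\<dots> = A" using R(2) A by simp
    finally have "Q *\<^sub>v (R * A *\<^sub>v unit_vec c j) \<in> V" using inV by simp
    moreover have RA: "R * A \<in> carrier_mat (n + p) c" by (rule mult_carrier_mat[OF R(1) A])
    moreover have "R * A *\<^sub>v unit_vec c j \<in> carrier_vec (n + p)"
      using RA by (rule mult_mat_vec_carrier) simp
    ultimately have "(R * A *\<^sub>v unit_vec c j) $ i = 0" using Q(5) i by blast
    moreover have "(R * A *\<^sub>v unit_vec c j) $ i = (R * A) $$ (i, j)"
      by (rule mult_unit_vec_index[OF RA i(2) j])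
    ultimately show ?thesis by simp
  qed
  have KP: "A * P *\<^sub>v unit_vec n j \<in> V" if "A = K \<or> A = L" "j < u" for A j
  proof -
    have A: "A \<in> carrier_mat (n + p) n" using that K L by auto
    have "P *\<^sub>v unit_vec n j \<in> U" using that P(3,5) by auto
    then have "A *\<^sub>v (P *\<^sub>v unit_vec n j) \<in> V" using maps_intoD[OF into K L U] that by auto
    then show ?thesis using A P(1) by (simp add: assoc_mult_mat_vec[of _ "n + p" n _ n])
  qed
  show ?thesis
  proof (rule that)
    show "(inv\<^bsub>gl n\<^esub> P, R) \<in> carrier (lomadze_group n p)"
      using Pg Qg by (simp add: carrier_lomadze_group R_def)
    show "act n (inv\<^bsub>gl n\<^esub> P, R) (K, L, M) = (R * K * P, R * L * P, R * M)"
      using Pg by simp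
    have "(R * K * P) = R * (K * P)" "(R * L * P) = R * (L * P)"
      using R(1) K L P(1) by (simp_all add: assoc_mult_mat[of _ "n + p" "n + p" _ n _ n])
    then show "\<forall>i j. v \<le> i \<and> i < n + p \<and> j < u \<longrightarrow> (R * K * P) $$ (i, j) = 0 \<and> (R * L * P) $$ (i, j) = 0"
      using zero[OF mult_carrier_mat[OF K P(1)]] zero[OF mult_carrier_mat[OF L P(1)]] KP P(3) by auto
    show "(\<lambda>x. M *\<^sub>v x) ` carrier_vec (p + m) \<subseteq> V \<longrightarrow>
      (\<forall>i j. v \<le> i \<and> i < n + p \<and> j < p + m \<longrightarrow> (R * M) $$ (i, j) = 0)"
    proof (intro impI allI, elim conjE)
      fix i j assume im: "(\<lambda>x. M *\<^sub>v x) ` carrier_vec (p + m) \<subseteq> V"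
        and i: "v \<le> i" "i < n + p" and j: "j < p + m"
      have "M *\<^sub>v unit_vec (p + m) j \<in> V" using im by (rule subsetD) (rule imageI, simp)
      then show "(R * M) $$ (i, j) = 0" by (rule zero[OF M j _ i])
    qed
  qed (use P Q in auto)
qed

lemma numerically_stable_of_semistable:
  fixes S :: "'k :: field_char_0 lomadze"
  assumes S: "S \<in> lomadze_space n m p" and gen: "generic_slope n p a b"
    and ss: "char_semistable n m p (- int a) (int b) S"
  shows "numerically_stable n m p a b S"
proof -
  obtain K L M where S_def: "S = (K, L, M)" by (cases S)
  obtain N f where N: "1 \<le> N" and f: "f \<in> semi_invariants n m p (- int a) (int b) N" and nz: "f S \<noteq> 0"
    using ss by (auto simp: char_semistable_def)
  have main: "(0 < vec_dim n U \<or> 0 < vec_dim (n + p) V \<longrightarrow>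
        int a * vec_dim n U < int b * vec_dim (n + p) V) \<and>
      ((U \<subset> carrier_vec n \<or> V \<subset> carrier_vec (n + p)) \<and> (\<lambda>x. M *\<^sub>v x) ` carrier_vec (p + m) \<subseteq> V \<longrightarrow>
        int b * (int (n + p) - vec_dim (n + p) V) < int a * (int n - vec_dim n U))"
    if U: "vec_subspace n U" and V: "vec_subspace (n + p) V" and into: "maps_into K L U V" for U V
  proof -
    obtain g K' L' M' u v where g: "g \<in> carrier (lomadze_group n p)" "act n g (K, L, M) = (K', L', M')"
      and uv: "u \<le> n" "v \<le> n + p" "vec_dim n U = int u" "vec_dim (n + p) V = int v"
      and zero: "\<forall>i j. v \<le> i \<and> i < n + p \<and> j < u \<longrightarrow> K' $$ (i, j) = 0 \<and> L' $$ (i, j) = 0"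
      and zeroM: "(\<lambda>x. M *\<^sub>v x) ` carrier_vec (p + m) \<subseteq> V \<longrightarrow>
        (\<forall>i j. v \<le> i \<and> i < n + p \<and> j < p + m \<longrightarrow> M' $$ (i, j) = 0)"
      by (rule adapted_representative[OF S[unfolded S_def] U V into])
    have S': "(K', L', M') \<in> lomadze_space n m p" using act_closed[OF g(1) S] g(2) by (simp add: S_def)
    have K': "K' \<in> carrier_mat (n + p) n" and L': "L' \<in> carrier_mat (n + p) n"
      and M': "M' \<in> carrier_mat (n + p) (p + m)" using S' by (auto simp: lomadze_space_iff)
    obtain g0 g1 where gd: "g = (g0, g1)" by (cases g)
    have "character (- int a) (int b) g \<noteq> 0"
      using g(1) by (auto simp: gd carrier_lomadze_group carrier_gl)
    moreover have "f (act n g S) = character (- int a) (int b) g ^ N * f S"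
      using f g(1) S by (simp add: semi_invariants_def)
    ultimately have nz': "f (K', L', M') \<noteq> 0" using nz g(2) by (simp add: S_def)
    \<comment> \<open>Only the ratio t = \<alpha> / \<beta> affects the first two matrices. It
      multiplies the upper right block by t and leaves the diagonal blocks alone; the lower left
      block, which would get 1 / t, is zero. So the curve extends to t = 0.\<close>
    define scale :: "'k mat \<Rightarrow> 'k \<Rightarrow> 'k mat"
      where "scale A t = mat (n + p) n (\<lambda>(i, j). (if i < v \<and> u \<le> j then t else 1) * A $$ (i, j))" for A t
    \<comment> \<open>For (t, 1) the upper rows are multiplied by t. For (1, 1 / t) the lower rows
      would be divided by t, but they vanish when \<open>V\<close> contains the image of
      \<open>M\<close>; the third matrix is then constant, which is the choice \<open>h\<close> = 1
      below.\<close>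
    define scaleM :: "'k \<Rightarrow> 'k mat"
      where "scaleM t = mat (n + p) (p + m) (\<lambda>(i, j). (if i < v then t else 1) * M' $$ (i, j))" for t
    have curve: "\<exists>P. \<forall>t. c (scale K' t, scale L' t, scaleM (h t)) = poly P t"
      if c: "c \<in> lomadze_coords n m p" and h: "h = (\<lambda>t. t) \<or> h = (\<lambda>t. 1)" for c h
    proof -
      have lin: "\<exists>P. \<forall>t. (if Q then t else 1) * z = poly P t" for Q and z :: 'k
        by (cases Q) (auto intro: exI[of _ "[:0, z:]"] exI[of _ "[:z:]"])
      have cst: "\<exists>P. \<forall>t. z = poly P t" for z :: 'k by (rule exI[of _ "[:z:]"]) simp
      have linh: "\<exists>P. \<forall>t. (if Q then h t else 1) * z = poly P t" for Q and z :: 'k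
        using h by (elim disjE) (simp_all only: lin if_cancel mult_1 cst)
      show ?thesis
        using c unfolding lomadze_coords_def
        by (elim UnE CollectE exE conjE) (auto simp: scale_def scaleM_def lin linh simp del: mult_1 if_splits)
    qed
    have scale: "split_diag (n + p) v \<alpha> \<beta> * A * inv\<^bsub>gl n\<^esub> (split_diag n u \<alpha> \<beta>) = scale A t"
      if ab: "\<alpha> \<noteq> 0" "\<beta> \<noteq> 0" "\<alpha> = t * \<beta>" and A: "A = K' \<or> A = L'" for \<alpha> \<beta> t A
    proof (rule eq_matI)
      have Ac: "A \<in> carrier_mat (n + p) n" using A K' L' by auto
      have carr: "split_diag (n + p) v \<alpha> \<beta> * A * inv\<^bsub>gl n\<^esub> (split_diag n u \<alpha> \<beta>) \<in> carrier_mat (n + p) n"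
        unfolding inv_split_diag[OF ab(1,2) uv(1)]
        by (rule mult_carrier_mat[OF mult_carrier_mat[OF split_diag_carrier Ac] split_diag_carrier])
      show "dim_row (split_diag (n + p) v \<alpha> \<beta> * A * inv\<^bsub>gl n\<^esub> (split_diag n u \<alpha> \<beta>)) = dim_row (scale A t)"
        "dim_col (split_diag (n + p) v \<alpha> \<beta> * A * inv\<^bsub>gl n\<^esub> (split_diag n u \<alpha> \<beta>)) = dim_col (scale A t)"
        using carr by (auto simp: scale_def)
      fix i j assume "i < dim_row (scale A t)" "j < dim_col (scale A t)"
      then have ij: "i < n + p" "j < n" by (auto simp: scale_def)
      have "A $$ (i, j) = 0" if "v \<le> i" "j < u" using zero that ij A by auto
      then show "(split_diag (n + p) v \<alpha> \<beta> * A * inv\<^bsub>gl n\<^esub> (split_diag n u \<alpha> \<beta>)) $$ (i, j) = scale A t $$ (i, j)"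
        unfolding act_split_diag[OF ab(1,2) uv(1) Ac ij] using ij ab by (auto simp: scale_def field_simps)
    qed
    have char: "character (- int a) (int b) (split_diag n u \<alpha> \<beta>, split_diag (n + p) v \<alpha> \<beta>) =
        inverse (\<alpha> ^ (a * u) * \<beta> ^ (a * (n - u))) * (\<alpha> ^ (b * v) * \<beta> ^ (b * (n + p - v)))" for \<alpha> \<beta> :: 'k
      using uv by (simp add: det_split_diag power_int_minus power_mult_distrib mult.commute[of a]
          mult.commute[of b] flip: power_mult)
    have pw: "inverse (t ^ i) * t ^ j = inverse t ^ (i - j)" if "j \<le> i" "t \<noteq> 0" for t :: 'k and i j
      using that by (simp add: power_diff power_inverse field_simps)
    have mem: "(split_diag n u \<alpha> \<beta>, split_diag (n + p) v \<alpha> \<beta>) \<in> carrier (lomadze_group n p)"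
      if "\<alpha> \<noteq> 0" "\<beta> \<noteq> 0" for \<alpha> \<beta> :: 'k
      using that uv by (simp add: carrier_lomadze_group split_diag_gl)
    \<comment> \<open>The subgroup (t, 1) has character t to the power b v - a u, a negative power
      exactly when the inequality fails.\<close>
    have 1: "\<not> b * v < a * u"
    proof
      assume less: "b * v < a * u"
      have "f (K', L', M') = 0"
      proof (rule semi_invariant_degenerate[OF f N S' curve[where h = "\<lambda>t. t"]])
        fix t :: 'k assume t: "t \<noteq> 0"
        have "split_diag (n + p) v t 1 * M' = scaleM t"
          using M' by (intro eq_matI) (auto simp: scaleM_def split_diag_mult[OF M'] split_diag_dims simp del: index_mult_mat(1))
        then show "\<exists>g\<in>carrier (lomadze_group n p).
            (scale K' t, scale L' t, scaleM t) =
            act n g (K', L', M') \<and> character (- int a) (int b) g = inverse t ^ (a * u - b * v)"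
          using t mem[of t 1] scale[of t 1 t] less
          by (intro bexI[OF _ mem[of t 1]]) (simp_all add: char pw del: character.simps)
      qed (use less in auto)
      with nz' show False by simp
    qed
    \<comment> \<open>The subgroup (1, 1 / t) has character t to the power a (n - u) - b (n + p -
      v).\<close>
    have 2: "\<not> a * (n - u) < b * (n + p - v)" if im: "(\<lambda>x. M *\<^sub>v x) ` carrier_vec (p + m) \<subseteq> V"
    proof
      assume less: "a * (n - u) < b * (n + p - v)"
      have "f (K', L', M') = 0"
      proof (rule semi_invariant_degenerate[OF f N S' curve[where h = "\<lambda>t. 1"]])
        fix t :: 'k assume t: "t \<noteq> 0"
        have "split_diag (n + p) v 1 (inverse t) * M' = scaleM 1"
          using M' zeroM im by (intro eq_matI) (auto simp: scaleM_def split_diag_mult[OF M'] split_diag_dims simp del: index_mult_mat(1))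
        then show "\<exists>g\<in>carrier (lomadze_group n p).
            (scale K' t, scale L' t, scaleM 1) =
            act n g (K', L', M') \<and> character (- int a) (int b) g = inverse t ^ (b * (n + p - v) - a * (n - u))"
          using t mem[of 1 "inverse t"] scale[of 1 "inverse t" t] less pw[of "a * (n - u)" "b * (n + p - v)" t]
          by (intro bexI[OF _ mem[of 1 "inverse t"]]) (simp_all add: char power_inverse mult.commute del: character.simps)
      qed (use less in auto)
      with nz' show False by simp
    qed
    \<comment> \<open>Degeneration excludes only strict violations; genericity of the slope excludes
      equality.\<close>
    have "a * u < b * v" if "0 < u \<or> 0 < v"
      using 1 gen uv that unfolding generic_slope_def by (meson linorder_neqE_nat)
    moreover have "b * (n + p - v) < a * (n - u)"
      if "(\<lambda>x. M *\<^sub>v x) ` carrier_vec (p + m) \<subseteq> V" "u < n \<or> v < n + p"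
      using 2[OF that(1)] gen that(2) unfolding generic_slope_def
      by (metis diff_le_self linorder_neqE_nat zero_less_diff)
    moreover have "u < n \<or> v < n + p" if "U \<subset> carrier_vec n \<or> V \<subset> carrier_vec (n + p)"
      using that vec_dim_eq_full[OF U] vec_dim_eq_full[OF V] uv by (metis le_neq_implies_less psubset_eq)
    moreover have diff: "int (n + p) - int v = int (n + p - v)" "int n - int u = int (n - u)"
      using uv by simp_all
    ultimately show ?thesis
      unfolding uv(3,4) diff of_nat_mult[symmetric] of_nat_less_iff of_nat_0_less_iff by blast
  qed
  then show ?thesis by (simp add: S_def)
qed

section \<open>Slopes and homomorphisms\<close>

lemma of_nat_divide_less_iff:
  assumes "0 < b" "0 < d"
  shows "(of_nat a / of_nat b :: rat) < of_nat c / of_nat d \<longleftrightarrow> a * d < b * c"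
proof -
  have "(of_nat a / of_nat b :: rat) < of_nat c / of_nat d \<longleftrightarrow> (of_nat (a * d) :: rat) < of_nat (b * c)"
    using assms by (simp add: field_simps)
  then show ?thesis by (simp only: of_nat_less_iff)
qed

lemma ratio_less_ratio:
  assumes "0 < a" "0 < b" "0 < u \<or> 0 < v"
  shows "ratio (int a) (int b) < ratio (int v) (int u) \<longleftrightarrow> a * u < b * v"
    and "ratio (int v) (int u) < ratio (int a) (int b) \<longleftrightarrow> b * v < a * u"
  using assms of_nat_divide_less_iff[of b u a v] of_nat_divide_less_iff[of u b v a]
  by (cases "u = 0"; simp add: ratio_def mult.commute)+

lemma ratio_in_Lambda_set:
  "u \<le> n \<Longrightarrow> v \<le> n + p \<Longrightarrow> 0 < u \<or> 0 < v \<Longrightarrow> ratio (int v) (int u) \<in> Lambda_set n p"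
  unfolding Lambda_set_def by force

text \<open>As n > 0, both \<infinity> = 1 / 0 and 0 = 0 / 1 belong to \<Lambda>, so neither entry
  of the pair vanishes.\<close>

lemma slope_pair_generic:
  assumes "0 < n" "\<chi> \<notin> Lambda_set n p" "slope_pair \<chi> \<chi>0 \<chi>1"
  obtains a b where "\<chi>0 = - int a" "\<chi>1 = int b" "\<chi> = ratio (int a) (int b)" "generic_slope n p a b"
proof -
  define a b where "a = nat (- \<chi>0)" and "b = nat \<chi>1"
  have ab: "\<chi>0 = - int a" "\<chi>1 = int b" "\<chi> = ratio (int a) (int b)" "0 < a \<or> 0 < b"
    using assms(3) by (auto simp: slope_pair_def a_def b_def)
  have "b \<noteq> 0"
  proof
    assume "b = 0"
    then have "\<chi> = ratio (int 1) (int 0)" using ab(3) by (simp add: ratio_def)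
    then show False using assms(1,2) ratio_in_Lambda_set[of 0 n 1 p] by auto
  qed
  have "a \<noteq> 0"
  proof
    assume "a = 0"
    then have "\<chi> = ratio (int 0) (int 1)" using ab(3) \<open>b \<noteq> 0\<close> by (simp add: ratio_def)
    then show False using assms(1,2) ratio_in_Lambda_set[of 1 n 0 p] by auto
  qed
  have "a * u \<noteq> b * v" if "u \<le> n" "v \<le> n + p" "0 < u \<or> 0 < v" for u v
    using ratio_less_ratio[of a b u v] ratio_in_Lambda_set[OF that] \<open>a \<noteq> 0\<close> \<open>b \<noteq> 0\<close> that(3) assms(2) ab(3)
    by (metis less_irrefl linorder_neqE neq0_conv)
  then show ?thesis using that[OF ab(1,2,3)] \<open>a \<noteq> 0\<close> \<open>b \<noteq> 0\<close> by (simp add: generic_slope_def)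
qed

lemma slope_pair_exists:
  assumes "\<chi> \<in> slopes"
  shows "\<exists>\<chi>0 \<chi>1. slope_pair \<chi> \<chi>0 \<chi>1"
proof (cases \<chi>)
  case (Fin q)
  obtain x y where xy: "quotient_of q = (x, y)" by (cases "quotient_of q")
  have y: "0 < y" using quotient_of_denom_pos[OF xy] .
  have q: "q = of_int x / of_int y" using quotient_of_div[OF xy] .
  have "0 \<le> q" using assms Fin by (simp add: slopes_def)
  then have "0 \<le> x" using q y by (simp add: zero_le_divide_iff)
  then show ?thesis using Fin q y
    by (intro exI[of _ "- x"] exI[of _ y]) (simp add: slope_pair_def ratio_def)
next
  case Pinf
  then show ?thesis by (intro exI[of _ "- 1"] exI[of _ 0]) (simp add: slope_pair_def ratio_def)
qed (use assms in \<open>simp add: slopes_def\<close>)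

text \<open>No element of \<Lambda> lies strictly between \<chi> and \<open>l\<close>, and none
  equals \<chi>. Replacing \<open>l\<close> by \<chi> therefore changes no comparison with \<Lambda>
  except that the weak inequality becomes strict.\<close>

lemma Delta_plus_iff:
  assumes "\<chi> \<in> Delta_plus n p l" "r \<in> Lambda_set n p"
  shows "l \<le> r \<longleftrightarrow> \<chi> < r" "r < l \<longleftrightarrow> r < \<chi>"
  using assms unfolding Delta_plus_def
  by (auto dest: order.strict_trans less_le_trans simp: not_le[symmetric])

lemma Delta_minus_iff:
  assumes "\<chi> \<in> Delta_minus n p l" "r \<in> Lambda_set n p"
  shows "l < r \<longleftrightarrow> \<chi> < r" "r \<le> l \<longleftrightarrow> r < \<chi>"
  using assms unfolding Delta_minus_def
  by (auto dest: order.strict_trans less_le_trans simp: not_le[symmetric])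

text \<open>With r = \<chi> the two preceding equivalences would give \<chi> < \<chi>.\<close>

lemma Delta_not_Lambda:
  assumes "\<chi> \<in> Delta_plus n p l \<or> \<chi> \<in> Delta_minus n p l"
  shows "\<chi> \<notin> Lambda_set n p"
  using assms Delta_plus_iff Delta_minus_iff unfolding Delta_plus_def Delta_minus_def by blast

lemma vec_dim_nat:
  assumes U: "vec_subspace d (U :: 'k :: field vec set)"
  obtains u where "vec_dim d U = int u" "u \<le> d" "U \<subset> carrier_vec d \<longleftrightarrow> u < d"
proof -
  obtain u where u: "vec_dim d U = int u" "u \<le> d"
    using vec_dim_bounds[OF U] by (metis nonneg_int_cases of_nat_le_iff)
  moreover have "U \<subset> carrier_vec d \<longleftrightarrow> u < d"
    using vec_dim_eq_full[OF U] U u by (auto simp: vec_subspace_iff psubset_eq)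
  ultimately show ?thesis using that by blast
qed

text \<open>\<open>P\<close> and \<open>Q\<close> stand for the comparisons with \<open>l\<close>,
  so that one proof serves upper and lower stability.\<close>

lemma numerically_stable_iff_ratios:
  fixes K L M :: "'k :: field mat"
  assumes P: "\<And>u v. u \<le> n \<Longrightarrow> v \<le> n + p \<Longrightarrow> 0 < u \<or> 0 < v \<Longrightarrow>
      P (ratio (int v) (int u)) \<longleftrightarrow> a * u < b * v"
    and Q: "\<And>u v. u \<le> n \<Longrightarrow> v \<le> n + p \<Longrightarrow> 0 < u \<or> 0 < v \<Longrightarrow>
      Q (ratio (int v) (int u)) \<longleftrightarrow> b * v < a * u"
  shows "(\<forall>U V. vec_subspace n U \<and> vec_subspace (n + p) V \<longrightarrow>
        ((vec_dim n U > 0 \<or> vec_dim (n + p) V > 0) \<and> maps_into K L U V \<longrightarrow>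
           P (ratio (vec_dim (n + p) V) (vec_dim n U))) \<and>
        ((U \<subset> carrier_vec n \<or> V \<subset> carrier_vec (n + p)) \<and> maps_into K L U V \<and>
         (\<lambda>x. M *\<^sub>v x) ` carrier_vec (p + m) \<subseteq> V \<longrightarrow>
           Q (ratio (int (n + p) - vec_dim (n + p) V) (int n - vec_dim n U)))) \<longleftrightarrow>
    numerically_stable n m p a b (K, L, M)"
proof -
  have "((vec_dim n U > 0 \<or> vec_dim (n + p) V > 0) \<longrightarrow>
       (P (ratio (vec_dim (n + p) V) (vec_dim n U)) \<longleftrightarrow>
        int a * vec_dim n U < int b * vec_dim (n + p) V)) \<and>
     ((U \<subset> carrier_vec n \<or> V \<subset> carrier_vec (n + p)) \<longrightarrow>
       (Q (ratio (int (n + p) - vec_dim (n + p) V) (int n - vec_dim n U)) \<longleftrightarrow>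
        int b * (int (n + p) - vec_dim (n + p) V) < int a * (int n - vec_dim n U)))"
    if sub: "vec_subspace n U" "vec_subspace (n + p) V" for U V :: "'k vec set"
  proof -
    obtain u where u: "vec_dim n U = int u" "u \<le> n" "U \<subset> carrier_vec n \<longleftrightarrow> u < n"
      using vec_dim_nat[OF sub(1)] .
    obtain v where v: "vec_dim (n + p) V = int v" "v \<le> n + p" "V \<subset> carrier_vec (n + p) \<longleftrightarrow> v < n + p"
      using vec_dim_nat[OF sub(2)] .
    have diff: "int n - int u = int (n - u)" "int (n + p) - int v = int (n + p - v)"
      using u v by auto
    have "Q (ratio (int (n + p - v)) (int (n - u))) \<longleftrightarrow> b * (n + p - v) < a * (n - u)"
      if "u < n \<or> v < n + p"
      by (rule Q) (use that in auto)
    with P[OF u(2) v(2)] show ?thesis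
      unfolding u v diff of_nat_mult[symmetric] of_nat_less_iff of_nat_0_less_iff by blast
  qed
  then show ?thesis unfolding numerically_stable.simps by blast
qed

lemma numerically_stable_iff_upperstable:
  assumes chi: "\<chi> = ratio (int a) (int b)" "generic_slope n p a b" and D: "\<chi> \<in> Delta_plus n p l"
  shows "upperstable n m p l S \<longleftrightarrow> numerically_stable n m p a b S"
proof -
  obtain K L M where S: "S = (K, L, M)" by (cases S)
  have pos: "0 < a" "0 < b" using chi(2) by (auto simp: generic_slope_def)
  show ?thesis
    unfolding S upperstable.simps
    by (rule numerically_stable_iff_ratios)
      (simp_all only: Delta_plus_iff[OF D ratio_in_Lambda_set] chi(1) ratio_less_ratio[OF pos])
qed

lemma numerically_stable_iff_lowerstable:
  assumes chi: "\<chi> = ratio (int a) (int b)" "generic_slope n p a b" and D: "\<chi> \<in> Delta_minus n p l"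
  shows "lowerstable n m p l S \<longleftrightarrow> numerically_stable n m p a b S"
proof -
  obtain K L M where S: "S = (K, L, M)" by (cases S)
  have pos: "0 < a" "0 < b" using chi(2) by (auto simp: generic_slope_def)
  show ?thesis
    unfolding S lowerstable.simps
    by (rule numerically_stable_iff_ratios)
      (simp_all only: Delta_minus_iff[OF D ratio_in_Lambda_set] chi(1) ratio_less_ratio[OF pos])
qed

section \<open>Homomorphisms between numerically stable systems\<close>

lemma mult_vec_assoc:
  "A \<in> carrier_mat r s \<Longrightarrow> B \<in> carrier_mat s c \<Longrightarrow> x \<in> carrier_vec c \<Longrightarrow> A *\<^sub>v (B *\<^sub>v x) = A * B *\<^sub>v x"
  by (rule assoc_mult_mat_vec[symmetric])

text \<open>In the language of quivers, \<open>(H0, H1)\<close> is a morphism of Kronecker modules: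
  its kernel is a submodule of the source, its image a submodule of the target.\<close>

lemma intertwiner_maps_into:
  fixes K L K' L' :: "'k :: field mat"
  assumes K: "K \<in> carrier_mat e d" and L: "L \<in> carrier_mat e d"
    and K': "K' \<in> carrier_mat e d" and L': "L' \<in> carrier_mat e d"
    and H0: "H0 \<in> carrier_mat d d" and H1: "H1 \<in> carrier_mat e e"
    and HK: "H1 * K = K' * H0" and HL: "H1 * L = L' * H0"
  shows "maps_into K L (kernel_of H0) (kernel_of H1)"
    and "maps_into K' L' (colspace H0) (colspace H1)"
proof -
  have ker: "A *\<^sub>v u \<in> kernel_of H1"
    if A: "A \<in> carrier_mat e d" and A': "A' \<in> carrier_mat e d" and HA: "H1 * A = A' * H0"
      and u: "u \<in> kernel_of H0" for A A' u
  proof -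
    have u: "u \<in> carrier_vec d" "H0 *\<^sub>v u = 0\<^sub>v d" using u by (auto simp: kernel_of_iff[OF H0])
    have "H1 *\<^sub>v (A *\<^sub>v u) = A' *\<^sub>v (H0 *\<^sub>v u)"
      unfolding mult_vec_assoc[OF H1 A u(1)] mult_vec_assoc[OF A' H0 u(1)] HA ..
    also have "\<dots> = 0\<^sub>v e" using u(2) A' by auto
    finally show ?thesis using A u by (simp add: kernel_of_iff[OF H1])
  qed
  show "maps_into K L (kernel_of H0) (kernel_of H1)"
    by (rule maps_intoI[OF vec_subspace_kernel_of[OF H1]])
      (use ker[OF K K' HK] ker[OF L L' HL] in auto)
  have im: "A' *\<^sub>v u \<in> colspace H1"
    if A: "A \<in> carrier_mat e d" and A': "A' \<in> carrier_mat e d" and HA: "H1 * A = A' * H0"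
      and u: "u \<in> colspace H0" for A A' u
  proof -
    obtain x where x: "x \<in> carrier_vec d" "u = H0 *\<^sub>v x" using u by (rule colspaceE[OF _ H0])
    have "A' *\<^sub>v u = H1 *\<^sub>v (A *\<^sub>v x)"
      unfolding x(2) mult_vec_assoc[OF H1 A x(1)] mult_vec_assoc[OF A' H0 x(1)] HA ..
    then show ?thesis using colspaceI[OF H1, of "A *\<^sub>v x"] A x(1) by simp
  qed
  show "maps_into K' L' (colspace H0) (colspace H1)"
    by (rule maps_intoI[OF vec_subspace_colspace[OF H1]])
      (use im[OF K K' HK] im[OF L L' HL] in auto)
qed

lemma kernel_full_imp_zero:
  assumes H: "(H :: 'k :: field mat) \<in> carrier_mat c d" and "kernel_of H = carrier_vec d"
  shows "H = 0\<^sub>m c d"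
proof (rule eq_matI)
  fix i j assume "i < dim_row (0\<^sub>m c d :: 'k mat)" "j < dim_col (0\<^sub>m c d :: 'k mat)"
  then have ij: "i < c" "j < d" by auto
  have "unit_vec d j \<in> kernel_of H" using assms(2) by simp
  then have "H *\<^sub>v unit_vec d j = 0\<^sub>v c" by (simp add: kernel_of_iff[OF H])
  then have "(H *\<^sub>v unit_vec d j) $ i = 0" using ij by simp
  then show "H $$ (i, j) = 0\<^sub>m c d $$ (i, j)" using mult_unit_vec_index[OF H ij] ij by simp
qed (use H in auto)

text \<open>If the kernel were proper, the codimension inequality for it, which contains the image
  of \<open>M\<close>, would give b rk H1 < a rk H0, whereas the dimension inequality for the image,
  in the target, gives a rk H0 < b rk H1.\<close>

lemma hom_eq_zero:
  fixes K L M K' L' M' :: "'k :: field mat"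
  assumes x: "(K, L, M) \<in> lomadze_space n m p" and y: "(K', L', M') \<in> lomadze_space n m p"
    and sx: "numerically_stable n m p a b (K, L, M)" and sy: "numerically_stable n m p a b (K', L', M')"
    and H0: "H0 \<in> carrier_mat n n" and H1: "H1 \<in> carrier_mat (n + p) (n + p)"
    and HK: "H1 * K = K' * H0" and HL: "H1 * L = L' * H0" and HM: "H1 * M = 0\<^sub>m (n + p) (p + m)"
  shows "H0 = 0\<^sub>m n n" "H1 = 0\<^sub>m (n + p) (n + p)"
proof -
  have M: "M \<in> carrier_mat (n + p) (p + m)" using x by (auto simp: lomadze_space_iff)
  have into: "maps_into K L (kernel_of H0) (kernel_of H1)"
    "maps_into K' L' (colspace H0) (colspace H1)"
    by (rule intertwiner_maps_into[OF _ _ _ _ H0 H1 HK HL], use x y in \<open>auto simp: lomadze_space_iff\<close>)+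
  note sub = vec_subspace_kernel_of[OF H0] vec_subspace_kernel_of[OF H1]
    vec_subspace_colspace[OF H0] vec_subspace_colspace[OF H1]
  have im: "(\<lambda>x. M *\<^sub>v x) ` carrier_vec (p + m) \<subseteq> kernel_of H1"
  proof
    fix z assume "z \<in> (\<lambda>x. M *\<^sub>v x) ` carrier_vec (p + m)"
    then obtain x where x: "x \<in> carrier_vec (p + m)" "z = M *\<^sub>v x" by auto
    have "H1 *\<^sub>v z = 0\<^sub>m (n + p) (p + m) *\<^sub>v x"
      unfolding x(2) mult_vec_assoc[OF H1 M x(1)] HM ..
    also have "\<dots> = 0\<^sub>v (n + p)" using x(1) by (intro eq_vecI) auto
    finally show "z \<in> kernel_of H1" using M x by (simp add: kernel_of_iff[OF H1])
  qed
  note rn = rank_nullity_mat[OF H0] rank_nullity_mat[OF H1]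
  note pos = vec_dim_bounds(1)[OF sub(3)] vec_dim_bounds(1)[OF sub(4)]
  have full: "\<not> (kernel_of H0 \<subset> carrier_vec n \<or> kernel_of H1 \<subset> carrier_vec (n + p))"
  proof
    assume "kernel_of H0 \<subset> carrier_vec n \<or> kernel_of H1 \<subset> carrier_vec (n + p)"
    from numerically_stableD(2)[OF sx sub(1,2) into(1) this im]
    have "int b * vec_dim (n + p) (colspace H1) < int a * vec_dim n (colspace H0)"
      using rn by (metis add_diff_cancel_left')
    moreover from this have "0 < vec_dim n (colspace H0) \<or> 0 < vec_dim (n + p) (colspace H1)"
      using pos by (metis less_irrefl linorder_not_less mult_zero_right nle_le)
    from numerically_stableD(1)[OF sy sub(3,4) into(2) this]
    have "int a * vec_dim n (colspace H0) < int b * vec_dim (n + p) (colspace H1)" .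
    ultimately show False by simp
  qed
  then have "kernel_of H0 = carrier_vec n" "kernel_of H1 = carrier_vec (n + p)"
    using sub(1,2) by (auto simp: vec_subspace_iff)
  then show "H0 = 0\<^sub>m n n" "H1 = 0\<^sub>m (n + p) (n + p)"
    using kernel_full_imp_zero H0 H1 by blast+
qed

text \<open>The argument dual to that for \<open>hom_eq_zero\<close>: a nonzero kernel would give a
  dim ker H0 < b dim ker H1 in the source, and the image, which contains that of \<open>M'\<close>,
  gives the opposite, because for square matrices the codimension of the image is the dimension of
  the kernel.\<close>

lemma hom_invertible:
  fixes K L M K' L' M' :: "'k :: field mat"
  assumes x: "(K, L, M) \<in> lomadze_space n m p" and y: "(K', L', M') \<in> lomadze_space n m p"
    and sx: "numerically_stable n m p a b (K, L, M)" and sy: "numerically_stable n m p a b (K', L', M')"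
    and H0: "H0 \<in> carrier_mat n n" and H1: "H1 \<in> carrier_mat (n + p) (n + p)"
    and HK: "H1 * K = K' * H0" and HL: "H1 * L = L' * H0" and HM: "H1 * M = M'"
  shows "Determinant.det H0 \<noteq> 0" "Determinant.det H1 \<noteq> 0"
proof -
  have M: "M \<in> carrier_mat (n + p) (p + m)" using x by (auto simp: lomadze_space_iff)
  have into: "maps_into K L (kernel_of H0) (kernel_of H1)"
    "maps_into K' L' (colspace H0) (colspace H1)"
    by (rule intertwiner_maps_into[OF _ _ _ _ H0 H1 HK HL], use x y in \<open>auto simp: lomadze_space_iff\<close>)+
  note sub = vec_subspace_kernel_of[OF H0] vec_subspace_kernel_of[OF H1]
    vec_subspace_colspace[OF H0] vec_subspace_colspace[OF H1]
  have im: "(\<lambda>x. M' *\<^sub>v x) ` carrier_vec (p + m) \<subseteq> colspace H1"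
  proof
    fix z assume "z \<in> (\<lambda>x. M' *\<^sub>v x) ` carrier_vec (p + m)"
    then obtain x where x: "x \<in> carrier_vec (p + m)" "z = M' *\<^sub>v x" by auto
    have "z = H1 *\<^sub>v (M *\<^sub>v x)" unfolding x(2) mult_vec_assoc[OF H1 M x(1)] HM ..
    then show "z \<in> colspace H1" using colspaceI[OF H1, of "M *\<^sub>v x"] M x(1) by simp
  qed
  note rn = rank_nullity_mat[OF H0] rank_nullity_mat[OF H1]
  note pos = vec_dim_bounds(1)[OF sub(1)] vec_dim_bounds(1)[OF sub(2)]
  have "\<not> (0 < vec_dim n (kernel_of H0) \<or> 0 < vec_dim (n + p) (kernel_of H1))"
  proof
    assume k: "0 < vec_dim n (kernel_of H0) \<or> 0 < vec_dim (n + p) (kernel_of H1)"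
    from numerically_stableD(1)[OF sx sub(1,2) into(1) this]
    have 1: "int a * vec_dim n (kernel_of H0) < int b * vec_dim (n + p) (kernel_of H1)" .
    have "vec_dim n (colspace H0) \<noteq> int n \<or> vec_dim (n + p) (colspace H1) \<noteq> int (n + p)"
      using k rn by linarith
    then have "colspace H0 \<subset> carrier_vec n \<or> colspace H1 \<subset> carrier_vec (n + p)"
      using vec_dim_eq_full[OF sub(3)] vec_dim_eq_full[OF sub(4)]
        colspace_carrier[OF H0] colspace_carrier[OF H1] by blast
    from numerically_stableD(2)[OF sy sub(3,4) into(2) this im]
    have "int b * vec_dim (n + p) (kernel_of H1) < int a * vec_dim n (kernel_of H0)"
      using rn by (metis add_diff_cancel_right')
    with 1 show False by simp
  qed
  then have "vec_dim n (kernel_of H0) = 0" "vec_dim (n + p) (kernel_of H1) = 0" using pos by auto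
  then have "kernel_of H0 = {0\<^sub>v n}" "kernel_of H1 = {0\<^sub>v (n + p)}"
    using vec_dim_eq_0[OF sub(1)] vec_dim_eq_0[OF sub(2)] by auto
  then have "inj_mat H0" "inj_mat H1"
    using kernel_of_iff[OF H0] kernel_of_iff[OF H1] by (auto intro!: inj_matI[OF H0] inj_matI[OF H1])
  then show "Determinant.det H0 \<noteq> 0" "Determinant.det H1 \<noteq> 0"
    using inj_mat_iff_det[OF H0] inj_mat_iff_det[OF H1] by auto
qed

section \<open>Rational solution of the intertwiner equations\<close>

lemma col_index: "A \<in> carrier_mat r c \<Longrightarrow> i < r \<Longrightarrow> j < c \<Longrightarrow> col A j $ i = A $$ (i, j)"
  by simp

text \<open>An overdetermined linear system with polynomial coefficients that is injective at
  \<open>y0\<close>. A constant matrix reduces it to a square system still invertible at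
  \<open>y0\<close>; \<delta> is the determinant and the \<gamma> i are Cramer's numerators.
  Solvability is not claimed: whatever solution exists at \<open>y\<close> is recovered up to the
  factor \<delta>.\<close>

lemma cramer_family:
  fixes c :: "'j \<Rightarrow> 'i \<Rightarrow> 'x \<Rightarrow> 'k :: field"
  assumes I: "finite I" and J: "finite J"
    and c: "\<And>j i. j \<in> J \<Longrightarrow> i \<in> I \<Longrightarrow> c j i \<in> polyfuns C"
    and r: "\<And>j. j \<in> J \<Longrightarrow> r j \<in> polyfuns C"
    and inj: "\<And>w i. (\<And>j. j \<in> J \<Longrightarrow> (\<Sum>i\<in>I. c j i y0 * w i) = 0) \<Longrightarrow> i \<in> I \<Longrightarrow> w i = 0"
  shows "\<exists>\<delta> \<gamma>. \<delta> \<in> polyfuns C \<and> (\<forall>i\<in>I. \<gamma> i \<in> polyfuns C) \<and> \<delta> y0 \<noteq> 0 \<and>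
    (\<forall>y w. (\<forall>j\<in>J. (\<Sum>i\<in>I. c j i y * w i) = r j y) \<longrightarrow> (\<forall>i\<in>I. \<gamma> i y = \<delta> y * w i))"
proof -
  define D where "D = card I"
  define R where "R = card J"
  obtain eI where eI: "bij_betw eI {0..<D} I" using ex_bij_betw_nat_finite[OF I] D_def by auto
  obtain eJ where eJ: "bij_betw eJ {0..<R} J" using ex_bij_betw_nat_finite[OF J] R_def by auto
  have eI_mem: "eI k \<in> I" if "k < D" for k using eI that by (auto simp: bij_betw_def)
  have eJ_mem: "eJ q \<in> J" if "q < R" for q using eJ that by (auto simp: bij_betw_def)
  have J_cases: "\<exists>q<R. j = eJ q" if "j \<in> J" for j using eJ that by (force simp: bij_betw_def)
  have I_cases: "\<exists>k<D. i = eI k" if "i \<in> I" for i using eI that by (force simp: bij_betw_def)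
  define \<Psi> where "\<Psi> y = mat R D (\<lambda>(q, k). c (eJ q) (eI k) y)" for y
  have \<Psi>: "\<Psi> y \<in> carrier_mat R D" for y by (simp add: \<Psi>_def)
  have poly\<Psi>: "poly_mat C R D \<Psi>"
    by (rule poly_matI[OF \<Psi>]) (simp add: \<Psi>_def c eI_mem eJ_mem)
  have \<Psi>_mult: "(\<Psi> y *\<^sub>v v) $ q = (\<Sum>i\<in>I. c (eJ q) i y * v $ inv_into {0..<D} eI i)"
    if v: "v \<in> carrier_vec D" and q: "q < R" for y v q
  proof -
    have "(\<Psi> y *\<^sub>v v) $ q = (\<Sum>k=0..<D. c (eJ q) (eI k) y * v $ k)"
      using v q by (simp add: \<Psi>_def scalar_prod_def)
    also have "\<dots> = (\<Sum>k=0..<D. (\<lambda>i. c (eJ q) i y * v $ inv_into {0..<D} eI i) (eI k))"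
      by (rule sum.cong) (use eI in \<open>auto simp: bij_betw_def\<close>)
    also have "\<dots> = (\<Sum>i\<in>I. c (eJ q) i y * v $ inv_into {0..<D} eI i)"
      by (rule sum.reindex_bij_betw[OF eI])
    finally show ?thesis .
  qed
  have inj\<Psi>: "v = 0\<^sub>v D" if v: "v \<in> carrier_vec D" and 0: "\<Psi> y0 *\<^sub>v v = 0\<^sub>v R" for v
  proof (rule eq_vecI)
    fix k assume "k < dim_vec (0\<^sub>v D :: 'k vec)"
    then have k: "k < D" by simp
    have "v $ inv_into {0..<D} eI (eI k) = 0"
    proof (rule inj[where w = "\<lambda>i. v $ inv_into {0..<D} eI i"])
      fix j assume "j \<in> J"
      then obtain q where q: "q < R" "j = eJ q" using J_cases by blast
      then show "(\<Sum>i\<in>I. c j i y0 * v $ inv_into {0..<D} eI i) = 0"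
        using \<Psi>_mult[OF v q(1), of y0] 0 by simp
    qed (rule eI_mem[OF k])
    then show "v $ k = 0\<^sub>v D $ k" using eI k by (simp add: bij_betw_def)
  qed (use v in simp)
  have W: "(\<Psi> y0)\<^sup>T \<in> carrier_mat D R" using \<Psi> by simp
  have "\<exists>z. (\<forall>j. z j \<in> carrier_vec R) \<and>
      inj_mat (colmat D D (\<lambda>j. if j < 0 then 0\<^sub>v D else (\<Psi> y0)\<^sup>T *\<^sub>v z j))"
    by (rule extend_inj_colmat[OF inj_colmat_0 _ W]) (use inj\<Psi> in auto)
  then obtain z where z: "\<And>j. z j \<in> carrier_vec R" "inj_mat (colmat D D (\<lambda>j. (\<Psi> y0)\<^sup>T *\<^sub>v z j))" by auto
  \<comment> \<open>The rows of \<open>\<Psi> y0\<close> span, so \<open>D\<close> combinations of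
    them form a basis. \<open>Z\<close> records these combinations at \<open>y0\<close> and is used
    unchanged at every other \<open>y\<close>.\<close>
  define Z where "Z = colmat R D z"
  have Z: "Z \<in> carrier_mat R D" by (simp add: Z_def)
  have WZ: "(\<Psi> y0)\<^sup>T * Z = colmat D D (\<lambda>j. (\<Psi> y0)\<^sup>T *\<^sub>v z j)"
    unfolding Z_def by (rule mult_colmat[OF W z(1)])
  define N where "N y = Z\<^sup>T * \<Psi> y" for y
  have ZT: "Z\<^sup>T \<in> carrier_mat D R" using Z by simp
  have N: "N y \<in> carrier_mat D D" for y unfolding N_def by (rule mult_carrier_mat[OF ZT \<Psi>])
  have polyN: "poly_mat C D D N"
    unfolding N_def by (rule poly_mat_mult[OF poly_mat_const[OF ZT] poly\<Psi>])
  have NT: "(N y0)\<^sup>T = (\<Psi> y0)\<^sup>T * Z"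
    unfolding N_def using transpose_mult[OF ZT \<Psi>] by simp
  have "Determinant.det ((\<Psi> y0)\<^sup>T * Z) \<noteq> 0"
    using z(2) unfolding WZ[symmetric] by (subst (asm) inj_mat_iff_det[OF mult_carrier_mat[OF W Z]])
  then have nz: "Determinant.det (N y0) \<noteq> 0" unfolding NT[symmetric] det_transpose[OF N] .
  define \<rho> where "\<rho> y = mat R 1 (\<lambda>(q, _). r (eJ q) y)" for y
  have "poly_mat C R 1 \<rho>" by (rule poly_matI) (simp_all add: \<rho>_def r eJ_mem)
  then have poly\<rho>: "poly_mat C D 1 (\<lambda>y. Z\<^sup>T * \<rho> y)" by (rule poly_mat_mult[OF poly_mat_const[OF ZT]])
  define \<gamma> where "\<gamma> i y = Determinant.det (replace_col (N y) (col (Z\<^sup>T * \<rho> y) 0) (inv_into {0..<D} eI i))" for i y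
  have "\<gamma> i \<in> polyfuns C" for i
    unfolding \<gamma>_def
  proof (rule polyfuns_det[where r = D], rule poly_matI)
    show "replace_col (N y) (col (Z\<^sup>T * \<rho> y) 0) (inv_into {0..<D} eI i) \<in> carrier_mat D D" for y
      using N[of y] by (auto simp: replace_col_def)
    fix k l assume kl: "k < D" "l < D"
    have "replace_col (N y) (col (Z\<^sup>T * \<rho> y) 0) (inv_into {0..<D} eI i) $$ (k, l) =
        (if l = inv_into {0..<D} eI i then (Z\<^sup>T * \<rho> y) $$ (k, 0) else N y $$ (k, l))" for y
      using kl N[of y] col_index[OF poly_mat_carrier[OF poly\<rho>, of y] kl(1), of 0]
      by (auto simp: replace_col_def simp del: index_mult_mat(1))
    then show "(\<lambda>y. replace_col (N y) (col (Z\<^sup>T * \<rho> y) 0) (inv_into {0..<D} eI i) $$ (k, l)) \<in> polyfuns C"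
      using poly_mat_entry[OF poly\<rho> kl(1), of 0] poly_mat_entry[OF polyN kl]
      by (cases "l = inv_into {0..<D} eI i") simp_all
  qed
  moreover have "\<gamma> i y = Determinant.det (N y) * w i"
    if sol: "\<And>j. j \<in> J \<Longrightarrow> (\<Sum>i\<in>I. c j i y * w i) = r j y" and i: "i \<in> I" for y w i
  proof -
    define v where "v = vec D (\<lambda>k. w (eI k))"
    have v: "v \<in> carrier_vec D" by (simp add: v_def)
    have inv: "v $ inv_into {0..<D} eI i = w i" "inv_into {0..<D} eI i < D" if "i \<in> I" for i
      using I_cases[OF that] eI by (auto simp: v_def bij_betw_def)
    have "\<Psi> y *\<^sub>v v = col (\<rho> y) 0"
    proof (rule eq_vecI)
      fix q assume "q < dim_vec (col (\<rho> y) 0)"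
      then have q: "q < R" by (simp add: \<rho>_def)
      have "(\<Psi> y *\<^sub>v v) $ q = (\<Sum>i\<in>I. c (eJ q) i y * w i)"
        unfolding \<Psi>_mult[OF v q] by (rule sum.cong) (simp_all add: inv)
      then show "(\<Psi> y *\<^sub>v v) $ q = col (\<rho> y) 0 $ q" using sol[OF eJ_mem[OF q]] q by (simp add: \<rho>_def)
    qed (simp add: \<rho>_def \<Psi>_def)
    then have "N y *\<^sub>v v = Z\<^sup>T *\<^sub>v col (\<rho> y) 0"
      unfolding N_def assoc_mult_mat_vec[OF ZT \<Psi> v] by simp
    also have "\<dots> = col (Z\<^sup>T * \<rho> y) 0"
      using ZT by (intro eq_vecI) (auto simp: \<rho>_def)
    finally have "\<gamma> i y = Determinant.det (replace_col (N y) (N y *\<^sub>v v) (inv_into {0..<D} eI i))"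
      by (simp add: \<gamma>_def)
    then show ?thesis
      unfolding cramer_lemma_mat[OF N v inv(2)[OF i]] inv(1)[OF i] by simp
  qed
  ultimately show ?thesis
    using nz polyfuns_det[OF polyN]
    by (intro exI[of _ "\<lambda>y. Determinant.det (N y)"] exI[of _ \<gamma>]) blast
qed

text \<open>The unknowns of the intertwiner equations are indexed by the entries of the first and the
  second component; the coefficient function picks out a column of the former and a row of the
  latter.\<close>

definition intertwiner_coeff :: "(nat \<Rightarrow> 'k :: field) \<Rightarrow> nat \<Rightarrow> (nat \<Rightarrow> 'k) \<Rightarrow> nat \<Rightarrow>
    nat \<times> nat + nat \<times> nat \<Rightarrow> 'k" where
  "intertwiner_coeff \<alpha> l \<beta> i idx =
     (case idx of Inl (k, l') \<Rightarrow> if l' = l then \<alpha> k else 0 | Inr (i', k) \<Rightarrow> if i' = i then \<beta> k else 0)"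

lemma sum_intertwiner_coeff:
  assumes "l < n" "i < e"
  shows "(\<Sum>idx \<in> ({..<n} \<times> {..<n}) <+> ({..<e} \<times> {..<e}). intertwiner_coeff \<alpha> l \<beta> i idx * w idx) =
    (\<Sum>k<n. \<alpha> k * w (Inl (k, l))) + (\<Sum>k<e. \<beta> k * w (Inr (i, k)))"
proof -
  have "(\<Sum>x \<in> {..<n} \<times> {..<n}. intertwiner_coeff \<alpha> l \<beta> i (Inl x) * w (Inl x)) =
      (\<Sum>k<n. \<Sum>l'<n. if l' = l then \<alpha> k * w (Inl (k, l)) else 0)"
    unfolding sum.cartesian_product by (intro sum.cong) (auto simp: intertwiner_coeff_def)
  moreover have "(\<Sum>x \<in> {..<e} \<times> {..<e}. intertwiner_coeff \<alpha> l \<beta> i (Inr x) * w (Inr x)) =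
      (\<Sum>i'<e. \<Sum>k<e. if i' = i then \<beta> k * w (Inr (i, k)) else 0)"
    unfolding sum.cartesian_product by (intro sum.cong) (auto simp: intertwiner_coeff_def)
  moreover have "\<dots> = (\<Sum>k<e. \<beta> k * w (Inr (i, k)))"
    by (subst sum.swap) (use assms in simp)
  ultimately show ?thesis using assms by (simp add: sum.Plus)
qed

text \<open>A separate case: the equations for \<open>M\<close> involve no entry of the first
  component, and their dummy column 0 need not satisfy 0 < n.\<close>

lemma sum_intertwiner_coeff_right:
  assumes "i < e"
  shows "(\<Sum>idx \<in> ({..<n} \<times> {..<n}) <+> ({..<e} \<times> {..<e}). intertwiner_coeff (\<lambda>_. 0) 0 \<beta> i idx * w idx) =
    (\<Sum>k<e. \<beta> k * w (Inr (i, k)))"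
proof -
  have "(\<Sum>x \<in> {..<n} \<times> {..<n}. intertwiner_coeff (\<lambda>_. 0) 0 \<beta> i (Inl x) * w (Inl x)) = 0"
    by (rule sum.neutral) (auto simp: intertwiner_coeff_def)
  moreover have "(\<Sum>x \<in> {..<e} \<times> {..<e}. intertwiner_coeff (\<lambda>_. 0) 0 \<beta> i (Inr x) * w (Inr x)) =
      (\<Sum>i'<e. \<Sum>k<e. if i' = i then \<beta> k * w (Inr (i, k)) else 0)"
    unfolding sum.cartesian_product by (intro sum.cong) (auto simp: intertwiner_coeff_def)
  moreover have "\<dots> = (\<Sum>k<e. \<beta> k * w (Inr (i, k)))"
    by (subst sum.swap) (use assms in simp)
  ultimately show ?thesis using assms by (simp add: sum.Plus)
qed

lemma polyfuns_lomadze_coords: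
  "i < n + p \<Longrightarrow> j < n \<Longrightarrow> (\<lambda>y. fst y $$ (i, j)) \<in> polyfuns (lomadze_coords n m p)"
  "i < n + p \<Longrightarrow> j < n \<Longrightarrow> (\<lambda>y. fst (snd y) $$ (i, j)) \<in> polyfuns (lomadze_coords n m p)"
  "i < n + p \<Longrightarrow> j < p + m \<Longrightarrow> (\<lambda>y. snd (snd y) $$ (i, j)) \<in> polyfuns (lomadze_coords n m p)"
  unfolding lomadze_coords_def by (auto intro!: polyfuns.coord simp: case_prod_unfold)

lemma polyfuns_if:
  "(Q \<Longrightarrow> f \<in> polyfuns C) \<Longrightarrow> (\<not> Q \<Longrightarrow> g \<in> polyfuns C) \<Longrightarrow>
    (\<lambda>x. if Q then f x else g x) \<in> polyfuns C"
  by (cases Q) auto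

lemma mat_mult_index:
  "A \<in> carrier_mat r s \<Longrightarrow> B \<in> carrier_mat s c \<Longrightarrow> i < r \<Longrightarrow> j < c \<Longrightarrow>
    (A * B) $$ (i, j) = (\<Sum>k<s. A $$ (i, k) * B $$ (k, j))"
  by (simp add: scalar_prod_def atLeast0LessThan)

text \<open>With the source fixed, the intertwiner equations are linear in \<open>H0\<close>,
  \<open>H1\<close> with coefficients polynomial in the target. Only the equation for
  \<open>M\<close> is inhomogeneous, and the homogeneous system at \<open>(K0, L0, M0)\<close> has
  no nonzero solution by \<open>hom_eq_zero\<close>. That point need not lie in the orbit of the
  source, which is what the closedness proof requires.\<close>

lemma rational_intertwiner:
  fixes K L M K0 L0 M0 :: "'k :: field mat"
  assumes x: "(K, L, M) \<in> lomadze_space n m p" and y: "(K0, L0, M0) \<in> lomadze_space n m p"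
    and sx: "numerically_stable n m p a b (K, L, M)" and sy: "numerically_stable n m p a b (K0, L0, M0)"
  shows "\<exists>\<delta> \<Gamma>0 \<Gamma>1. \<delta> \<in> polyfuns (lomadze_coords n m p) \<and>
    poly_mat (lomadze_coords n m p) n n \<Gamma>0 \<and> poly_mat (lomadze_coords n m p) (n + p) (n + p) \<Gamma>1 \<and>
    \<delta> (K0, L0, M0) \<noteq> 0 \<and>
    (\<forall>K' L' M' H0 H1. (K', L', M') \<in> lomadze_space n m p \<longrightarrow>
       H0 \<in> carrier_mat n n \<longrightarrow> H1 \<in> carrier_mat (n + p) (n + p) \<longrightarrow>
       H1 * K = K' * H0 \<longrightarrow> H1 * L = L' * H0 \<longrightarrow> H1 * M = M' \<longrightarrow>
       \<Gamma>0 (K', L', M') = \<delta> (K', L', M') \<cdot>\<^sub>m H0 \<and> \<Gamma>1 (K', L', M') = \<delta> (K', L', M') \<cdot>\<^sub>m H1)"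
proof -
  let ?e = "n + p" and ?C = "lomadze_coords n m p :: ('k lomadze \<Rightarrow> 'k) set"
  have K: "K \<in> carrier_mat ?e n" and L: "L \<in> carrier_mat ?e n" and M: "M \<in> carrier_mat ?e (p + m)"
    using x by (auto simp: lomadze_space_iff)
  define I where "I = ({..<n} \<times> {..<n}) <+> ({..<?e} \<times> {..<?e})"
  define J where "J = ({..<?e} \<times> {..<n}) <+> (({..<?e} \<times> {..<n}) <+> ({..<?e} \<times> {..<p + m}))"
  define c where "c j idx y = (case j of
      Inl (i, l) \<Rightarrow> intertwiner_coeff (\<lambda>k. - (fst y $$ (i, k))) l (\<lambda>k. K $$ (k, l)) i idx
    | Inr (Inl (i, l)) \<Rightarrow> intertwiner_coeff (\<lambda>k. - (fst (snd y) $$ (i, k))) l (\<lambda>k. L $$ (k, l)) i idx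
    | Inr (Inr (i, l)) \<Rightarrow> intertwiner_coeff (\<lambda>_. 0) 0 (\<lambda>k. M $$ (k, l)) i idx)"
    for j :: "nat \<times> nat + nat \<times> nat + nat \<times> nat" and idx :: "nat \<times> nat + nat \<times> nat" and y :: "'k lomadze"
  define r where "r j y = (case j of Inl _ \<Rightarrow> 0 | Inr (Inl _) \<Rightarrow> 0 | Inr (Inr (i, l)) \<Rightarrow> snd (snd y) $$ (i, l))"
    for j :: "nat \<times> nat + nat \<times> nat + nat \<times> nat" and y :: "'k lomadze"
  have sys1: "(\<Sum>idx\<in>I. c (Inl (i, l)) idx y * w idx) =
      (\<Sum>k<?e. K $$ (k, l) * w (Inr (i, k))) - (\<Sum>k<n. fst y $$ (i, k) * w (Inl (k, l)))"
    if "i < ?e" "l < n" for i l y w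
    unfolding c_def I_def sum.case prod.case sum_intertwiner_coeff[OF that(2,1)]
    by (simp add: sum_negf)
  have sys2: "(\<Sum>idx\<in>I. c (Inr (Inl (i, l))) idx y * w idx) =
      (\<Sum>k<?e. L $$ (k, l) * w (Inr (i, k))) - (\<Sum>k<n. fst (snd y) $$ (i, k) * w (Inl (k, l)))"
    if "i < ?e" "l < n" for i l y w
    unfolding c_def I_def sum.case prod.case sum_intertwiner_coeff[OF that(2,1)]
    by (simp add: sum_negf)
  have sys3: "(\<Sum>idx\<in>I. c (Inr (Inr (i, l))) idx y * w idx) = (\<Sum>k<?e. M $$ (k, l) * w (Inr (i, k)))"
    if "i < ?e" for i l y w
    unfolding c_def I_def sum.case prod.case by (rule sum_intertwiner_coeff_right[OF that])
  have "\<exists>\<delta> \<gamma>. \<delta> \<in> polyfuns ?C \<and> (\<forall>i\<in>I. \<gamma> i \<in> polyfuns ?C) \<and> \<delta> (K0, L0, M0) \<noteq> 0 \<and>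
    (\<forall>y w. (\<forall>j\<in>J. (\<Sum>i\<in>I. c j i y * w i) = r j y) \<longrightarrow> (\<forall>i\<in>I. \<gamma> i y = \<delta> y * w i))"
  proof (rule cramer_family)
    show "finite I" "finite J" by (auto simp: I_def J_def)
    show "c j i \<in> polyfuns ?C" if "j \<in> J" "i \<in> I" for j i
      using that unfolding c_def I_def J_def intertwiner_coeff_def
      by (auto intro!: polyfuns_if polyfuns_uminus polyfuns.const polyfuns_lomadze_coords)
    show "r j \<in> polyfuns ?C" if "j \<in> J" for j
      using that unfolding r_def J_def by (auto intro!: polyfuns.const polyfuns_lomadze_coords)
    fix w :: "nat \<times> nat + nat \<times> nat \<Rightarrow> 'k" and i
    assume sol: "\<And>j. j \<in> J \<Longrightarrow> (\<Sum>i\<in>I. c j i (K0, L0, M0) * w i) = 0" and i: "i \<in> I"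
    define H0 where "H0 = mat n n (\<lambda>kl. w (Inl kl))"
    define H1 where "H1 = mat ?e ?e (\<lambda>kl. w (Inr kl))"
    have H0: "H0 \<in> carrier_mat n n" and H1: "H1 \<in> carrier_mat ?e ?e" by (simp_all add: H0_def H1_def)
    have K0: "K0 \<in> carrier_mat ?e n" and L0: "L0 \<in> carrier_mat ?e n" using y by (auto simp: lomadze_space_iff)
    have "H1 * K = K0 * H0"
    proof (rule eq_matI)
      fix i l assume "i < dim_row (K0 * H0)" "l < dim_col (K0 * H0)"
      then have il: "i < ?e" "l < n" using K0 H0 by auto
      have "Inl (i, l) \<in> J" using il by (auto simp: J_def)
      from sol[OF this] show "(H1 * K) $$ (i, l) = (K0 * H0) $$ (i, l)"
        unfolding sys1[OF il] mat_mult_index[OF H1 K il] mat_mult_index[OF K0 H0 il]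
        using il by (simp add: H0_def H1_def mult.commute)
    qed (use H1 K K0 H0 in auto)
    moreover have "H1 * L = L0 * H0"
    proof (rule eq_matI)
      fix i l assume "i < dim_row (L0 * H0)" "l < dim_col (L0 * H0)"
      then have il: "i < ?e" "l < n" using L0 H0 by auto
      have "Inr (Inl (i, l)) \<in> J" using il by (auto simp: J_def)
      from sol[OF this] show "(H1 * L) $$ (i, l) = (L0 * H0) $$ (i, l)"
        unfolding sys2[OF il] mat_mult_index[OF H1 L il] mat_mult_index[OF L0 H0 il]
        using il by (simp add: H0_def H1_def mult.commute)
    qed (use H1 L L0 H0 in auto)
    moreover have "H1 * M = 0\<^sub>m ?e (p + m)"
    proof (rule eq_matI)
      fix i l assume "i < dim_row (0\<^sub>m ?e (p + m) :: 'k mat)" "l < dim_col (0\<^sub>m ?e (p + m) :: 'k mat)"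
      then have il: "i < ?e" "l < p + m" by auto
      have "Inr (Inr (i, l)) \<in> J" using il by (auto simp: J_def)
      from sol[OF this] show "(H1 * M) $$ (i, l) = 0\<^sub>m ?e (p + m) $$ (i, l)"
        unfolding sys3[OF il(1)] mat_mult_index[OF H1 M il]
        using il by (simp add: H1_def mult.commute)
    qed (use H1 M in auto)
    ultimately have zero: "H0 = 0\<^sub>m n n" "H1 = 0\<^sub>m ?e ?e"
      using hom_eq_zero[OF x y sx sy H0 H1] by blast+
    then have "w (Inl (k, l)) = 0" if "k < n \<and> l < n" for k l
      using zero(1) that unfolding H0_def by (metis index_mat(1) index_zero_mat(1))
    moreover have "w (Inr (k, l)) = 0" if "k < ?e \<and> l < ?e" for k l
      using zero(2) that unfolding H1_def by (metis index_mat(1) index_zero_mat(1))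
    ultimately show "w i = 0" using i by (auto simp: I_def)
  qed
  then obtain \<delta> \<gamma> where \<delta>: "\<delta> \<in> polyfuns ?C" and \<gamma>: "\<forall>i\<in>I. \<gamma> i \<in> polyfuns ?C" and nz: "\<delta> (K0, L0, M0) \<noteq> 0"
    and sol: "\<forall>y w. (\<forall>j\<in>J. (\<Sum>i\<in>I. c j i y * w i) = r j y) \<longrightarrow> (\<forall>i\<in>I. \<gamma> i y = \<delta> y * w i)"
    by blast
  define \<Gamma>0 where "\<Gamma>0 y = mat n n (\<lambda>kl. \<gamma> (Inl kl) y)" for y
  define \<Gamma>1 where "\<Gamma>1 y = mat ?e ?e (\<lambda>kl. \<gamma> (Inr kl) y)" for y
  have "poly_mat ?C n n \<Gamma>0" "poly_mat ?C ?e ?e \<Gamma>1"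
    using \<gamma> by (auto simp: poly_mat_def \<Gamma>0_def \<Gamma>1_def I_def)
  moreover have "\<Gamma>0 (K', L', M') = \<delta> (K', L', M') \<cdot>\<^sub>m H0 \<and> \<Gamma>1 (K', L', M') = \<delta> (K', L', M') \<cdot>\<^sub>m H1"
    if y': "(K', L', M') \<in> lomadze_space n m p" and H0: "H0 \<in> carrier_mat n n" and H1: "H1 \<in> carrier_mat ?e ?e"
      and HK: "H1 * K = K' * H0" and HL: "H1 * L = L' * H0" and HM: "H1 * M = M'" for K' L' M' H0 H1
  proof -
    have K': "K' \<in> carrier_mat ?e n" and L': "L' \<in> carrier_mat ?e n" using y' by (auto simp: lomadze_space_iff)
    define w where "w idx = (case idx of Inl kl \<Rightarrow> H0 $$ kl | Inr kl \<Rightarrow> H1 $$ kl)" for idx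
    have "(\<Sum>i\<in>I. c j i (K', L', M') * w i) = r j (K', L', M')" if j: "j \<in> J" for j
    proof -
      consider (1) i l where "j = Inl (i, l)" "i < ?e" "l < n"
        | (2) i l where "j = Inr (Inl (i, l))" "i < ?e" "l < n"
        | (3) i l where "j = Inr (Inr (i, l))" "i < ?e" "l < p + m"
        using j by (auto simp: J_def)
      then show ?thesis
      proof cases
        case 1
        have "(\<Sum>k<?e. H1 $$ (i, k) * K $$ (k, l)) = (\<Sum>k<n. K' $$ (i, k) * H0 $$ (k, l))"
          using arg_cong[OF HK, of "\<lambda>A. A $$ (i, l)"]
          unfolding mat_mult_index[OF H1 K 1(2,3)] mat_mult_index[OF K' H0 1(2,3)] .
        then show ?thesis unfolding 1(1) sys1[OF 1(2,3)] by (simp add: w_def r_def mult.commute)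
      next
        case 2
        have "(\<Sum>k<?e. H1 $$ (i, k) * L $$ (k, l)) = (\<Sum>k<n. L' $$ (i, k) * H0 $$ (k, l))"
          using arg_cong[OF HL, of "\<lambda>A. A $$ (i, l)"]
          unfolding mat_mult_index[OF H1 L 2(2,3)] mat_mult_index[OF L' H0 2(2,3)] .
        then show ?thesis unfolding 2(1) sys2[OF 2(2,3)] by (simp add: w_def r_def mult.commute)
      next
        case 3
        have "(\<Sum>k<?e. H1 $$ (i, k) * M $$ (k, l)) = M' $$ (i, l)"
          using arg_cong[OF HM, of "\<lambda>A. A $$ (i, l)"] unfolding mat_mult_index[OF H1 M 3(2,3)] .
        then show ?thesis unfolding 3(1) sys3[OF 3(2)] by (simp add: w_def r_def mult.commute)
      qed
    qed
    then have sol': "\<forall>i\<in>I. \<gamma> i (K', L', M') = \<delta> (K', L', M') * w i" using sol by blast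
    have "\<gamma> (Inl (i, k)) (K', L', M') = \<delta> (K', L', M') * H0 $$ (i, k)" if "i < n" "k < n" for i k
      using bspec[OF sol', of "Inl (i, k)"] that by (auto simp: w_def I_def)
    moreover have "\<gamma> (Inr (i, k)) (K', L', M') = \<delta> (K', L', M') * H1 $$ (i, k)"
      if "i < ?e" "k < ?e" for i k
      using bspec[OF sol', of "Inr (i, k)"] that by (auto simp: w_def I_def)
    ultimately show ?thesis
      using H0 H1 by (auto intro!: eq_matI simp: \<Gamma>0_def \<Gamma>1_def)
  qed
  ultimately show ?thesis using \<delta> nz by (intro exI[of _ \<delta>] exI[of _ \<Gamma>0] exI[of _ \<Gamma>1]) blast
qed

section \<open>Closed orbits\<close>

text \<open>A pointwise test by single polynomials. Conversely, the family defining \<open>U\<close>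
  consists of all polynomials whose nonvanishing locus in \<open>A\<close> lies in
  \<open>U\<close>.\<close>

lemma openin_subtopology_zariski:
  "openin (subtopology (zariski X C) A) U \<longleftrightarrow>
    U \<subseteq> X \<inter> A \<and> (\<forall>x\<in>U. \<exists>f\<in>polyfuns C. f x \<noteq> 0 \<and> (\<forall>y\<in>X \<inter> A. f y \<noteq> 0 \<longrightarrow> y \<in> U))"
  (is "?L \<longleftrightarrow> ?R")
proof
  assume ?L
  then obtain F where F: "F \<subseteq> polyfuns C" "U = {x \<in> X. \<exists>f\<in>F. f x \<noteq> 0} \<inter> A"
    unfolding openin_subtopology openin_zariski by blast
  then show ?R by blast
next
  assume R: ?R
  let ?F = "{f \<in> polyfuns C. \<forall>y\<in>X \<inter> A. f y \<noteq> 0 \<longrightarrow> y \<in> U}"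
  have "U = {x \<in> X. \<exists>f\<in>?F. f x \<noteq> 0} \<inter> A" using R by blast
  moreover have "openin (zariski X C) {x \<in> X. \<exists>f\<in>?F. f x \<noteq> 0}"
    unfolding openin_zariski by (intro exI[of _ ?F] conjI refl) simp
  ultimately show ?L unfolding openin_subtopology by (intro exI conjI)
qed

lemma openin_zariski_iff:
  "openin (zariski X C) U \<longleftrightarrow>
    U \<subseteq> X \<and> (\<forall>x\<in>U. \<exists>f\<in>polyfuns C. f x \<noteq> 0 \<and> (\<forall>y\<in>X. f y \<noteq> 0 \<longrightarrow> y \<in> U))"
  using openin_subtopology_zariski[of X C UNIV U] by simp

lemma closedin_subtopology_zariski:
  assumes "Z \<subseteq> X \<inter> A"
    and "\<And>y. y \<in> X \<Longrightarrow> y \<in> A \<Longrightarrow> (\<And>f. f \<in> polyfuns C \<Longrightarrow> (\<And>z. z \<in> Z \<Longrightarrow> f z = 0) \<Longrightarrow> f y = 0) \<Longrightarrow> y \<in> Z"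
  shows "closedin (subtopology (zariski X C) A) Z"
  unfolding closedin_def openin_subtopology_zariski topspace_subtopology topspace_zariski
proof (intro conjI ballI)
  fix y assume y: "y \<in> X \<inter> A - Z"
  have "\<exists>f\<in>polyfuns C. (\<forall>z\<in>Z. f z = 0) \<and> f y \<noteq> 0"
  proof (rule ccontr)
    assume "\<not> ?thesis"
    then have "y \<in> Z" by (intro assms(2)) (use y in auto)
    then show False using y by simp
  qed
  then show "\<exists>f\<in>polyfuns C. f y \<noteq> 0 \<and> (\<forall>y\<in>X \<inter> A. f y \<noteq> 0 \<longrightarrow> y \<in> X \<inter> A - Z)" by blast
qed (use assms(1) in auto)

section \<open>Krull dimension under homeomorphisms\<close>

lemma irreducible_closed_image:
  assumes h: "homeomorphic_map X Y h" and Z: "irreducible_closed X Z"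
  shows "irreducible_closed Y (h ` Z)"
  unfolding irreducible_closed_def
proof (intro conjI allI impI)
  have cZ: "closedin X Z" and ne: "Z \<noteq> {}"
    and irr: "\<And>A B. closedin X A \<Longrightarrow> closedin X B \<Longrightarrow> Z = A \<union> B \<Longrightarrow> Z = A \<or> Z = B"
    using Z unfolding irreducible_closed_def by blast+
  show "closedin Y (h ` Z)" using homeomorphic_map_closedness_eq[OF h] cZ by blast
  show "h ` Z \<noteq> {}" using ne by simp
  fix A B assume AB: "closedin Y A \<and> closedin Y B \<and> h ` Z = A \<union> B"
  have pre: "closedin X {x \<in> Z. h x \<in> S}" if "closedin Y S" for S
    by (rule closedin_continuous_map_preimage_gen[OF homeomorphic_imp_continuous_map[OF h] cZ that])
  have "Z = {x \<in> Z. h x \<in> A} \<union> {x \<in> Z. h x \<in> B}" using AB by blast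
  then have "Z = {x \<in> Z. h x \<in> A} \<or> Z = {x \<in> Z. h x \<in> B}" using irr pre AB by blast
  then show "h ` Z = A \<or> h ` Z = B" using AB by blast
qed

lemma krull_dim_le_homeomorphic:
  assumes h: "homeomorphic_map X Y h"
  shows "krull_dim X \<le> krull_dim Y"
  unfolding krull_dim_def
proof (rule Sup_subset_mono, rule subsetI)
  fix e assume "e \<in> {enat d |d. \<exists>Z. (\<forall>i\<le>d. irreducible_closed X (Z i)) \<and> (\<forall>i<d. Z i \<subset> Z (Suc i))}"
  then obtain d Z where e: "e = enat d" and irr: "\<forall>i\<le>d. irreducible_closed X (Z i)"
    and chain: "\<forall>i<d. Z i \<subset> Z (Suc i)" by blast
  have inj: "inj_on h (topspace X)" by (rule homeomorphic_imp_injective_map[OF h])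
  have sub: "Z i \<subseteq> topspace X" if "i \<le> d" for i
    using irr that closedin_subset unfolding irreducible_closed_def by blast
  have "h ` Z i \<subset> h ` Z (Suc i)" if i: "i < d" for i
  proof -
    have "h ` Z i = h ` Z (Suc i) \<longleftrightarrow> Z i = Z (Suc i)"
      by (rule inj_on_image_eq_iff[OF inj sub sub]) (use i in auto)
    moreover have "Z i \<subset> Z (Suc i)" using chain i by simp
    ultimately show ?thesis by (simp add: psubset_eq image_mono)
  qed
  then show "e \<in> {enat d |d. \<exists>Z. (\<forall>i\<le>d. irreducible_closed Y (Z i)) \<and> (\<forall>i<d. Z i \<subset> Z (Suc i))}"
    by (intro CollectI exI[of _ d] exI[of _ "\<lambda>i. h ` Z i"] conjI allI impI)
      (simp_all add: e irr irreducible_closed_image[OF h])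
qed

lemma krull_dim_homeomorphic:
  assumes "homeomorphic_map X Y h"
  shows "krull_dim X = krull_dim Y"
proof -
  obtain g where "homeomorphic_maps X Y h g" using iffD1[OF homeomorphic_map_maps assms] ..
  then have "homeomorphic_map Y X g" using homeomorphic_maps_map[of X Y h g] by simp
  from krull_dim_le_homeomorphic[OF assms] krull_dim_le_homeomorphic[OF this]
  show ?thesis by (rule order.antisym)
qed

section \<open>The group action and its orbits\<close>

lemma group_lomadze_group: "Group.group (lomadze_group n p :: ('k :: field mat \<times> 'k mat) monoid)"
  unfolding lomadze_group_def by (intro DirProd_group group_gl)

lemma lomadze_group_mult: "(g0, g1) \<otimes>\<^bsub>lomadze_group n p\<^esub> (h0, h1) = (g0 * h0, g1 * h1)"
  by (simp add: lomadze_group_def DirProd_def)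

lemma lomadze_group_one: "\<one>\<^bsub>lomadze_group n p\<^esub> = (1\<^sub>m n, 1\<^sub>m (n + p))"
  by (simp add: lomadze_group_def DirProd_def)

lemma act_mult:
  fixes x :: "'k :: field lomadze"
  assumes g: "g \<in> carrier (lomadze_group n p)" and h: "h \<in> carrier (lomadze_group n p)"
    and x: "x \<in> lomadze_space n m p"
  shows "act n (g \<otimes>\<^bsub>lomadze_group n p\<^esub> h) x = act n g (act n h x)"
proof -
  obtain g0 g1 where gd: "g = (g0, g1)" by (cases g)
  obtain h0 h1 where hd: "h = (h0, h1)" by (cases h)
  obtain K L M where xd: "x = (K, L, M)" by (cases x)
  have K: "K \<in> carrier_mat (n + p) n" and L: "L \<in> carrier_mat (n + p) n"
    and M: "M \<in> carrier_mat (n + p) (p + m)" using x by (auto simp: xd lomadze_space_iff)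
  have g0: "g0 \<in> carrier (gl n)" and h0: "h0 \<in> carrier (gl n)"
    and g1: "g1 \<in> carrier_mat (n + p) (n + p)" and h1: "h1 \<in> carrier_mat (n + p) (n + p)"
    using g h by (auto simp: gd hd carrier_lomadze_group carrier_gl)
  interpret group "gl n :: 'k mat monoid" by (rule group_gl)
  have inv: "inv\<^bsub>gl n\<^esub> (g0 * h0) = inv\<^bsub>gl n\<^esub> h0 * inv\<^bsub>gl n\<^esub> g0"
    using inv_mult_group[OF g0 h0] by simp
  have assoc: "g1 * h1 * A * (inv\<^bsub>gl n\<^esub> h0 * inv\<^bsub>gl n\<^esub> g0) = g1 * (h1 * A * inv\<^bsub>gl n\<^esub> h0) * inv\<^bsub>gl n\<^esub> g0"
    if A: "A \<in> carrier_mat (n + p) n" for A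
  proof -
    note i = inv_gl(1)[OF g0] inv_gl(1)[OF h0]
    have hA: "h1 * A \<in> carrier_mat (n + p) n" by (rule mult_carrier_mat[OF h1 A])
    have "g1 * h1 * A * (inv\<^bsub>gl n\<^esub> h0 * inv\<^bsub>gl n\<^esub> g0) = g1 * (h1 * A) * (inv\<^bsub>gl n\<^esub> h0 * inv\<^bsub>gl n\<^esub> g0)"
      by (simp only: assoc_mult_mat[OF g1 h1 A])
    also have "\<dots> = g1 * (h1 * A) * inv\<^bsub>gl n\<^esub> h0 * inv\<^bsub>gl n\<^esub> g0"
      by (rule assoc_mult_mat[symmetric, OF mult_carrier_mat[OF g1 hA] i(2,1)])
    also have "g1 * (h1 * A) * inv\<^bsub>gl n\<^esub> h0 = g1 * (h1 * A * inv\<^bsub>gl n\<^esub> h0)"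
      by (rule assoc_mult_mat[OF g1 hA i(2)])
    finally show ?thesis .
  qed
  show ?thesis
    using assoc[OF K] assoc[OF L] assoc_mult_mat[OF g1 h1 M]
    by (simp add: gd hd xd lomadze_group_mult inv)
qed

lemma act_one:
  assumes x: "x \<in> lomadze_space n m p"
  shows "act n \<one>\<^bsub>lomadze_group n p\<^esub> x = (x :: 'k :: field lomadze)"
proof -
  interpret group "gl n :: 'k mat monoid" by (rule group_gl)
  have "inv\<^bsub>gl n\<^esub> (1\<^sub>m n) = (1\<^sub>m n :: 'k mat)" using inv_one by simp
  then show ?thesis using x by (cases x) (auto simp: lomadze_group_one lomadze_space_iff)
qed

lemma lomadze_orbit_eq: "lomadze_orbit n p x = (\<lambda>g. act n g x) ` carrier (lomadze_group n p)"
  by (auto simp: lomadze_orbit_def Group_Action.orbit_def)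

text \<open>Moving the inverse of \<open>g0\<close> to the other side makes the orbit equations
  linear in \<open>g0\<close> and \<open>g1\<close>.\<close>

lemma act_eq_iff:
  fixes K L M :: "'k :: field mat"
  assumes x: "(K, L, M) \<in> lomadze_space n m p" and y: "(K', L', M') \<in> lomadze_space n m p"
    and g: "(g0, g1) \<in> carrier (lomadze_group n p)"
  shows "act n (g0, g1) (K, L, M) = (K', L', M') \<longleftrightarrow> g1 * K = K' * g0 \<and> g1 * L = L' * g0 \<and> g1 * M = M'"
proof -
  have g0: "g0 \<in> carrier (gl n)" "g0 \<in> carrier_mat n n" and g1: "g1 \<in> carrier_mat (n + p) (n + p)"
    using g by (auto simp: carrier_lomadze_group carrier_gl)
  note i = inv_gl[OF g0(1)]
  have "A * inv\<^bsub>gl n\<^esub> g0 = B \<longleftrightarrow> A = B * g0" if A: "A \<in> carrier_mat (n + p) n" and B: "B \<in> carrier_mat (n + p) n" for A B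
  proof
    assume "A * inv\<^bsub>gl n\<^esub> g0 = B"
    then have "B * g0 = A * (inv\<^bsub>gl n\<^esub> g0 * g0)" using assoc_mult_mat[OF A i(1) g0(2)] by simp
    then show "A = B * g0" using i(3) A by simp
  next
    assume "A = B * g0"
    then have "A * inv\<^bsub>gl n\<^esub> g0 = B * (g0 * inv\<^bsub>gl n\<^esub> g0)" using assoc_mult_mat[OF B g0(2) i(1)] by simp
    then show "A * inv\<^bsub>gl n\<^esub> g0 = B" using i(2) B by simp
  qed
  then show ?thesis using x y g1 by (simp add: lomadze_space_iff)
qed

lemma smult_mat_cancel:
  assumes "(c :: 'k :: field) \<noteq> 0" "c \<cdot>\<^sub>m A = c \<cdot>\<^sub>m B" "A \<in> carrier_mat r s" "B \<in> carrier_mat r s"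
  shows "A = B"
proof (rule eq_matI)
  fix i j assume "i < dim_row B" "j < dim_col B"
  then show "A $$ (i, j) = B $$ (i, j)"
    using arg_cong[OF assms(2), of "\<lambda>X. X $$ (i, j)"] assms(1,3,4) by simp
qed (use assms in auto)

text \<open>Let \<open>y\<close> be a limit point with f y \<noteq> 0. On the orbit \<Gamma>0 and
  \<Gamma>1 satisfy the intertwiner equations up to the factor \<delta>; these are polynomial
  identities, so they persist at \<open>y\<close>. Since \<delta> y \<noteq> 0, division gives a
  homomorphism from \<open>x\<close> to \<open>y\<close> compatible with \<open>M\<close>, which is
  invertible because both points are numerically stable.\<close>

lemma orbit_closed_in_semistable:
  fixes f :: "'k :: field lomadze \<Rightarrow> 'k"
  assumes inv: "f \<in> semi_invariants n m p c0 c1 N"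
    and num: "\<And>y. y \<in> lomadze_space n m p \<Longrightarrow> f y \<noteq> 0 \<Longrightarrow> numerically_stable n m p a b y"
    and x: "x \<in> lomadze_space n m p" and fx: "f x \<noteq> 0"
  shows "closedin (subtopology (lomadze_top n m p) {y. f y \<noteq> 0}) (lomadze_orbit n p x)"
  unfolding lomadze_top_def
proof (rule closedin_subtopology_zariski)
  let ?C = "lomadze_coords n m p :: ('k lomadze \<Rightarrow> 'k) set"
  have char: "character c0 c1 g \<noteq> 0" if "g \<in> carrier (lomadze_group n p)" for g :: "'k mat \<times> 'k mat"
    using that by (cases g) (auto simp: carrier_lomadze_group carrier_gl)
  show "lomadze_orbit n p x \<subseteq> lomadze_space n m p \<inter> {y. f y \<noteq> 0}"
    using act_closed[OF _ x] inv char fx x by (auto simp: lomadze_orbit_eq semi_invariants_def)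
  fix y assume y: "y \<in> lomadze_space n m p" and "y \<in> {y. f y \<noteq> 0}"
    and closure: "\<And>F. F \<in> polyfuns ?C \<Longrightarrow> (\<And>z. z \<in> lomadze_orbit n p x \<Longrightarrow> F z = 0) \<Longrightarrow> F y = 0"
  then have fy: "f y \<noteq> 0" by simp
  obtain K L M where xd: "x = (K, L, M)" by (cases x)
  obtain K0 L0 M0 where yd: "y = (K0, L0, M0)" by (cases y)
  note xs = x[unfolded xd] and ys = y[unfolded yd]
  note nx = num[OF x fx, unfolded xd] and ny = num[OF y fy, unfolded yd]
  have K: "K \<in> carrier_mat (n + p) n" and L: "L \<in> carrier_mat (n + p) n"
    and M: "M \<in> carrier_mat (n + p) (p + m)" using xs by (auto simp: lomadze_space_iff)
  have K0: "K0 \<in> carrier_mat (n + p) n" and L0: "L0 \<in> carrier_mat (n + p) n"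
    and M0: "M0 \<in> carrier_mat (n + p) (p + m)" using ys by (auto simp: lomadze_space_iff)
  obtain \<delta> \<Gamma>0 \<Gamma>1 where \<delta>: "\<delta> \<in> polyfuns ?C" and \<Gamma>0: "poly_mat ?C n n \<Gamma>0"
    and \<Gamma>1: "poly_mat ?C (n + p) (n + p) \<Gamma>1" and nz: "\<delta> (K0, L0, M0) \<noteq> 0"
    and sol: "\<forall>K' L' M' H0 H1. (K', L', M') \<in> lomadze_space n m p \<longrightarrow>
       H0 \<in> carrier_mat n n \<longrightarrow> H1 \<in> carrier_mat (n + p) (n + p) \<longrightarrow>
       H1 * K = K' * H0 \<longrightarrow> H1 * L = L' * H0 \<longrightarrow> H1 * M = M' \<longrightarrow>
       \<Gamma>0 (K', L', M') = \<delta> (K', L', M') \<cdot>\<^sub>m H0 \<and> \<Gamma>1 (K', L', M') = \<delta> (K', L', M') \<cdot>\<^sub>m H1"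
    using rational_intertwiner[OF xs ys nx ny] by blast
  have orbit: "\<Gamma>1 z * K = crop (n + p) n (fst z) * \<Gamma>0 z \<and> \<Gamma>1 z * L = crop (n + p) n (fst (snd z)) * \<Gamma>0 z \<and>
      \<Gamma>1 z * M = \<delta> z \<cdot>\<^sub>m crop (n + p) (p + m) (snd (snd z))" if z: "z \<in> lomadze_orbit n p x" for z
  proof -
    obtain g0 g1 where g: "(g0, g1) \<in> carrier (lomadze_group n p)" "z = act n (g0, g1) x"
      using z by (auto simp: lomadze_orbit_eq)
    obtain K' L' M' where zd: "z = (K', L', M')" by (cases z)
    have zs: "(K', L', M') \<in> lomadze_space n m p" using act_closed[OF g(1) x] g(2) zd by simp
    have eq: "g1 * K = K' * g0" "g1 * L = L' * g0" "g1 * M = M'"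
      using act_eq_iff[OF xs zs g(1)] g(2) zd xd by simp_all
    have g0: "g0 \<in> carrier_mat n n" and g1: "g1 \<in> carrier_mat (n + p) (n + p)"
      using g(1) by (auto simp: carrier_lomadze_group carrier_gl)
    have K': "K' \<in> carrier_mat (n + p) n" and L': "L' \<in> carrier_mat (n + p) n"
      and M': "M' \<in> carrier_mat (n + p) (p + m)" using zs by (auto simp: lomadze_space_iff)
    have \<Gamma>: "\<Gamma>0 z = \<delta> z \<cdot>\<^sub>m g0" "\<Gamma>1 z = \<delta> z \<cdot>\<^sub>m g1" using sol zs g0 g1 eq unfolding zd by blast+
    show ?thesis
      unfolding \<Gamma> using K' L' M'
      by (simp add: zd eq mult_smult_assoc_mat[OF g1 K] mult_smult_assoc_mat[OF g1 L]
          mult_smult_assoc_mat[OF g1 M] mult_smult_distrib[OF K' g0] mult_smult_distrib[OF L' g0])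
  qed
  \<comment> \<open>By \<open>closure\<close>, every polynomial vanishing on the orbit vanishes at
    \<open>y\<close>; this is applied entry by entry.\<close>
  have transfer: "F y = G y"
    if F: "poly_mat ?C r s F" and G: "poly_mat ?C r s G"
      and eq: "\<And>z. z \<in> lomadze_orbit n p x \<Longrightarrow> F z = G z" for F G r s
  proof (rule eq_matI)
    have dims: "F y \<in> carrier_mat r s" "G y \<in> carrier_mat r s" using poly_mat_carrier[OF F] poly_mat_carrier[OF G] by auto
    then show "dim_row (F y) = dim_row (G y)" "dim_col (F y) = dim_col (G y)" by auto
    fix i j assume "i < dim_row (G y)" "j < dim_col (G y)"
    then have ij: "i < r" "j < s" using dims by auto
    have "(\<lambda>y. F y $$ (i, j) - G y $$ (i, j)) \<in> polyfuns ?C"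
      by (rule polyfuns_diff[OF poly_mat_entry[OF F ij] poly_mat_entry[OF G ij]])
    then have "F y $$ (i, j) - G y $$ (i, j) = 0" by (rule closure) (simp add: eq)
    then show "F y $$ (i, j) = G y $$ (i, j)" by simp
  qed
  have pM: "poly_mat ?C (n + p) (p + m) (\<lambda>z. \<delta> z \<cdot>\<^sub>m crop (n + p) (p + m) (snd (snd z)))"
  proof (rule poly_matI)
    fix i j assume ij: "i < n + p" "j < p + m"
    have "(\<delta> z \<cdot>\<^sub>m crop (n + p) (p + m) (snd (snd z))) $$ (i, j) = \<delta> z * crop (n + p) (p + m) (snd (snd z)) $$ (i, j)" for z
      using ij by (simp add: crop_def)
    then show "(\<lambda>z. (\<delta> z \<cdot>\<^sub>m crop (n + p) (p + m) (snd (snd z))) $$ (i, j)) \<in> polyfuns ?C"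
      using polyfuns.mult[OF \<delta> poly_mat_entry[OF poly_mat_lomadze(3) ij]] by simp
  qed simp
  have eqs: "\<Gamma>1 y * K = K0 * \<Gamma>0 y" "\<Gamma>1 y * L = L0 * \<Gamma>0 y" "\<Gamma>1 y * M = \<delta> y \<cdot>\<^sub>m M0"
    using transfer[OF poly_mat_mult[OF \<Gamma>1 poly_mat_const[OF K]] poly_mat_mult[OF poly_mat_lomadze(1) \<Gamma>0]]
      transfer[OF poly_mat_mult[OF \<Gamma>1 poly_mat_const[OF L]] poly_mat_mult[OF poly_mat_lomadze(2) \<Gamma>0]]
      transfer[OF poly_mat_mult[OF \<Gamma>1 poly_mat_const[OF M]] pM] orbit K0 L0 M0
    by (simp_all add: yd)
  define H0 where "H0 = inverse (\<delta> y) \<cdot>\<^sub>m \<Gamma>0 y"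
  define H1 where "H1 = inverse (\<delta> y) \<cdot>\<^sub>m \<Gamma>1 y"
  note G0 = poly_mat_carrier[OF \<Gamma>0, of y] and G1 = poly_mat_carrier[OF \<Gamma>1, of y]
  have H: "H0 \<in> carrier_mat n n" "H1 \<in> carrier_mat (n + p) (n + p)"
    using G0 G1 by (auto simp: H0_def H1_def)
  have "inverse (\<delta> y) \<cdot>\<^sub>m (\<delta> y \<cdot>\<^sub>m M0) = M0" using nz M0 by (intro eq_matI) (auto simp: yd)
  then have HK: "H1 * K = K0 * H0" "H1 * L = L0 * H0" "H1 * M = M0"
    unfolding H0_def H1_def mult_smult_assoc_mat[OF G1 K] mult_smult_assoc_mat[OF G1 L]
      mult_smult_assoc_mat[OF G1 M] mult_smult_distrib[OF K0 G0] mult_smult_distrib[OF L0 G0] eqs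
    by simp_all
  have mem: "(H0, H1) \<in> carrier (lomadze_group n p)"
    using hom_invertible[OF xs ys nx ny H HK] H by (simp add: carrier_lomadze_group carrier_gl)
  have "act n (H0, H1) x = y" unfolding xd yd act_eq_iff[OF xs ys mem] using HK by blast
  with mem show "y \<in> lomadze_orbit n p x" unfolding lomadze_orbit_eq by (metis image_eqI)
qed

section \<open>The orbit map\<close>

text \<open>Polynomial functions of \<open>t g\<close> become polynomial in \<open>s g\<close> after clearing the denominator
  \<open>D\<close>.\<close>

lemma polyfuns_pullback:
  fixes D :: "'y \<Rightarrow> 'k :: comm_ring_1"
  assumes f: "f \<in> polyfuns C" and D: "D \<in> polyfuns C'"
    and coord: "\<And>c. c \<in> C \<Longrightarrow> \<exists>H \<in> polyfuns C'. \<exists>k. \<forall>g\<in>G. H (s g) = D (s g) ^ k * c (t g)"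
  shows "\<exists>H \<in> polyfuns C'. \<exists>k. \<forall>g\<in>G. H (s g) = D (s g) ^ k * f (t g)"
  using f
proof (induction rule: polyfuns.induct)
  case (const c)
  show ?case by (intro bexI[of _ "\<lambda>_. c"] exI[of _ 0]) (auto intro: polyfuns.const)
next
  case (add f g)
  then obtain F k H l where F: "F \<in> polyfuns C'" "\<forall>g\<in>G. F (s g) = D (s g) ^ k * f (t g)"
    and H: "H \<in> polyfuns C'" "\<forall>x\<in>G. H (s x) = D (s x) ^ l * g (t x)" by blast
  have pD: "(\<lambda>y. D y ^ k) \<in> polyfuns C'" for k using D by (induction k) (auto intro: polyfuns.intros)
  have "(\<lambda>y. D y ^ l * F y + D y ^ k * H y) \<in> polyfuns C'"
    by (intro polyfuns.add polyfuns.mult pD F H)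
  then show ?case
    by (rule bexI[rotated]) (rule exI[of _ "k + l"], simp add: F H power_add algebra_simps)
next
  case (mult f g)
  then obtain F k H l where F: "F \<in> polyfuns C'" "\<forall>g\<in>G. F (s g) = D (s g) ^ k * f (t g)"
    and H: "H \<in> polyfuns C'" "\<forall>x\<in>G. H (s x) = D (s x) ^ l * g (t x)" by blast
  have "(\<lambda>y. F y * H y) \<in> polyfuns C'" by (intro polyfuns.mult F H)
  then show ?case
    by (rule bexI[rotated]) (rule exI[of _ "k + l"], simp add: F H power_add algebra_simps)
qed (rule coord)

lemma poly_mat_group:
  "poly_mat (group_coords n p) n n (\<lambda>g. crop n n (fst g))"
  "poly_mat (group_coords n p) (n + p) (n + p) (\<lambda>g. crop (n + p) (n + p) (snd g))"
  unfolding poly_mat_def crop_def group_coords_def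
  by (auto intro!: polyfuns.coord simp: case_prod_unfold)

text \<open>Column \<open>j\<close> holds Cramer's numerators for column \<open>j\<close> of the
  inverse, so all entries are visibly polynomial.\<close>

definition adjugate :: "nat \<Rightarrow> 'k :: field mat \<Rightarrow> 'k mat" where
  "adjugate n A = mat n n (\<lambda>(k, j). Determinant.det (replace_col A (unit_vec n j) k))"

lemma adjugate_gl:
  assumes A: "A \<in> carrier (gl n)"
  shows "adjugate n A = Determinant.det A \<cdot>\<^sub>m inv\<^bsub>gl n\<^esub> A"
proof (rule eq_matI)
  have Ac: "A \<in> carrier_mat n n" using A by (simp add: carrier_gl)
  note i = inv_gl[OF A]
  show "dim_row (adjugate n A) = dim_row (Determinant.det A \<cdot>\<^sub>m inv\<^bsub>gl n\<^esub> A)"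
    "dim_col (adjugate n A) = dim_col (Determinant.det A \<cdot>\<^sub>m inv\<^bsub>gl n\<^esub> A)"
    using i(1) by (auto simp: adjugate_def)
  fix k j assume "k < dim_row (Determinant.det A \<cdot>\<^sub>m inv\<^bsub>gl n\<^esub> A)" "j < dim_col (Determinant.det A \<cdot>\<^sub>m inv\<^bsub>gl n\<^esub> A)"
  then have kj: "k < n" "j < n" using i(1) by auto
  have x: "col (inv\<^bsub>gl n\<^esub> A) j \<in> carrier_vec n"
    using i(1) by (intro carrier_vecI) simp
  have "A *\<^sub>v col (inv\<^bsub>gl n\<^esub> A) j = col (A * inv\<^bsub>gl n\<^esub> A) j"
    using col_mult2[OF Ac i(1) kj(2)] by simp
  also have "\<dots> = unit_vec n j" unfolding i(2) using kj by simp
  finally have "Determinant.det (replace_col A (unit_vec n j) k) = col (inv\<^bsub>gl n\<^esub> A) j $ k * Determinant.det A"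
    using cramer_lemma_mat[OF Ac x kj(1)] by simp
  then show "adjugate n A $$ (k, j) = (Determinant.det A \<cdot>\<^sub>m inv\<^bsub>gl n\<^esub> A) $$ (k, j)"
    using kj i(1) by (simp add: adjugate_def)
qed

lemma poly_mat_adjugate:
  assumes F: "poly_mat C n n F"
  shows "poly_mat C n n (\<lambda>x. adjugate n (F x))"
proof (rule poly_matI)
  fix k j assume kj: "k < n" "j < n"
  have "poly_mat C n n (\<lambda>x. replace_col (F x) (unit_vec n j) k)"
  proof (rule poly_matI)
    show "replace_col (F x) (unit_vec n j) k \<in> carrier_mat n n" for x
      using poly_mat_carrier[OF F, of x] by (auto simp: replace_col_def)
    fix a b assume ab: "a < n" "b < n"
    have "replace_col (F x) (unit_vec n j) k $$ (a, b) = (if b = k then unit_vec n j $ a else F x $$ (a, b))" for x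
      using poly_mat_carrier[OF F, of x] ab by (auto simp: replace_col_def)
    then show "(\<lambda>x. replace_col (F x) (unit_vec n j) k $$ (a, b)) \<in> polyfuns C"
      using poly_mat_entry[OF F ab] by (auto intro: polyfuns_if polyfuns.const)
  qed
  then show "(\<lambda>x. adjugate n (F x) $$ (k, j)) \<in> polyfuns C"
    using kj polyfuns_det by (simp add: adjugate_def)
qed (simp add: adjugate_def)

lemma smult_mat_index:
  "A \<in> carrier_mat r s \<Longrightarrow> i < r \<Longrightarrow> j < s \<Longrightarrow> (c \<cdot>\<^sub>m A) $$ (i, j) = c * A $$ (i, j)"
  by simp

text \<open>The only denominator in the action is det g0: multiplication by it replaces the inverse
  of g0 by the adjugate. So k = 1 for coordinates of the first two matrices and k = 0 for the
  third.\<close>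

lemma act_polynomial:
  fixes x :: "'k :: field lomadze"
  assumes x: "x \<in> lomadze_space n m p" and c: "c \<in> lomadze_coords n m p"
  shows "\<exists>H \<in> polyfuns (group_coords n p). \<exists>k. \<forall>g \<in> carrier (lomadze_group n p).
    H g = Determinant.det (crop n n (fst g)) ^ k * c (act n g x)"
proof -
  let ?G = "group_coords n p :: ('k mat \<times> 'k mat \<Rightarrow> 'k) set"
  obtain K L M where xd: "x = (K, L, M)" by (cases x)
  have K: "K \<in> carrier_mat (n + p) n" and L: "L \<in> carrier_mat (n + p) n"
    and M: "M \<in> carrier_mat (n + p) (p + m)" using x by (auto simp: xd lomadze_space_iff)
  let ?P = "\<lambda>A g. crop (n + p) (n + p) (snd g) * A * adjugate n (crop n n (fst g))"
  have left: "\<exists>H \<in> polyfuns ?G. \<exists>k. \<forall>g \<in> carrier (lomadze_group n p).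
      H g = Determinant.det (crop n n (fst g)) ^ k * (snd g * A * inv\<^bsub>gl n\<^esub> (fst g)) $$ (i, j)"
    if A: "A \<in> carrier_mat (n + p) n" and ij: "i < n + p" "j < n" for A i j
  proof (intro bexI[of _ "\<lambda>g. ?P A g $$ (i, j)"] exI[of _ 1] ballI)
    show "(\<lambda>g. ?P A g $$ (i, j)) \<in> polyfuns ?G"
      by (rule poly_mat_entry[OF poly_mat_mult[OF poly_mat_mult[OF poly_mat_group(2) poly_mat_const[OF A]]
            poly_mat_adjugate[OF poly_mat_group(1)]] ij])
    fix g :: "'k mat \<times> 'k mat" assume g: "g \<in> carrier (lomadze_group n p)"
    have g0: "fst g \<in> carrier (gl n)" "fst g \<in> carrier_mat n n" and g1: "snd g \<in> carrier_mat (n + p) (n + p)"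
      using g by (cases g; auto simp: carrier_lomadze_group carrier_gl)+
    have gA: "snd g * A \<in> carrier_mat (n + p) n" by (rule mult_carrier_mat[OF g1 A])
    have "?P A g = Determinant.det (fst g) \<cdot>\<^sub>m (snd g * A * inv\<^bsub>gl n\<^esub> (fst g))"
      using g0 g1 by (simp add: adjugate_gl mult_smult_distrib[OF gA inv_gl(1)])
    then show "?P A g $$ (i, j) = Determinant.det (crop n n (fst g)) ^ 1 * (snd g * A * inv\<^bsub>gl n\<^esub> (fst g)) $$ (i, j)"
      using g0(2) smult_mat_index[OF mult_carrier_mat[OF gA inv_gl(1)[OF g0(1)]] ij] by simp
  qed
  have right: "\<exists>H \<in> polyfuns ?G. \<exists>k. \<forall>g \<in> carrier (lomadze_group n p).
      H g = Determinant.det (crop n n (fst g)) ^ k * (snd g * M) $$ (i, j)"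
    if ij: "i < n + p" "j < p + m" for i j
  proof (intro bexI[of _ "\<lambda>g. (crop (n + p) (n + p) (snd g) * M) $$ (i, j)"] exI[of _ 0] ballI)
    show "(\<lambda>g. (crop (n + p) (n + p) (snd g) * M) $$ (i, j)) \<in> polyfuns ?G"
      by (rule poly_mat_entry[OF poly_mat_mult[OF poly_mat_group(2) poly_mat_const[OF M]] ij])
    fix g :: "'k mat \<times> 'k mat" assume g: "g \<in> carrier (lomadze_group n p)"
    have "snd g \<in> carrier_mat (n + p) (n + p)"
      using g by (cases g) (auto simp: carrier_lomadze_group carrier_gl)
    then show "(crop (n + p) (n + p) (snd g) * M) $$ (i, j) =
        Determinant.det (crop n n (fst g)) ^ 0 * (snd g * M) $$ (i, j)" by simp
  qed
  have act: "act n g x = (snd g * K * inv\<^bsub>gl n\<^esub> (fst g), snd g * L * inv\<^bsub>gl n\<^esub> (fst g), snd g * M)" for g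
    by (cases g) (simp add: xd)
  from c consider
    i j where "c = (\<lambda>(K, L, M). K $$ (i, j))" "i < n + p" "j < n"
    | i j where "c = (\<lambda>(K, L, M). L $$ (i, j))" "i < n + p" "j < n"
    | i j where "c = (\<lambda>(K, L, M). M $$ (i, j))" "i < n + p" "j < p + m"
    unfolding lomadze_coords_def by blast
  then show ?thesis
  proof cases
    case 1
    then show ?thesis using left[OF K 1(2,3)] by (simp only: act prod.case)
  next
    case 2
    then show ?thesis using left[OF L 2(2,3)] by (simp only: act prod.case)
  next
    case 3
    then show ?thesis using right[OF 3(2,3)] by (simp only: act prod.case)
  qed
qed

text \<open>Where \<delta> \<noteq> 0, the quotients of \<Gamma>0 and \<Gamma>1 by \<delta> recover
  the group element from the orbit point: a rational inverse of the orbit map near any prescribed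
  point.\<close>

lemma orbit_map_properties:
  fixes x :: "'k :: field lomadze"
  assumes x: "x \<in> lomadze_space n m p"
    and num: "\<And>g. g \<in> carrier (lomadze_group n p) \<Longrightarrow> numerically_stable n m p a b (act n g x)"
    and g: "g \<in> carrier (lomadze_group n p)"
  shows "\<exists>\<delta> \<in> polyfuns (lomadze_coords n m p). \<exists>\<Gamma>0 \<Gamma>1. \<delta> (act n g x) \<noteq> 0 \<and>
    poly_mat (lomadze_coords n m p) n n \<Gamma>0 \<and> poly_mat (lomadze_coords n m p) (n + p) (n + p) \<Gamma>1 \<and>
    (\<forall>h \<in> carrier (lomadze_group n p). \<Gamma>0 (act n h x) = \<delta> (act n h x) \<cdot>\<^sub>m fst h \<and>
      \<Gamma>1 (act n h x) = \<delta> (act n h x) \<cdot>\<^sub>m snd h)"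
proof -
  obtain K L M where xd: "x = (K, L, M)" by (cases x)
  obtain K0 L0 M0 where yd: "act n g x = (K0, L0, M0)" by (cases "act n g x")
  note xs = x[unfolded xd]
  have ys: "(K0, L0, M0) \<in> lomadze_space n m p" using act_closed[OF g x] yd by simp
  have nx: "numerically_stable n m p a b (K, L, M)"
    using num[OF group.is_monoid[OF group_lomadze_group, THEN monoid.one_closed]] act_one[OF x] xd by simp
  have ny: "numerically_stable n m p a b (K0, L0, M0)" using num[OF g] yd by simp
  obtain \<delta> \<Gamma>0 \<Gamma>1 where \<delta>: "\<delta> \<in> polyfuns (lomadze_coords n m p)"
    and \<Gamma>: "poly_mat (lomadze_coords n m p) n n \<Gamma>0" "poly_mat (lomadze_coords n m p) (n + p) (n + p) \<Gamma>1"
    and nz: "\<delta> (K0, L0, M0) \<noteq> 0"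
    and sol: "\<forall>K' L' M' H0 H1. (K', L', M') \<in> lomadze_space n m p \<longrightarrow>
       H0 \<in> carrier_mat n n \<longrightarrow> H1 \<in> carrier_mat (n + p) (n + p) \<longrightarrow>
       H1 * K = K' * H0 \<longrightarrow> H1 * L = L' * H0 \<longrightarrow> H1 * M = M' \<longrightarrow>
       \<Gamma>0 (K', L', M') = \<delta> (K', L', M') \<cdot>\<^sub>m H0 \<and> \<Gamma>1 (K', L', M') = \<delta> (K', L', M') \<cdot>\<^sub>m H1"
    using rational_intertwiner[OF xs ys nx ny] by blast
  have "\<Gamma>0 (act n h x) = \<delta> (act n h x) \<cdot>\<^sub>m fst h \<and> \<Gamma>1 (act n h x) = \<delta> (act n h x) \<cdot>\<^sub>m snd h"
    if h: "h \<in> carrier (lomadze_group n p)" for h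
  proof -
    obtain h0 h1 where hd: "h = (h0, h1)" by (cases h)
    obtain K' L' M' where zd: "act n h x = (K', L', M')" by (cases "act n h x")
    have zs: "(K', L', M') \<in> lomadze_space n m p" using act_closed[OF h x] zd by simp
    have eqs: "h1 * K = K' * h0" "h1 * L = L' * h0" "h1 * M = M'"
      using act_eq_iff[OF xs zs h[unfolded hd]] zd xd hd by simp_all
    have car: "h0 \<in> carrier_mat n n" "h1 \<in> carrier_mat (n + p) (n + p)"
      using h by (auto simp: hd carrier_lomadze_group carrier_gl)
    show ?thesis unfolding zd unfolding hd fst_conv snd_conv by (rule sol[rule_format, OF zs car eqs])
  qed
  then show ?thesis using \<delta> \<Gamma> nz yd by (intro bexI[OF _ \<delta>] exI[of _ \<Gamma>0] exI[of _ \<Gamma>1]) simp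
qed

text \<open>Two group elements with the same orbit point are recovered from it by the same
  quotients.\<close>

lemma orbit_map_inj:
  fixes x :: "'k :: field lomadze"
  assumes x: "x \<in> lomadze_space n m p"
    and num: "\<And>g. g \<in> carrier (lomadze_group n p) \<Longrightarrow> numerically_stable n m p a b (act n g x)"
  shows "inj_on (\<lambda>g. act n g x) (carrier (lomadze_group n p))"
proof (rule inj_onI)
  fix g h :: "'k mat \<times> 'k mat"
  assume g: "g \<in> carrier (lomadze_group n p)" and h: "h \<in> carrier (lomadze_group n p)"
    and eq: "act n g x = act n h x"
  obtain \<delta> \<Gamma>0 \<Gamma>1 where nz: "\<delta> (act n g x) \<noteq> 0"
    and sol: "\<forall>h \<in> carrier (lomadze_group n p). \<Gamma>0 (act n h x) = \<delta> (act n h x) \<cdot>\<^sub>m fst h \<and>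
      \<Gamma>1 (act n h x) = \<delta> (act n h x) \<cdot>\<^sub>m snd h"
    using orbit_map_properties[OF x num g] by blast
  have car: "fst g \<in> carrier_mat n n" "fst h \<in> carrier_mat n n"
    "snd g \<in> carrier_mat (n + p) (n + p)" "snd h \<in> carrier_mat (n + p) (n + p)"
    using g h by (cases g; cases h; auto simp: carrier_lomadze_group carrier_gl)+
  have "\<delta> (act n g x) \<cdot>\<^sub>m fst g = \<delta> (act n g x) \<cdot>\<^sub>m fst h"
    "\<delta> (act n g x) \<cdot>\<^sub>m snd g = \<delta> (act n g x) \<cdot>\<^sub>m snd h"
    using bspec[OF sol g] bspec[OF sol h] eq by auto
  then show "g = h" using smult_mat_cancel[OF nz] car by (metis prod.expand)
qed

text \<open>Continuity and openness both amount to rewriting a polynomial on one side as a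
  polynomial on the other after clearing a denominator: det g0 in one direction, \<delta> in the
  other.\<close>

lemma orbit_map_homeomorphic:
  fixes x :: "'k :: field lomadze"
  assumes x: "x \<in> lomadze_space n m p"
    and num: "\<And>g. g \<in> carrier (lomadze_group n p) \<Longrightarrow> numerically_stable n m p a b (act n g x)"
  shows "homeomorphic_map (group_top n p)
    (subtopology (lomadze_top n m p) (lomadze_orbit n p x)) (\<lambda>g. act n g x)"
proof -
  let ?G = "carrier (lomadze_group n p) :: ('k mat \<times> 'k mat) set" and ?\<phi> = "\<lambda>g. act n g x"
  let ?C = "lomadze_coords n m p :: ('k lomadze \<Rightarrow> 'k) set"
    and ?D = "group_coords n p :: ('k mat \<times> 'k mat \<Rightarrow> 'k) set"
  have orb: "lomadze_orbit n p x = ?\<phi> ` ?G" by (rule lomadze_orbit_eq)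
  have top: "topspace (group_top n p) = ?G" by (simp add: group_top_def topspace_zariski)
  have sub: "lomadze_orbit n p x \<subseteq> lomadze_space n m p" using act_closed[OF _ x] by (auto simp: orb)
  then have top': "topspace (subtopology (lomadze_top n m p) (lomadze_orbit n p x)) = lomadze_orbit n p x"
    by (auto simp: lomadze_top_def topspace_zariski topspace_subtopology)
  have "openin (group_top n p) {g \<in> ?G. ?\<phi> g \<in> U}"
    if U: "openin (subtopology (lomadze_top n m p) (lomadze_orbit n p x)) U" for U
    unfolding group_top_def openin_zariski_iff
  proof (intro conjI ballI)
    fix g assume "g \<in> {g \<in> ?G. ?\<phi> g \<in> U}"
    then have g: "g \<in> ?G" "?\<phi> g \<in> U" by auto
    obtain f where f: "f \<in> polyfuns ?C" "f (?\<phi> g) \<noteq> 0"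
      and fU: "\<forall>y \<in> lomadze_space n m p \<inter> lomadze_orbit n p x. f y \<noteq> 0 \<longrightarrow> y \<in> U"
      using U g(2) unfolding lomadze_top_def openin_subtopology_zariski by blast
    have D: "(\<lambda>g. Determinant.det (crop n n (fst g))) \<in> polyfuns ?D"
      by (rule polyfuns_det[OF poly_mat_group(1)])
    \<comment> \<open>Here the polynomial is moved from the orbit to the group, so the new variable
      is the group element itself.\<close>
    have "\<exists>H \<in> polyfuns ?D. \<exists>k. \<forall>g\<in>?G. H (id g) =
        (\<lambda>g. Determinant.det (crop n n (fst g))) (id g) ^ k * f (?\<phi> g)"
      by (rule polyfuns_pullback[OF f(1) D]) (simp only: id_apply act_polynomial[OF x])
    then obtain H k where H: "H \<in> polyfuns ?D"
      "\<forall>g\<in>?G. H g = Determinant.det (crop n n (fst g)) ^ k * f (?\<phi> g)" by auto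
    have "Determinant.det (crop n n (fst g)) \<noteq> 0"
      using g(1) by (cases g) (auto simp: carrier_lomadze_group carrier_gl)
    then have "H g \<noteq> 0" using H(2) g(1) f(2) by simp
    moreover have "h \<in> {g \<in> ?G. ?\<phi> g \<in> U}" if "h \<in> ?G" "H h \<noteq> 0" for h
    proof -
      have "f (?\<phi> h) \<noteq> 0" using H(2) that by auto
      then show ?thesis using fU sub that(1) orb by blast
    qed
    ultimately show "\<exists>f\<in>polyfuns ?D. f g \<noteq> 0 \<and> (\<forall>y\<in>?G. f y \<noteq> 0 \<longrightarrow> y \<in> {g \<in> ?G. ?\<phi> g \<in> U})"
      using H(1) by blast
  qed blast
  moreover have "openin (subtopology (lomadze_top n m p) (lomadze_orbit n p x)) U"
    if U: "U \<subseteq> lomadze_orbit n p x" and pre: "openin (group_top n p) {g \<in> ?G. ?\<phi> g \<in> U}" for U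
    unfolding lomadze_top_def openin_subtopology_zariski
  proof (intro conjI ballI)
    show "U \<subseteq> lomadze_space n m p \<inter> lomadze_orbit n p x" using U sub by blast
    fix y assume y: "y \<in> U"
    then obtain g where g: "g \<in> ?G" "y = ?\<phi> g" using U orb by blast
    obtain h where h: "h \<in> polyfuns ?D" "h g \<noteq> 0" "\<forall>g'\<in>?G. h g' \<noteq> 0 \<longrightarrow> ?\<phi> g' \<in> U"
      using pre g y unfolding group_top_def openin_zariski_iff by blast
    obtain \<delta> \<Gamma>0 \<Gamma>1 where \<delta>: "\<delta> \<in> polyfuns ?C" and nz: "\<delta> (?\<phi> g) \<noteq> 0"
      and \<Gamma>: "poly_mat ?C n n \<Gamma>0" "poly_mat ?C (n + p) (n + p) \<Gamma>1"
      and sol: "\<forall>h \<in> ?G. \<Gamma>0 (?\<phi> h) = \<delta> (?\<phi> h) \<cdot>\<^sub>m fst h \<and> \<Gamma>1 (?\<phi> h) = \<delta> (?\<phi> h) \<cdot>\<^sub>m snd h"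
      using orbit_map_properties[OF x num g(1)] by blast
    \<comment> \<open>The reverse direction: a polynomial in the group element is expressed through
      its orbit point, using \<open>sol\<close>.\<close>
    have "\<exists>H \<in> polyfuns ?C. \<exists>k. \<forall>g\<in>?G. H (?\<phi> g) = \<delta> (?\<phi> g) ^ k * h (id g)"
    proof (rule polyfuns_pullback[OF h(1) \<delta>])
      fix c assume "c \<in> ?D"
      then consider i j where "c = (\<lambda>(g0, g1). g0 $$ (i, j))" "i < n" "j < n"
        | i j where "c = (\<lambda>(g0, g1). g1 $$ (i, j))" "i < n + p" "j < n + p"
        unfolding group_coords_def by blast
      then show "\<exists>H \<in> polyfuns ?C. \<exists>k. \<forall>g\<in>?G. H (?\<phi> g) = \<delta> (?\<phi> g) ^ k * c (id g)"
      proof cases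
        case 1
        show ?thesis
        proof (intro bexI[OF _ poly_mat_entry[OF \<Gamma>(1) 1(2,3)]] exI[of _ 1] ballI)
          fix g assume g: "g \<in> ?G"
          then have "fst g \<in> carrier_mat n n" by (cases g) (auto simp: carrier_lomadze_group carrier_gl)
          then show "\<Gamma>0 (?\<phi> g) $$ (i, j) = \<delta> (?\<phi> g) ^ 1 * c (id g)"
            using sol g 1 by (simp add: case_prod_unfold)
        qed
      next
        case 2
        show ?thesis
        proof (intro bexI[OF _ poly_mat_entry[OF \<Gamma>(2) 2(2,3)]] exI[of _ 1] ballI)
          fix g assume g: "g \<in> ?G"
          then have "snd g \<in> carrier_mat (n + p) (n + p)"
            by (cases g) (auto simp: carrier_lomadze_group carrier_gl)
          then show "\<Gamma>1 (?\<phi> g) $$ (i, j) = \<delta> (?\<phi> g) ^ 1 * c (id g)"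
            using sol g 2 by (simp add: case_prod_unfold)
        qed
      qed
    qed
    then obtain H k where H: "H \<in> polyfuns ?C" "\<forall>g\<in>?G. H (?\<phi> g) = \<delta> (?\<phi> g) ^ k * h g" by auto
    have "(\<lambda>y. \<delta> y * H y) \<in> polyfuns ?C" by (rule polyfuns.mult[OF \<delta> H(1)])
    moreover have "\<delta> y * H y \<noteq> 0" using nz H(2) g h(2) by simp
    moreover have "z \<in> U" if z: "z \<in> lomadze_orbit n p x" and nz': "\<delta> z * H z \<noteq> 0" for z
    proof -
      obtain g' where g': "g' \<in> ?G" "z = ?\<phi> g'" using z orb by blast
      then have "h g' \<noteq> 0" using nz' H(2) by auto
      then show ?thesis using h(3) g' by blast
    qed
    ultimately show "\<exists>f\<in>polyfuns ?C. f y \<noteq> 0 \<and>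
        (\<forall>y\<in>lomadze_space n m p \<inter> lomadze_orbit n p x. f y \<noteq> 0 \<longrightarrow> y \<in> U)"
      by (intro bexI[of _ "\<lambda>y. \<delta> y * H y"]) auto
  qed
  ultimately show ?thesis
    unfolding homeomorphic_map_def quotient_map_def top top'
    using orbit_map_inj[OF x num] orb by auto
qed

text \<open>If two elements lie in one coset of the kernel, they move \<open>x\<close> to the same
  point and hence coincide. The quotient map is thus injective, and an injective quotient map is a
  homeomorphism.\<close>

lemma coset_map_homeomorphic:
  fixes x :: "'k :: field lomadze"
  assumes x: "x \<in> lomadze_space n m p"
    and num: "\<And>g. g \<in> carrier (lomadze_group n p) \<Longrightarrow> numerically_stable n m p a b (act n g x)"
  shows "homeomorphic_map (group_top n p)
    (quotient_topology (group_top n p :: ('k mat \<times> 'k mat) topology)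
      (\<lambda>g. act_kernel n m p #>\<^bsub>lomadze_group n p\<^esub> g))
    (\<lambda>g. act_kernel n m p #>\<^bsub>lomadze_group n p\<^esub> g)"
  unfolding homeomorphic_map_def
proof (intro conjI quotient_map_quotient_topology inj_onI)
  interpret group "lomadze_group n p :: ('k mat \<times> 'k mat) monoid" by (rule group_lomadze_group)
  fix g h :: "'k mat \<times> 'k mat"
  assume "g \<in> topspace (group_top n p)" "h \<in> topspace (group_top n p)"
    and eq: "act_kernel n m p #>\<^bsub>lomadze_group n p\<^esub> g = act_kernel n m p #>\<^bsub>lomadze_group n p\<^esub> h"
  then have g: "g \<in> carrier (lomadze_group n p)" and h: "h \<in> carrier (lomadze_group n p)"
    by (auto simp: group_top_def topspace_zariski)
  have "\<one>\<^bsub>lomadze_group n p\<^esub> \<in> (act_kernel n m p :: ('k mat \<times> 'k mat) set)"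
    by (simp add: act_kernel_def act_one)
  then have "\<one>\<^bsub>lomadze_group n p\<^esub> \<otimes>\<^bsub>lomadze_group n p\<^esub> g \<in> act_kernel n m p #>\<^bsub>lomadze_group n p\<^esub> g"
    unfolding r_coset_def by blast
  then have "g \<in> act_kernel n m p #>\<^bsub>lomadze_group n p\<^esub> h" using g eq by simp
  then obtain k where k: "k \<in> act_kernel n m p" "g = k \<otimes>\<^bsub>lomadze_group n p\<^esub> h"
    unfolding r_coset_def by blast
  have kc: "k \<in> carrier (lomadze_group n p)" using k(1) by (simp add: act_kernel_def)
  have "act n g x = act n k (act n h x)" unfolding k(2) by (rule act_mult[OF kc h x])
  also have "\<dots> = act n h x" using k(1) act_closed[OF h x] by (simp add: act_kernel_def)
  finally show "g = h" using orbit_map_inj[OF x num] g h by (simp add: inj_on_def)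
qed

text \<open>The semi-invariant that witnesses semistability also witnesses stability: every point
  where it does not vanish is semistable, hence numerically stable, so the results on orbits apply
  to all of them at once.\<close>

lemma char_stable_of_semistable:
  fixes S :: "'k :: field_char_0 lomadze"
  assumes S: "S \<in> lomadze_space n m p" and gen: "generic_slope n p a b"
    and ss: "char_semistable n m p (- int a) (int b) S"
  shows "char_stable n m p (- int a) (int b) S"
proof -
  obtain N f where N: "1 \<le> N" and f: "f \<in> semi_invariants n m p (- int a) (int b) N" and nz: "f S \<noteq> 0"
    using ss by (auto simp: char_semistable_def)
  have num: "numerically_stable n m p a b y" if "y \<in> lomadze_space n m p" "f y \<noteq> 0" for y
    by (rule numerically_stable_of_semistable[OF that(1) gen])
      (use N f that(2) in \<open>auto simp: char_semistable_def\<close>)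
  have orbit_num: "numerically_stable n m p a b (act n g S)" if g: "g \<in> carrier (lomadze_group n p)" for g
  proof (rule num[OF act_closed[OF g S]])
    have "character (- int a) (int b) g \<noteq> 0"
      using g by (cases g) (auto simp: carrier_lomadze_group carrier_gl)
    then show "f (act n g S) \<noteq> 0" using f g S nz by (simp add: semi_invariants_def)
  qed
  have "krull_dim (subtopology (lomadze_top n m p) (lomadze_orbit n p S)) =
      dim_group_mod_kernel TYPE('k) n m p"
    unfolding dim_group_mod_kernel_def
    using krull_dim_homeomorphic[OF orbit_map_homeomorphic[OF S orbit_num]]
      krull_dim_homeomorphic[OF coset_map_homeomorphic[OF S orbit_num]] by simp
  then show ?thesis
    unfolding char_stable_def
    using N f nz orbit_closed_in_semistable[OF f num] by blast
qed

lemma char_semistable_iff_numerically_stable: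
  fixes S :: "'k :: field_char_0 lomadze"
  assumes S: "S \<in> lomadze_space n m p" and gen: "generic_slope n p a b" and n: "0 < n"
  shows "char_semistable n m p (- int a) (int b) S \<longleftrightarrow> numerically_stable n m p a b S"
proof
  show "char_semistable n m p (- int a) (int b) S" if num: "numerically_stable n m p a b S"
  proof -
    obtain K L M where Sd: "S = (K, L, M)" by (cases S)
    \<comment> \<open>Genericity at u = v = 1, which is available because n > 0.\<close>
    have "a * 1 \<noteq> b * 1" 
      using gen[unfolded generic_slope_def, THEN conjunct2, THEN conjunct2, rule_format, of 1 1] n
      by simp
    then show ?thesis
      using char_semistable_of_expanding[OF S[unfolded Sd]
          expanding_of_numerically_stable[OF S[unfolded Sd] num[unfolded Sd]]
          expanding_transpose_of_numerically_stable[OF S[unfolded Sd] num[unfolded Sd]]] gen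
      by (simp add: Sd generic_slope_def)
  qed
qed (rule numerically_stable_of_semistable[OF S gen])

text \<open>\<open>P\<close> stands for upper or lower stability. Semistability provides one pair of
  slope \<chi>, while stability may be proved with any such pair; \<open>P\<close> bridges the two,
  being equivalent to the numerical criterion for every pair.\<close>

lemma slope_stability_equivalence:
  fixes S :: "'k :: field_char_0 lomadze"
  assumes S: "S \<in> lomadze_space n m p" and n: "0 < n"
    and chi: "\<chi> \<in> slopes" "\<chi> \<notin> Lambda_set n p"
    and P: "\<And>a b. \<chi> = ratio (int a) (int b) \<Longrightarrow> generic_slope n p a b \<Longrightarrow> P \<longleftrightarrow> numerically_stable n m p a b S"
  shows "(P \<longleftrightarrow> slope_stable n m p \<chi> S) \<and> (slope_stable n m p \<chi> S \<longleftrightarrow> slope_semistable n m p \<chi> S)"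
proof -
  have "slope_semistable n m p \<chi> S" if "slope_stable n m p \<chi> S"
    using that unfolding slope_stable_def slope_semistable_def char_stable_def char_semistable_def by blast
  moreover have "P" if "slope_semistable n m p \<chi> S"
  proof -
    obtain \<chi>0 \<chi>1 where pair: "slope_pair \<chi> \<chi>0 \<chi>1" and ss: "char_semistable n m p \<chi>0 \<chi>1 S"
      using \<open>slope_semistable n m p \<chi> S\<close> unfolding slope_semistable_def by blast
    obtain a b where ab: "\<chi>0 = - int a" "\<chi>1 = int b" "\<chi> = ratio (int a) (int b)" "generic_slope n p a b"
      by (rule slope_pair_generic[OF n chi(2) pair])
    show P using P[OF ab(3,4)] char_semistable_iff_numerically_stable[OF S ab(4) n] ss ab(1,2) by simp
  qed
  moreover have "slope_stable n m p \<chi> S" if P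
  proof -
    obtain \<chi>0 \<chi>1 where pair: "slope_pair \<chi> \<chi>0 \<chi>1" using slope_pair_exists[OF chi(1)] by blast
    obtain a b where ab: "\<chi>0 = - int a" "\<chi>1 = int b" "\<chi> = ratio (int a) (int b)" "generic_slope n p a b"
      by (rule slope_pair_generic[OF n chi(2) pair])
    have "char_semistable n m p (- int a) (int b) S"
      using P[OF ab(3,4)] char_semistable_iff_numerically_stable[OF S ab(4) n] \<open>P\<close> by simp
    then show ?thesis
      using char_stable_of_semistable[OF S ab(4)] pair ab(1,2) unfolding slope_stable_def by blast
  qed
  ultimately show ?thesis by blast
qed

theorem proposition2p8:
  fixes n m p :: nat
    and l \<chi> :: "rat extended"
    and S :: "'k :: {alg_closed_field, field_char_0} lomadze"
  assumes "n > 0"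
    and "l \<in> Lambda_set n p"
    and "S \<in> lomadze_space n m p"
  shows "(\<chi> \<in> Delta_plus n p l \<longrightarrow>
            (upperstable n m p l S \<longleftrightarrow> slope_stable n m p \<chi> S) \<and>
            (slope_stable n m p \<chi> S \<longleftrightarrow> slope_semistable n m p \<chi> S)) \<and>
         (\<chi> \<in> Delta_minus n p l \<longrightarrow>
            (lowerstable n m p l S \<longleftrightarrow> slope_stable n m p \<chi> S) \<and>
            (slope_stable n m p \<chi> S \<longleftrightarrow> slope_semistable n m p \<chi> S))"
proof (intro conjI impI)
  assume D: "\<chi> \<in> Delta_plus n p l"
  have "\<chi> \<in> slopes" using D by (simp add: Delta_plus_def)
  note eq = slope_stability_equivalence[OF assms(3,1) this Delta_not_Lambda[OF disjI1[OF D]]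
      numerically_stable_iff_upperstable[OF _ _ D]]
  show "upperstable n m p l S \<longleftrightarrow> slope_stable n m p \<chi> S" by (rule conjunct1[OF eq])
  show "slope_stable n m p \<chi> S \<longleftrightarrow> slope_semistable n m p \<chi> S" by (rule conjunct2[OF eq])
next
  assume D: "\<chi> \<in> Delta_minus n p l"
  have "\<chi> \<in> slopes" using D by (simp add: Delta_minus_def)
  note eq = slope_stability_equivalence[OF assms(3,1) this Delta_not_Lambda[OF disjI2[OF D]]
      numerically_stable_iff_lowerstable[OF _ _ D]]
  show "lowerstable n m p l S \<longleftrightarrow> slope_stable n m p \<chi> S" by (rule conjunct1[OF eq])
  show "slope_stable n m p \<chi> S \<longleftrightarrow> slope_semistable n m p \<chi> S" by (rule conjunct2[OF eq])
qed

end
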